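(* The problem \[ \min_{\mathbf{x}\in\mathcal{X}} \ \alpha\sum_{j\in E} c^I_j x_j + (1-\alpha)\sum_{i\in[N]}\tilde{\lambda}_i\, H\bigl(\chi_{E'}(\mathbf{x}),\chi_{E'}(\mathbf{x}^i)\bigr) \] can be solved in polynomial time in each of the following two cases: (i) the shortest path problem in directed acyclic graphs, i.e. $\mathcal{X}\subseteq\{0,1\}^{E}$ is the set of characteristic vectors of $s$-$t$ paths in a given directed acyclic graph $G=(V,E)$ with $s,t\in V$; (ii) the minimum spanning tree problem, i.e. $\mathcal{X}\subseteq\{0,1\}^{E}$ is the set of characteristic vectors of spanning trees of a given undirected graph $G=(V,E)$.
   Context: Notation: $[N]=\{1,\ldots,N\}$. The elements (items) are the edges of the given graph; $c^I_j$ is the cost of edge $j$ in the current instance $I$ (in the shortest path problem the edge weights are non-negative). There are $N>0$ historic solutions $\mathbf{x}^1,\ldots,\mathbf{x}^N\in\mathcal{X}$ with weights $\tilde{\lambda}_1,\ldots,\tilde{\lambda}_N\in\mathbb{R}$, which are part of the input and may be positive, zero or negative. The scalarization weight is $\alpha\in(0,1)$. All numerical input data are rational. $E'\subseteq E$ is a given set of important edges (possibly $E'=E$), and $\chi_{E'}(\mathbf{x})=(x_j)_{j\in E'}\in\{0,1\}^{|E'|}$ indicates for each edge of $E'$ whether the solution $\mathbf{x}$ contains it. $H:\{0,1\}^{|E'|}\times\{0,1\}^{|E'|}\to\mathbb{N}$ is the Hamming distance (number of coordinates in which the two vectors differ). *)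

theory Defs
  imports
    "HOL-Computational_Algebra.Polynomial"
    "HOL-Library.FuncSet"
    "HOL-Library.Log_Nat"
    "Graph_Theory.Pair_Digraph"
begin

section \<open>Polynomial time: random access machine with logarithmic cost\<close>

text \<open>
  The machine model is the random access machine of Cook and Reckhow and of Aho, Hopcroft and
  Ullman: integer registers, indirect addressing, addition, subtraction and multiplication, a
  read-only input tape and a write-only output tape of integers, and the logarithmic cost
  criterion (every operation is charged the number of bits of the integers and of the
  addresses it handles). With this cost criterion polynomial time on the machine is the same
  as polynomial time on a Turing machine. Two inessential deviations from the textbook
  presentation: control flow is structured instead of given by jumps, and the right-hand sides
  of instructions may be nested expressions. Registers may have negative addresses.
\<close>

definition int_bits :: "int \<Rightarrow> nat" where
  "int_bits z = nat (bitlen \<bar>z\<bar>) + 1"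

datatype exp =
    Const int
  | Cell exp
  | Plus exp exp
  | Minus exp exp
  | Times exp exp

datatype com =
    Skip
  | Assign exp exp
  | Read exp
  | Write exp
  | Seq com com
  | Cond exp com com
  | While exp com

type_synonym memory = "int \<Rightarrow> int"

text \<open>A machine state consists of the memory, the unread input and the output so far.\<close>

type_synonym state = "memory \<times> int list \<times> int list"

primrec eval :: "exp \<Rightarrow> memory \<Rightarrow> int" where
  "eval (Const k) m = k"
| "eval (Cell a) m = m (eval a m)"
| "eval (Plus e f) m = eval e m + eval f m"
| "eval (Minus e f) m = eval e m - eval f m"
| "eval (Times e f) m = eval e m * eval f m"

text \<open>
  The cost of an expression is the total number of bits of the values of all its
  subexpressions; since the address of an accessed register is the value of a subexpression,
  it is charged, too.
\<close>

primrec eval_cost :: "exp \<Rightarrow> memory \<Rightarrow> nat" where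
  "eval_cost (Const k) m = int_bits k"
| "eval_cost (Cell a) m = eval_cost a m + int_bits (m (eval a m))"
| "eval_cost (Plus e f) m = eval_cost e m + eval_cost f m + int_bits (eval e m + eval f m)"
| "eval_cost (Minus e f) m = eval_cost e m + eval_cost f m + int_bits (eval e m - eval f m)"
| "eval_cost (Times e f) m = eval_cost e m + eval_cost f m + int_bits (eval e m * eval f m)"

text \<open>
  \<open>exec c s t s'\<close>: started in state \<open>s\<close>, the program \<open>c\<close> terminates in state \<open>s'\<close> and
  the run has cost \<open>t\<close>. Conditions are tests for a positive value. Reading from the exhausted
  input tape yields 0.
\<close>

inductive exec :: "com \<Rightarrow> state \<Rightarrow> nat \<Rightarrow> state \<Rightarrow> bool" where
  Skip: "exec Skip s 1 s"
| Assign: "exec (Assign a e) (m, inp, out) (eval_cost a m + eval_cost e m + 1)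
     (m(eval a m := eval e m), inp, out)"
| Read_Cons: "exec (Read a) (m, v # inp, out) (eval_cost a m + int_bits v + 1)
     (m(eval a m := v), inp, out)"
| Read_Nil: "exec (Read a) (m, [], out) (eval_cost a m + int_bits 0 + 1)
     (m(eval a m := 0), [], out)"
| Write: "exec (Write e) (m, inp, out) (eval_cost e m + 1) (m, inp, out @ [eval e m])"
| Seq: "exec c1 s1 t1 s2 \<Longrightarrow> exec c2 s2 t2 s3 \<Longrightarrow> exec (Seq c1 c2) s1 (t1 + t2 + 1) s3"
| Cond_True: "eval e (fst s) > 0 \<Longrightarrow> exec c1 s t s' \<Longrightarrow>
     exec (Cond e c1 c2) s (eval_cost e (fst s) + t + 1) s'"
| Cond_False: "eval e (fst s) \<le> 0 \<Longrightarrow> exec c2 s t s' \<Longrightarrow>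
     exec (Cond e c1 c2) s (eval_cost e (fst s) + t + 1) s'"
| While_True: "eval e (fst s1) > 0 \<Longrightarrow> exec c s1 t1 s2 \<Longrightarrow> exec (While e c) s2 t2 s3 \<Longrightarrow>
     exec (While e c) s1 (eval_cost e (fst s1) + t1 + t2 + 1) s3"
| While_False: "eval e (fst s) \<le> 0 \<Longrightarrow>
     exec (While e c) s (eval_cost e (fst s) + 1) s"

inductive_cases exec_SkipE: "exec Skip s t s'"
inductive_cases exec_AssignE: "exec (Assign a e) s t s'"
inductive_cases exec_ReadE: "exec (Read a) s t s'"
inductive_cases exec_WriteE: "exec (Write e) s t s'"
inductive_cases exec_SeqE: "exec (Seq c1 c2) s t s'"
inductive_cases exec_CondE: "exec (Cond e c1 c2) s t s'"
inductive_cases exec_WhileE: "exec (While e c) s t s'"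

lemma exec_deterministic:
  "exec c s t s' \<Longrightarrow> exec c s u s'' \<Longrightarrow> u = t \<and> s'' = s'"
proof (induction arbitrary: u s'' rule: exec.induct)
  case (Seq c1 s1 t1 s2 c2 t2 s3)
  from Seq.prems obtain u1 u2 r where *: "u = u1 + u2 + 1" "exec c1 s1 u1 r" "exec c2 r u2 s''"
    by (rule exec_SeqE) simp
  with Seq.IH(1)[OF *(2)] Seq.IH(2)[of u2 s''] show ?case by simp
next
  case (Cond_True e s c1 t s' c2)
  from Cond_True.prems Cond_True.hyps(1)
  obtain u1 where *: "u = eval_cost e (fst s) + u1 + 1" "exec c1 s u1 s''"
    by (auto elim: exec_CondE)
  with Cond_True.IH[OF *(2)] show ?case by simp
next
  case (Cond_False e s c2 t s' c1)
  from Cond_False.prems Cond_False.hyps(1)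
  obtain u1 where *: "u = eval_cost e (fst s) + u1 + 1" "exec c2 s u1 s''"
    by (auto elim: exec_CondE)
  with Cond_False.IH[OF *(2)] show ?case by simp
next
  case (While_True e s1 c t1 s2 t2 s3)
  from While_True.prems While_True.hyps(1)
  obtain u1 u2 r where *: "u = eval_cost e (fst s1) + u1 + u2 + 1"
      "exec c s1 u1 r" "exec (While e c) r u2 s''"
    by (auto elim: exec_WhileE)
  with While_True.IH(1)[OF *(2)] While_True.IH(2)[of u2 s''] show ?case by simp
next
  case (While_False e s c)
  from While_False.prems While_False.hyps show ?case by (auto elim: exec_WhileE)
next
  case (Skip s)
  then show ?case by (rule exec_SkipE) simp
next
  case (Assign a e m inp out)
  then show ?case by (rule exec_AssignE) simp
next
  case (Read_Cons a m v inp out)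
  then show ?case by (rule exec_ReadE) simp_all
next
  case (Read_Nil a m out)
  then show ?case by (rule exec_ReadE) simp_all
next
  case (Write e m inp out)
  then show ?case by (rule exec_WriteE) simp
qed

definition run :: "com \<Rightarrow> int list \<Rightarrow> nat \<Rightarrow> int list \<Rightarrow> bool" where
  "run c input t output \<longleftrightarrow>
     (\<exists>m rest. exec c ((\<lambda>_. 0), input, []) t (m, rest, output))"

definition input_size :: "int list \<Rightarrow> nat" where
  "input_size zs = (\<Sum>z\<leftarrow>zs. int_bits z)"

text \<open>
  A minimization problem is given by its instances, their encoding as an input, the feasible
  set and the objective function of every instance, and the encoding of solutions as outputs.
  One program has to output an optimal solution for every instance.
\<close>

definition polynomial_time_minimizable ::
  "'i set \<Rightarrow> ('i \<Rightarrow> int list) \<Rightarrow> ('i \<Rightarrow> 'x set) \<Rightarrow> ('i \<Rightarrow> 'x \<Rightarrow> rat) \<Rightarrow> ('i \<Rightarrow> 'x \<Rightarrow> int list) \<Rightarrow> bool"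
where
  "polynomial_time_minimizable insts enc feasible obj enc_sol \<longleftrightarrow>
     (\<exists>(c :: com) (p :: nat poly). \<forall>I\<in>insts. \<exists>x t.
        is_arg_min (obj I) (\<lambda>y. y \<in> feasible I) x \<and>
        run c (enc I) t (enc_sol I x) \<and>
        t \<le> poly p (input_size (enc I)))"


section \<open>Scalarized problem with Hamming distances to historic solutions\<close>

text \<open>
  The lists \<open>nodes\<close> and \<open>items\<close> enumerate \<open>V\<close> and \<open>E\<close>; their order only matters
  for the encoding. The set \<open>important\<close> is \<open>E'\<close>, and \<open>history\<close> lists the historic
  solutions together with their weights. Vectors in \<open>{0,1}\<^sup>E\<close> are extensional functions.
\<close>

record 'e scalarized_instance =
  nodes :: "nat list"
  items :: "'e list"
  cost :: "'e \<Rightarrow> rat"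
  important :: "'e set"
  alpha :: rat
  history :: "(('e \<Rightarrow> nat) \<times> rat) list"

definition char_vec :: "'e set \<Rightarrow> 'e set \<Rightarrow> 'e \<Rightarrow> nat" where
  "char_vec E F = (\<lambda>j\<in>E. if j \<in> F then 1 else 0)"

definition hamming :: "'e set \<Rightarrow> ('e \<Rightarrow> nat) \<Rightarrow> ('e \<Rightarrow> nat) \<Rightarrow> nat" where
  "hamming D u v = card {j \<in> D. u j \<noteq> v j}"

definition objective :: "('e, 'a) scalarized_instance_scheme \<Rightarrow> ('e \<Rightarrow> nat) \<Rightarrow> rat" where
  "objective I x =
     alpha I * (\<Sum>j\<in>set (items I). cost I j * of_nat (x j)) +
     (1 - alpha I) * (\<Sum>i<length (history I). snd (history I ! i) *
        of_nat (hamming (important I) (restrict x (important I))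
                  (restrict (fst (history I ! i)) (important I))))"

definition valid_data ::
  "('e \<Rightarrow> nat) set \<Rightarrow> ('e, 'a) scalarized_instance_scheme \<Rightarrow> bool" where
  "valid_data X I \<longleftrightarrow>
     distinct (nodes I) \<and> distinct (items I) \<and>
     important I \<subseteq> set (items I) \<and>
     0 < alpha I \<and> alpha I < 1 \<and>
     history I \<noteq> [] \<and> fst ` set (history I) \<subseteq> X"

definition encode_rat :: "rat \<Rightarrow> int list" where
  "encode_rat q = [fst (quotient_of q), snd (quotient_of q)]"

definition encode_vec :: "('e, 'a) scalarized_instance_scheme \<Rightarrow> ('e \<Rightarrow> nat) \<Rightarrow> int list" where
  "encode_vec I x = map (\<lambda>j. int (x j)) (items I)"

text \<open>All vertices are listed in the input, so its size is at least \<open>|V| + |E|\<close>.\<close>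

definition encode ::
  "('e \<Rightarrow> int list) \<Rightarrow> ('e, 'a) scalarized_instance_scheme \<Rightarrow> int list" where
  "encode enc_edge I =
     int (length (nodes I)) # map int (nodes I) @
     int (length (items I)) # concat (map enc_edge (items I)) @
     concat (map (\<lambda>j. encode_rat (cost I j)) (items I)) @
     map (\<lambda>j. of_bool (j \<in> important I)) (items I) @
     encode_rat (alpha I) @
     int (length (history I)) #
     concat (map (\<lambda>(x, w). encode_vec I x @ encode_rat w) (history I))"


subsection \<open>Shortest paths in directed acyclic graphs\<close>

record dag_instance = "(nat \<times> nat) scalarized_instance" +
  source :: nat
  sink :: nat

definition dag_graph :: "dag_instance \<Rightarrow> nat pair_pre_digraph" where
  "dag_graph I = \<lparr>pverts = set (nodes I), parcs = set (items I)\<rparr>"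

definition st_paths :: "dag_instance \<Rightarrow> (nat \<times> nat \<Rightarrow> nat) set" where
  "st_paths I = {char_vec (set (items I)) (set p) | p.
     pre_digraph.apath (with_proj (dag_graph I)) (source I) p (sink I)}"

definition dag_instances :: "dag_instance set" where
  "dag_instances = {I. valid_data (st_paths I) I \<and>
     pair_wf_digraph (dag_graph I) \<and> acyclic (set (items I)) \<and>
     source I \<in> set (nodes I) \<and> sink I \<in> set (nodes I) \<and>
     (\<forall>j\<in>set (items I). 0 \<le> cost I j)}"

definition encode_dag_instance :: "dag_instance \<Rightarrow> int list" where
  "encode_dag_instance I =
     int (source I) # int (sink I) # encode (\<lambda>(u, v). [int u, int v]) I"


subsection \<open>Minimum spanning trees\<close>

text \<open>
  Edges of undirected graphs are two-element sets of vertices. The notion \<open>spanning_tree\<close> of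
  \<open>Graph_Theory\<close> does not apply: it forbids directed cycles only, and a pair of opposite arcs
  counts as a cycle there.
\<close>

type_synonym graph_instance = "nat set scalarized_instance"

definition undirected_cycle :: "nat set set \<Rightarrow> nat list \<Rightarrow> bool" where
  "undirected_cycle T vs \<longleftrightarrow> 3 \<le> length vs \<and> distinct vs \<and>
     (\<forall>i<length vs. {vs ! i, vs ! (Suc i mod length vs)} \<in> T)"

definition undirected_connected :: "nat set \<Rightarrow> nat set set \<Rightarrow> bool" where
  "undirected_connected V T \<longleftrightarrow> (\<forall>u\<in>V. \<forall>v\<in>V. (u, v) \<in> {(a, b). {a, b} \<in> T}\<^sup>*)"

definition undirected_spanning_tree :: "nat set \<Rightarrow> nat set set \<Rightarrow> nat set set \<Rightarrow> bool" where
  "undirected_spanning_tree V E T \<longleftrightarrow>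
     T \<subseteq> E \<and> undirected_connected V T \<and> (\<nexists>vs. undirected_cycle T vs)"

definition spanning_trees :: "graph_instance \<Rightarrow> (nat set \<Rightarrow> nat) set" where
  "spanning_trees I = {char_vec (set (items I)) T | T.
     undirected_spanning_tree (set (nodes I)) (set (items I)) T}"

definition graph_instances :: "graph_instance set" where
  "graph_instances = {I. valid_data (spanning_trees I) I \<and>
     (\<forall>e\<in>set (items I). e \<subseteq> set (nodes I) \<and> card e = 2)}"

definition encode_graph_instance :: "graph_instance \<Rightarrow> int list" where
  "encode_graph_instance I = encode (\<lambda>e. [int (Min e), int (Max e)]) I"

end

theory Submission
  imports Defs
begin

text \<open>
  The Hamming distance to a fixed 0/1 vector \<open>y\<close> is affine on 0/1 vectors: the edge \<open>j\<close> contributes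
  \<open>y\<^sub>j + (1 - 2 y\<^sub>j) x\<^sub>j\<close>. Hence, up to a constant and the factor \<open>\<alpha> > 0\<close>, the objective function is
  linear with rational edge weights of arbitrary sign, and it remains to find a shortest path
  with arbitrary weights in an acyclic graph (Bellman-Ford; there are no cycles, in particular no
  negative ones) or a minimum spanning tree with arbitrary weights (Prim).

  For the running time on the machine it suffices to count steps: as long as one factor of every
  product is a constant or has few bits, a step lengthens the numbers by at most a fixed number of
  bits, so all numbers stay polynomially long if the number of steps is polynomial.
\<close>

section \<open>Bounding the logarithmic cost by the number of steps\<close>

text \<open>The restriction on products is tied to how fractions are stored. All edge weights share
  one denominator, and it is multiplied by every denominator that is read, so it gets long. The long
  number always stands on the left of a product; the right factor is a number from the input or a
  product of two of them, which is why the programs are later run with a factor length of twice the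
  input size. Once this is checked at each product, no variable needs an invariant about its size.

  Both algorithms are chosen so that plain counting loops suffice: |E| rounds of Bellman-Ford need
  no topological order, and searching the edge list for a lightest crossing edge needs neither
  sorting nor a union-find structure.

  A solution has to be printed for every instance, so feasibility matters: the sink must be
  reachable and the graph connected. Both follow from the historic solutions, which are feasible and
  at least one in number.\<close>

primrec mul_bounded :: "nat \<Rightarrow> exp \<Rightarrow> memory \<Rightarrow> bool" where
  "mul_bounded A (Const k) m \<longleftrightarrow> True"
| "mul_bounded A (Cell a) m \<longleftrightarrow> mul_bounded A a m"
| "mul_bounded A (Plus e f) m \<longleftrightarrow> mul_bounded A e m \<and> mul_bounded A f m"
| "mul_bounded A (Minus e f) m \<longleftrightarrow> mul_bounded A e m \<and> mul_bounded A f m"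
| "mul_bounded A (Times e f) m \<longleftrightarrow> mul_bounded A e m \<and> mul_bounded A f m \<and>
     ((\<exists>k. f = Const k) \<or> \<bar>eval f m\<bar> \<le> 2 ^ A)"

text \<open>A constant counts with its absolute value, so that 2 to the power of the size bounds it.
  This is coarse, but the size of a fixed program does not depend on the instance.\<close>

primrec exp_size :: "exp \<Rightarrow> nat" where
  "exp_size (Const k) = nat \<bar>k\<bar> + 1"
| "exp_size (Cell a) = exp_size a + 1"
| "exp_size (Plus e f) = exp_size e + exp_size f + 1"
| "exp_size (Minus e f) = exp_size e + exp_size f + 1"
| "exp_size (Times e f) = exp_size e + exp_size f + 1"

primrec com_size :: "com \<Rightarrow> nat" where
  "com_size Skip = 1"
| "com_size (Assign a e) = exp_size a + exp_size e"
| "com_size (Read a) = exp_size a"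
| "com_size (Write e) = exp_size e"
| "com_size (Seq c d) = com_size c + com_size d"
| "com_size (Cond e c d) = exp_size e + com_size c + com_size d"
| "com_size (While e c) = exp_size e + com_size c"

text \<open>There is no rule for reading from an exhausted tape, so a derivation also certifies that
  the program never reads beyond its input.\<close>

inductive steps :: "nat \<Rightarrow> com \<Rightarrow> state \<Rightarrow> nat \<Rightarrow> state \<Rightarrow> bool" for A where
  "steps A Skip s 1 s"
| "mul_bounded A a m \<Longrightarrow> mul_bounded A e m \<Longrightarrow>
     steps A (Assign a e) (m, inp, out) 1 (m(eval a m := eval e m), inp, out)"
| "mul_bounded A a m \<Longrightarrow>
     steps A (Read a) (m, v # inp, out) 1 (m(eval a m := v), inp, out)"
| "mul_bounded A e m \<Longrightarrow>
     steps A (Write e) (m, inp, out) 1 (m, inp, out @ [eval e m])"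
| "steps A c1 s1 n1 s2 \<Longrightarrow> steps A c2 s2 n2 s3 \<Longrightarrow> steps A (Seq c1 c2) s1 (n1 + n2 + 1) s3"
| "mul_bounded A e (fst s) \<Longrightarrow> eval e (fst s) > 0 \<Longrightarrow> steps A c1 s n s' \<Longrightarrow>
     steps A (Cond e c1 c2) s (n + 1) s'"
| "mul_bounded A e (fst s) \<Longrightarrow> eval e (fst s) \<le> 0 \<Longrightarrow> steps A c2 s n s' \<Longrightarrow>
     steps A (Cond e c1 c2) s (n + 1) s'"
| "mul_bounded A e (fst s1) \<Longrightarrow> eval e (fst s1) > 0 \<Longrightarrow> steps A c s1 n1 s2 \<Longrightarrow>
     steps A (While e c) s2 n2 s3 \<Longrightarrow> steps A (While e c) s1 (n1 + n2 + 1) s3"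
| "mul_bounded A e (fst s) \<Longrightarrow> eval e (fst s) \<le> 0 \<Longrightarrow> steps A (While e c) s 1 s"

lemma int_bits_le:
  assumes "\<bar>v\<bar> \<le> 2 ^ k"
  shows "int_bits v \<le> k + 2"
proof -
  have "\<bar>v\<bar> < 2 ^ (k + 1)" by (rule le_less_trans[OF assms]) simp
  hence "bitlen \<bar>v\<bar> \<le> int (k + 1)" by (subst bitlen_le_iff_power) (auto simp: nat_add_distrib)
  thus ?thesis by (simp add: int_bits_def)
qed

lemma abs_le_power_int_bits: "\<bar>v\<bar> \<le> 2 ^ int_bits v"
proof -
  have "\<bar>v\<bar> < 2 ^ nat (bitlen \<bar>v\<bar>)" using bitlen_bounds[of "\<bar>v\<bar>"] by (cases "v = 0") auto
  also have "(2 :: int) ^ nat (bitlen \<bar>v\<bar>) \<le> 2 ^ int_bits v"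
    by (intro power_increasing) (auto simp: int_bits_def)
  finally show ?thesis by simp
qed

lemma exp_size_pos: "exp_size e > 0"
  by (induction e) auto

text \<open>Every node of an expression has a budget of \<open>A + 1\<close> bits. A sum needs one
  of them for the carry; the summand 1 in \<open>a + b + 1\<close> stands for the node
  itself.\<close>

lemma
  assumes "\<bar>x\<bar> \<le> (2 :: int) ^ (L + a * (A + 1))" "\<bar>y\<bar> \<le> 2 ^ (L + b * (A + 1))"
  shows abs_add_le_power: "\<bar>x + y\<bar> \<le> 2 ^ (L + (a + b + 1) * (A + 1))"
    and abs_diff_le_power: "\<bar>x - y\<bar> \<le> 2 ^ (L + (a + b + 1) * (A + 1))"
proof -
  let ?N = "L + (a + b) * (A + 1)"
  have "(2 :: int) ^ (L + a * (A + 1)) \<le> 2 ^ ?N" "(2 :: int) ^ (L + b * (A + 1)) \<le> 2 ^ ?N"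
    by (rule power_increasing; simp add: add_mult_distrib)+
  hence xy: "\<bar>x\<bar> + \<bar>y\<bar> \<le> 2 ^ Suc ?N" using assms unfolding power_Suc by linarith
  have "(2 :: int) ^ Suc ?N \<le> 2 ^ (L + (a + b + 1) * (A + 1))"
    by (rule power_increasing) (simp_all add: add_mult_distrib)
  with xy show "\<bar>x + y\<bar> \<le> 2 ^ (L + (a + b + 1) * (A + 1))"
    "\<bar>x - y\<bar> \<le> 2 ^ (L + (a + b + 1) * (A + 1))" by linarith+
qed

text \<open>\<open>L\<close> may occur only once in the exponent, although lengths add up in a
  product. This works because the right factor is a constant or at most \<open>2 ^ A\<close>, so its
  bound is free of \<open>L\<close>; only the left factor inherits the length of the memory
  contents.\<close>

lemma abs_eval_le:
  assumes "\<And>a. \<bar>m a\<bar> \<le> 2 ^ L" "mul_bounded A e m"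
  shows "\<bar>eval e m\<bar> \<le> 2 ^ (L + exp_size e * (A + 1))"
  using assms(2)
proof (induction e)
  case (Const k)
  have "\<bar>k\<bar> \<le> 2 ^ nat \<bar>k\<bar>"
    using of_nat_less_two_power[of "nat \<bar>k\<bar>", where ?'a = int] by simp
  also have "(2 :: int) ^ nat \<bar>k\<bar> \<le> 2 ^ (L + (nat \<bar>k\<bar> + 1) * (A + 1))"
    by (intro power_increasing) auto
  finally show ?case by simp
next
  case (Cell e)
  have "\<bar>m (eval e m)\<bar> \<le> 2 ^ L" by (rule assms)
  also have "(2 :: int) ^ L \<le> 2 ^ (L + exp_size (Cell e) * (A + 1))"
    by (intro power_increasing) auto
  finally show ?case by simp
next
  case (Plus e f)
  thus ?case using abs_add_le_power[of "eval e m" L "exp_size e" A "eval f m" "exp_size f"] by simp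
next
  case (Minus e f)
  thus ?case using abs_diff_le_power[of "eval e m" L "exp_size e" A "eval f m" "exp_size f"] by simp
next
  case (Times e f)
  have "\<bar>eval f m\<bar> \<le> 2 ^ ((exp_size f + 1) * (A + 1))"
  proof (cases "\<exists>k. f = Const k")
    case True
    then obtain k where k: "f = Const k" by auto
    have "\<bar>k\<bar> \<le> 2 ^ nat \<bar>k\<bar>"
      using of_nat_less_two_power[of "nat \<bar>k\<bar>", where ?'a = int] by simp
    also have "(2 :: int) ^ nat \<bar>k\<bar> \<le> 2 ^ ((exp_size f + 1) * (A + 1))"
      unfolding k by (intro power_increasing) auto
    finally show ?thesis using k by simp
  next
    case False
    hence "\<bar>eval f m\<bar> \<le> 2 ^ A" using Times.prems by simp
    also have "(2 :: int) ^ A \<le> 2 ^ ((exp_size f + 1) * (A + 1))"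
      by (intro power_increasing) auto
    finally show ?thesis .
  qed
  hence "\<bar>eval e m\<bar> * \<bar>eval f m\<bar> \<le>
      2 ^ (L + exp_size e * (A + 1)) * 2 ^ ((exp_size f + 1) * (A + 1))"
    using Times by (intro mult_mono) auto
  also have "\<dots> = 2 ^ (L + exp_size (Times e f) * (A + 1))"
    unfolding power_add[symmetric] by (rule arg_cong[of _ _ "(^) 2"]) (simp add: algebra_simps)
  finally show ?case by (simp add: abs_mult)
qed

text \<open>There are at most \<open>exp_size e\<close> subexpressions, all charged at the same
  rate. The rate depends on the common bound \<open>D\<close> instead of the size of
  \<open>e\<close>, so it does not change in the induction.\<close>

lemma eval_cost_le:
  assumes "\<And>a. \<bar>m a\<bar> \<le> 2 ^ L" "mul_bounded A e m" "exp_size e \<le> D"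
  shows "eval_cost e m \<le> exp_size e * (L + D * (A + 1) + 2)"
proof -
  have bits: "int_bits (eval f m) \<le> L + D * (A + 1) + 2"
    if "exp_size f \<le> D" "mul_bounded A f m" for f
  proof -
    have "int_bits (eval f m) \<le> L + exp_size f * (A + 1) + 2"
      by (rule int_bits_le[OF abs_eval_le]) (use assms that in auto)
    also have "exp_size f * (A + 1) \<le> D * (A + 1)" using that by (rule_tac mult_right_mono) auto
    finally show ?thesis by simp
  qed
  from assms(2,3) show ?thesis
  proof (induction e)
    case (Const k)
    show ?case using bits[OF Const.prems(2,1)] by (simp add: add_increasing)
  next
    case (Cell e)
    thus ?case using bits[of "Cell e"] by simp
  next
    case (Plus e f)
    thus ?case using bits[of "Plus e f"] by (simp add: add_mult_distrib)
  next
    case (Minus e f)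
    thus ?case using bits[of "Minus e f"] by (simp add: add_mult_distrib)
  next
    case (Times e f)
    thus ?case using bits[of "Times e f"] by (simp add: add_mult_distrib)
  qed
qed

text \<open>
  Since every step multiplies the values by at most \<open>2 ^ (D * (A + 1))\<close>, all values
  stay polynomially long if the number of steps is polynomial.
\<close>

lemma exec_if_steps:
  assumes "steps A c s n s'" "com_size c \<le> D" "\<And>a. \<bar>fst s a\<bar> \<le> 2 ^ L"
    "\<And>v. v \<in> set (fst (snd s)) \<Longrightarrow> \<bar>v\<bar> \<le> 2 ^ A" "L + n * (D * (A + 1)) \<le> X"
  shows "(\<exists>t. exec c s t s' \<and> t \<le> n * ((D + 1) * (X + 3))) \<and>
     (\<forall>a. \<bar>fst s' a\<bar> \<le> 2 ^ (L + n * (D * (A + 1)))) \<and> set (fst (snd s')) \<subseteq> set (fst (snd s))"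
  using assms
\<comment> \<open>\<open>L\<close> varies because the second part of a run starts with longer
  numbers than the first. \<open>X\<close> stays fixed: it bounds the length at the end of the whole
  run, so that the costs of the parts can be added.\<close>
proof (induction arbitrary: L rule: steps.induct)
  case (1 s)
  have "\<bar>fst s a\<bar> \<le> 2 ^ (L + 1 * (D * (A + 1)))" for a
    by (rule order.trans[OF 1(2)]) (rule power_increasing, auto)
  moreover have "1 \<le> 1 * ((D + 1) * (X + 3))" by simp
  ultimately show ?case using exec.Skip[of s] by (intro conjI exI[of _ 1] allI subset_refl)
next
  case (2 a m e inp out)
  have D: "exp_size a \<le> D" "exp_size e \<le> D" "exp_size a + exp_size e \<le> D"
    using 2 exp_size_pos[of e] exp_size_pos[of a] by auto
  have "eval_cost a m + eval_cost e m \<le> (exp_size a + exp_size e) * (L + D * (A + 1) + 2)"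
    using eval_cost_le[of m L A a D] eval_cost_le[of m L A e D] 2 D by (simp add: add_mult_distrib)
  also have "\<dots> \<le> (D + 1) * (X + 2)"
    using D 2 by (intro mult_mono) auto
  finally have t: "eval_cost a m + eval_cost e m + 1 \<le> 1 * ((D + 1) * (X + 3))" by (simp add: algebra_simps)
  have *: "exp_size e * (A + 1) \<le> D * (A + 1)" using D by (intro mult_right_mono) auto
  have "\<bar>eval e m\<bar> \<le> 2 ^ (L + exp_size e * (A + 1))"
    by (rule abs_eval_le) (use 2 in auto)
  also have "(2 :: int) ^ (L + exp_size e * (A + 1)) \<le> 2 ^ (L + 1 * (D * (A + 1)))"
    using * by (intro power_increasing) auto
  finally have e: "\<bar>eval e m\<bar> \<le> 2 ^ (L + 1 * (D * (A + 1)))" .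
  have m: "\<bar>m b\<bar> \<le> 2 ^ (L + 1 * (D * (A + 1)))" for b
    by (rule order.trans[OF 2(4)[simplified]]) (rule power_increasing, auto)
  show ?case using t e m exec.Assign[of a e m inp out] by (auto simp del: One_nat_def)
next
  case (3 a m v inp out)
  have "D \<ge> 1" using 3 exp_size_pos[of a] by auto
  \<comment> \<open>The length of a value from the tape is limited by \<open>A\<close> and has
    nothing to do with \<open>L\<close>; the growth \<open>D * (A + 1)\<close> granted to a single
    step leaves room for it.\<close>
  hence DA: "D * (A + 1) \<ge> A + 1" by (metis mult_le_mono1 nat_mult_1)
  have "eval_cost a m \<le> exp_size a * (L + D * (A + 1) + 2)"
    using eval_cost_le[of m L A a D] 3 by auto
  also have "\<dots> \<le> D * (X + 2)"
    using 3 by (intro mult_mono) auto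
  finally have "eval_cost a m + int_bits v + 1 \<le> D * (X + 2) + (A + 2) + 1"
    using int_bits_le[of v A] 3 by simp
  also have "\<dots> \<le> 1 * ((D + 1) * (X + 3))"
    using DA 3 by (simp add: algebra_simps)
  finally have t: "eval_cost a m + int_bits v + 1 \<le> 1 * ((D + 1) * (X + 3))" .
  have "\<bar>v\<bar> \<le> 2 ^ A" using 3 by auto
  also have "(2 :: int) ^ A \<le> 2 ^ (L + 1 * (D * (A + 1)))"
    using DA by (intro power_increasing) auto
  finally have e: "\<bar>v\<bar> \<le> 2 ^ (L + 1 * (D * (A + 1)))" .
  have m: "\<bar>m b\<bar> \<le> 2 ^ (L + 1 * (D * (A + 1)))" for b
    by (rule order.trans[OF 3(3)[simplified]]) (rule power_increasing, auto)
  show ?case using t e m exec.Read_Cons[of a m v inp out] by (auto simp del: One_nat_def)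
next
  case (4 e m inp out)
  have "eval_cost e m \<le> exp_size e * (L + D * (A + 1) + 2)"
    using eval_cost_le[of m L A e D] 4 by auto
  also have "\<dots> \<le> (D + 1) * (X + 2)"
    using 4 by (intro mult_mono) auto
  finally have t: "eval_cost e m + 1 \<le> 1 * ((D + 1) * (X + 3))" by (simp add: algebra_simps)
  have m: "\<bar>m b\<bar> \<le> 2 ^ (L + 1 * (D * (A + 1)))" for b
    by (rule order.trans[OF 4(3)[simplified]]) (rule power_increasing, auto)
  show ?case using t m exec.Write[of e m inp out] by (auto simp del: One_nat_def)
next
  case (5 c1 s1 n1 s2 c2 n2 s3)
  obtain t1 where 1: "exec c1 s1 t1 s2" "t1 \<le> n1 * ((D + 1) * (X + 3))"
    "\<And>a. \<bar>fst s2 a\<bar> \<le> 2 ^ (L + n1 * (D * (A + 1)))" "set (fst (snd s2)) \<subseteq> set (fst (snd s1))"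
    using 5(3)[of L] 5(5-) by (auto simp: add_mult_distrib)
  have "(\<exists>t. exec c2 s2 t s3 \<and> t \<le> n2 * ((D + 1) * (X + 3))) \<and>
     (\<forall>a. \<bar>fst s3 a\<bar> \<le> 2 ^ (L + n1 * (D * (A + 1)) + n2 * (D * (A + 1)))) \<and>
     set (fst (snd s3)) \<subseteq> set (fst (snd s2))"
    by (rule 5(4)) (use 1 5(5-) in \<open>auto simp: add_mult_distrib\<close>)
  then obtain t2 where 2: "exec c2 s2 t2 s3" "t2 \<le> n2 * ((D + 1) * (X + 3))"
    "\<And>a. \<bar>fst s3 a\<bar> \<le> 2 ^ (L + n1 * (D * (A + 1)) + n2 * (D * (A + 1)))"
    "set (fst (snd s3)) \<subseteq> set (fst (snd s2))" by auto
  have "\<bar>fst s3 a\<bar> \<le> 2 ^ (L + (n1 + n2 + 1) * (D * (A + 1)))" for a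
    by (rule order.trans[OF 2(3)]) (rule power_increasing, auto simp: add_mult_distrib)
  moreover have "t1 + t2 + 1 \<le> (n1 + n2 + 1) * ((D + 1) * (X + 3))"
    unfolding add_mult_distrib[of "n1 + n2"] add_mult_distrib[of n1] using 1(2) 2(2) by simp
  ultimately show ?case using exec.Seq[OF 1(1) 2(1)] 1(4) 2(4) by blast
next
  case (6 e s c1 n s' c2)
  obtain t where 1: "exec c1 s t s'" "t \<le> n * ((D + 1) * (X + 3))"
    "\<And>a. \<bar>fst s' a\<bar> \<le> 2 ^ (L + n * (D * (A + 1)))" "set (fst (snd s')) \<subseteq> set (fst (snd s))"
    using 6(4)[of L] 6(5-) by (auto simp: add_mult_distrib)
  have "eval_cost e (fst s) \<le> exp_size e * (L + D * (A + 1) + 2)"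
    using eval_cost_le[of "fst s" L A e D] 6 by auto
  also have "\<dots> \<le> (D + 1) * (X + 2)"
    using 6 by (intro mult_mono) auto
  finally have e: "eval_cost e (fst s) + 1 \<le> (D + 1) * (X + 3)" by (simp add: algebra_simps)
  have "\<bar>fst s' a\<bar> \<le> 2 ^ (L + (n + 1) * (D * (A + 1)))" for a
    by (rule order.trans[OF 1(3)]) (rule power_increasing, auto simp: add_mult_distrib)
  moreover have "eval_cost e (fst s) + t + 1 \<le> (n + 1) * ((D + 1) * (X + 3))"
    unfolding add_mult_distrib[of n] using 1(2) e by simp
  ultimately show ?case using exec.Cond_True[OF 6(2) 1(1)] 1(4) by blast
next
  case (7 e s c2 n s' c1)
  obtain t where 1: "exec c2 s t s'" "t \<le> n * ((D + 1) * (X + 3))"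
    "\<And>a. \<bar>fst s' a\<bar> \<le> 2 ^ (L + n * (D * (A + 1)))" "set (fst (snd s')) \<subseteq> set (fst (snd s))"
    using 7(4)[of L] 7(5-) by (auto simp: add_mult_distrib)
  have "eval_cost e (fst s) \<le> exp_size e * (L + D * (A + 1) + 2)"
    using eval_cost_le[of "fst s" L A e D] 7 by auto
  also have "\<dots> \<le> (D + 1) * (X + 2)"
    using 7 by (intro mult_mono) auto
  finally have e: "eval_cost e (fst s) + 1 \<le> (D + 1) * (X + 3)" by (simp add: algebra_simps)
  have "\<bar>fst s' a\<bar> \<le> 2 ^ (L + (n + 1) * (D * (A + 1)))" for a
    by (rule order.trans[OF 1(3)]) (rule power_increasing, auto simp: add_mult_distrib)
  moreover have "eval_cost e (fst s) + t + 1 \<le> (n + 1) * ((D + 1) * (X + 3))"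
    unfolding add_mult_distrib[of n] using 1(2) e by simp
  ultimately show ?case using exec.Cond_False[OF 7(2) 1(1)] 1(4) by blast
next
  case (8 e s1 c n1 s2 n2 s3)
  obtain t1 where 1: "exec c s1 t1 s2" "t1 \<le> n1 * ((D + 1) * (X + 3))"
    "\<And>a. \<bar>fst s2 a\<bar> \<le> 2 ^ (L + n1 * (D * (A + 1)))" "set (fst (snd s2)) \<subseteq> set (fst (snd s1))"
    using 8(5)[of L] 8(7-) by (auto simp: add_mult_distrib)
  have "(\<exists>t. exec (While e c) s2 t s3 \<and> t \<le> n2 * ((D + 1) * (X + 3))) \<and>
     (\<forall>a. \<bar>fst s3 a\<bar> \<le> 2 ^ (L + n1 * (D * (A + 1)) + n2 * (D * (A + 1)))) \<and>
     set (fst (snd s3)) \<subseteq> set (fst (snd s2))"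
    by (rule 8(6)) (use 1 8(7-) in \<open>auto simp: add_mult_distrib\<close>)
  then obtain t2 where 2: "exec (While e c) s2 t2 s3" "t2 \<le> n2 * ((D + 1) * (X + 3))"
    "\<And>a. \<bar>fst s3 a\<bar> \<le> 2 ^ (L + n1 * (D * (A + 1)) + n2 * (D * (A + 1)))"
    "set (fst (snd s3)) \<subseteq> set (fst (snd s2))" by auto
  have "eval_cost e (fst s1) \<le> exp_size e * (L + D * (A + 1) + 2)"
    using eval_cost_le[of "fst s1" L A e D] 8 by auto
  also have "\<dots> \<le> (D + 1) * (X + 2)"
    using 8 by (intro mult_mono) auto
  finally have e: "eval_cost e (fst s1) + 1 \<le> (D + 1) * (X + 3)" by (simp add: algebra_simps)
  have "\<bar>fst s3 a\<bar> \<le> 2 ^ (L + (n1 + n2 + 1) * (D * (A + 1)))" for a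
    by (rule order.trans[OF 2(3)]) (rule power_increasing, auto simp: add_mult_distrib)
  moreover have "eval_cost e (fst s1) + t1 + t2 + 1 \<le> (n1 + n2 + 1) * ((D + 1) * (X + 3))"
    unfolding add_mult_distrib[of "n1 + n2"] add_mult_distrib[of n1] using 1(2) 2(2) e by simp
  ultimately show ?case using exec.While_True[OF 8(2) 1(1) 2(1)] 1(4) 2(4) by blast
next
  case (9 e s c)
  have "eval_cost e (fst s) \<le> exp_size e * (L + D * (A + 1) + 2)"
    using eval_cost_le[of "fst s" L A e D] 9 by auto
  also have "\<dots> \<le> (D + 1) * (X + 2)"
    using 9 by (intro mult_mono) auto
  finally have e: "eval_cost e (fst s) + 1 \<le> 1 * ((D + 1) * (X + 3))" by (simp add: algebra_simps)
  have "\<bar>fst s a\<bar> \<le> 2 ^ (L + 1 * (D * (A + 1)))" for a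
    by (rule order.trans[OF 9(4)]) (rule power_increasing, auto)
  with e show ?case using exec.While_False[OF 9(2), of c] by blast
qed

section \<open>Arrays and a calculus of weakest preconditions\<close>

datatype name =
    Src | Snk | NodeCount | Node | EdgeCount | HistCount | Ix | Jx | Num | Den | AlphaNum | AlphaDen
  | Bit | Scale | Cur | Best
  | Tail | Head | Weight | Coeff | Imp | Chosen | Reached | Dist | Via

primrec slot :: "name \<Rightarrow> int" where
  "slot Src = 0"
| "slot Snk = 1"
| "slot NodeCount = 2"
| "slot Node = 3"
| "slot EdgeCount = 4"
| "slot HistCount = 5"
| "slot Ix = 6"
| "slot Jx = 7"
| "slot Num = 8"
| "slot Den = 9"
| "slot AlphaNum = 10"
| "slot AlphaDen = 11"
| "slot Bit = 12"
| "slot Scale = 13"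
| "slot Cur = 14"
| "slot Best = 15"
| "slot Tail = 16"
| "slot Head = 17"
| "slot Weight = 18"
| "slot Coeff = 19"
| "slot Imp = 20"
| "slot Chosen = 21"
| "slot Reached = 22"
| "slot Dist = 23"
| "slot Via = 24"

type_synonym store = "name \<Rightarrow> int \<Rightarrow> int"

text \<open>Interleaving the arrays modulo 32 lets each of them grow without a length fixed in
  advance. Residues that belong to no name hold 0, so the all-zero store is the initial memory of
  the machine.\<close>

definition flat :: "store \<Rightarrow> memory" where
  "flat st a = (if \<exists>x. slot x = a mod 32 then st (inv slot (a mod 32)) (a div 32) else 0)"

definition loc :: "name \<Rightarrow> exp \<Rightarrow> exp" where
  "loc x i = Plus (Times i (Const 32)) (Const (slot x))"

definition Arr :: "name \<Rightarrow> exp \<Rightarrow> exp" where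
  "Arr x i = Cell (loc x i)"

definition Var :: "name \<Rightarrow> exp" where
  "Var x = Arr x (Const 0)"

lemma inj_slot: "inj slot"
proof (rule injI)
  fix x y
  assume "slot x = slot y"
  thus "x = y" by (cases x; cases y; simp)
qed

lemma slot_bounds: "0 \<le> slot x" "slot x < 32"
  by (cases x; simp)+

lemma flat_loc: "flat st (i * 32 + slot x) = st x i"
proof -
  have "(i * 32 + slot x) mod 32 = slot x" "(i * 32 + slot x) div 32 = i"
    using slot_bounds[of x] by auto
  thus ?thesis by (auto simp: flat_def inj_slot)
qed

lemma flat_update: "(flat st)(i * 32 + slot x := v) = flat (st(x := (st x)(i := v)))"
proof
  fix a
  show "((flat st)(i * 32 + slot x := v)) a = flat (st(x := (st x)(i := v))) a"
  proof (cases "a = i * 32 + slot x")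
    case True
    thus ?thesis by (simp add: flat_loc)
  next
    case False
    show ?thesis
    proof (cases "\<exists>y. slot y = a mod 32")
      case True
      then obtain y where y: "slot y = a mod 32" by blast
      have "\<not> (y = x \<and> a div 32 = i)" using False y by (metis div_mult_mod_eq)
      with False show ?thesis by (auto simp: flat_def inj_slot simp flip: y)
    next
      case 2: False
      with False show ?thesis by (auto simp: flat_def)
    qed
  qed
qed

lemma eval_loc: "eval (loc x i) (flat st) = eval i (flat st) * 32 + slot x"
  by (simp add: loc_def)

lemma eval_Arr [simp]: "eval (Arr x i) (flat st) = st x (eval i (flat st))"
  by (simp add: Arr_def eval_loc flat_loc)

lemma eval_Var [simp]: "eval (Var x) (flat st) = st x 0"
  by (simp add: Var_def)

lemma mul_bounded_loc [simp]: "mul_bounded A (loc x i) m \<longleftrightarrow> mul_bounded A i m"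
  by (simp add: loc_def)

lemma mul_bounded_Arr [simp]: "mul_bounded A (Arr x i) m \<longleftrightarrow> mul_bounded A i m"
  by (simp add: Arr_def)

lemma mul_bounded_Var [simp]: "mul_bounded A (Var x) m"
  by (simp add: Var_def)

section \<open>Total correctness with step counts in the postcondition\<close>

definition wp :: "nat \<Rightarrow> com \<Rightarrow> (nat \<Rightarrow> store \<Rightarrow> int list \<Rightarrow> int list \<Rightarrow> bool) \<Rightarrow>
    store \<Rightarrow> int list \<Rightarrow> int list \<Rightarrow> bool" where
  "wp A c Q st inp out \<longleftrightarrow> (\<exists>n st' inp' out'.
     steps A c (flat st, inp, out) n (flat st', inp', out') \<and> Q n st' inp' out')"

lemma wp_mono:
  "wp A c Q st inp out \<Longrightarrow> (\<And>n st' inp' out'. Q n st' inp' out' \<Longrightarrow> R n st' inp' out') \<Longrightarrow>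
   wp A c R st inp out"
  unfolding wp_def by blast

text \<open>The equations allow a specification to be applied when the current store and tapes agree
  with the specified ones only after simplification and not syntactically.\<close>

lemma wp_step:
  "wp A c P st1 inp1 out1 \<Longrightarrow> st = st1 \<Longrightarrow> inp = inp1 \<Longrightarrow> out = out1 \<Longrightarrow>
   (\<And>n st' inp' out'. P n st' inp' out' \<Longrightarrow> Q n st' inp' out') \<Longrightarrow> wp A c Q st inp out"
  unfolding wp_def by blast

lemma wp_Skip: "Q 1 st inp out \<Longrightarrow> wp A Skip Q st inp out"
  unfolding wp_def using steps.intros(1) by blast

lemma wp_Assign:
  "mul_bounded A i (flat st) \<Longrightarrow> mul_bounded A e (flat st) \<Longrightarrow>
   Q 1 (st(x := (st x)(eval i (flat st) := eval e (flat st)))) inp out \<Longrightarrow>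
   wp A (Assign (loc x i) e) Q st inp out"
  unfolding wp_def using steps.intros(2)[of A "loc x i" "flat st" e inp out]
  by (auto simp: eval_loc flat_update)

lemma wp_Read:
  "inp \<noteq> [] \<Longrightarrow> mul_bounded A i (flat st) \<Longrightarrow>
   Q 1 (st(x := (st x)(eval i (flat st) := hd inp))) (tl inp) out \<Longrightarrow>
   wp A (Read (loc x i)) Q st inp out"
  unfolding wp_def using steps.intros(3)[of A "loc x i" "flat st" "hd inp" "tl inp" out]
  by (auto simp: eval_loc flat_update)

lemma wp_Write:
  "mul_bounded A e (flat st) \<Longrightarrow> Q 1 st inp (out @ [eval e (flat st)]) \<Longrightarrow>
   wp A (Write e) Q st inp out"
  unfolding wp_def using steps.intros(4) by blast

lemma wp_Seq:
  "wp A c (\<lambda>n. wp A d (\<lambda>k. Q (n + k + 1))) st inp out \<Longrightarrow> wp A (Seq c d) Q st inp out"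
  unfolding wp_def using steps.intros(5) by blast

lemma wp_Cond:
  assumes "mul_bounded A e (flat st)"
    "eval e (flat st) > 0 \<Longrightarrow> wp A c (\<lambda>n. Q (n + 1)) st inp out"
    "eval e (flat st) \<le> 0 \<Longrightarrow> wp A d (\<lambda>n. Q (n + 1)) st inp out"
  shows "wp A (Cond e c d) Q st inp out"
  using assms steps.intros(6)[of A e "(flat st, inp, out)" c]
    steps.intros(7)[of A e "(flat st, inp, out)" d]
  unfolding wp_def fst_conv by (meson linorder_not_le)

text \<open>The number in the invariant is a variant that limits the remaining iterations. Each
  iteration is charged \<open>b\<close> for the body and 1 for the loop rule, and the last failing
  test costs 1.\<close>

lemma wp_While:
  assumes "Inv n st inp out"
    and bounded: "\<And>n st inp out. Inv n st inp out \<Longrightarrow> mul_bounded A e (flat st)"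
    and body: "\<And>n st inp out. Inv n st inp out \<Longrightarrow> eval e (flat st) > 0 \<Longrightarrow>
      wp A c (\<lambda>k st' inp' out'. k \<le> b \<and> (\<exists>n'<n. Inv n' st' inp' out')) st inp out"
    and exit: "\<And>n st inp out. Inv n st inp out \<Longrightarrow> eval e (flat st) \<le> 0 \<Longrightarrow> R st inp out"
  shows "wp A (While e c) (\<lambda>k st' inp' out'. k \<le> n * (b + 1) + 1 \<and> R st' inp' out') st inp out"
  using assms(1)
proof (induction n arbitrary: st inp out rule: less_induct)
  case (less n)
  show ?case
  proof (cases "eval e (flat st) > 0")
    case True
    from body[OF less.prems True] obtain k n' st1 inp1 out1 where
      1: "steps A c (flat st, inp, out) k (flat st1, inp1, out1)" "k \<le> b" "n' < n"
        "Inv n' st1 inp1 out1"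
      unfolding wp_def by blast
    from less.IH[OF 1(3,4)] obtain k' st2 inp2 out2 where
      2: "steps A (While e c) (flat st1, inp1, out1) k' (flat st2, inp2, out2)"
        "k' \<le> n' * (b + 1) + 1" "R st2 inp2 out2"
      unfolding wp_def by blast
    have "(n' + 1) * (b + 1) \<le> n * (b + 1)" using 1(3) by (intro mult_right_mono) auto
    hence "k + k' + 1 \<le> n * (b + 1) + 1" using 1(2) 2(2) by simp
    moreover have "steps A (While e c) (flat st, inp, out) (k + k' + 1) (flat st2, inp2, out2)"
      by (rule steps.intros(8)[OF _ _ 1(1) 2(1)]) (use True bounded[OF less.prems] in auto)
    ultimately show ?thesis unfolding wp_def using 2(3) by blast
  next
    case False
    have "steps A (While e c) (flat st, inp, out) 1 (flat st, inp, out)"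
      by (rule steps.intros(9)) (use False bounded[OF less.prems] in auto)
    moreover have "R st inp out" using exit[OF less.prems] False by simp
    ultimately show ?thesis unfolding wp_def by (metis le_add2)
  qed
qed

lemmas wp_rules = wp_Skip wp_Assign wp_Read wp_Write wp_Cond wp_Seq

definition For :: "name \<Rightarrow> name \<Rightarrow> com \<Rightarrow> com" where
  "For x y c = Seq (Assign (loc x (Const 0)) (Const 0))
     (While (Minus (Var y) (Var x))
        (Seq c (Assign (loc x (Const 0)) (Plus (Var x) (Const 1)))))"

text \<open>Besides \<open>b\<close> for the body, an iteration pays for the increment, for the
  sequential composition and for the loop rule. The final 3 covers the initialization, its
  composition with the loop and the last test. \<open>Inv (Suc i)\<close> speaks of the store after
  the increment, hence the update in the condition on the body.\<close>

lemma wp_For: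
  assumes init: "Inv 0 (st(x := (st x)(0 := 0))) inp out"
    and limit: "\<And>i st inp out. Inv i st inp out \<Longrightarrow> st y 0 = int n"
    and body: "\<And>i st inp out. i < n \<Longrightarrow> st x 0 = int i \<Longrightarrow> Inv i st inp out \<Longrightarrow>
      wp A c (\<lambda>k st' inp' out'. k \<le> b \<and> st' x 0 = int i \<and>
        Inv (Suc i) (st'(x := (st' x)(0 := int (Suc i)))) inp' out') st inp out"
  shows "wp A (For x y c) (\<lambda>k st' inp' out'. k \<le> n * (b + 3) + 3 \<and> Inv n st' inp' out') st inp out"
proof -
  let ?I = "\<lambda>k st inp out. \<exists>i. i + k = n \<and> st x 0 = int i \<and> Inv i st inp out"
  have "wp A (While (Minus (Var y) (Var x)) (Seq c (Assign (loc x (Const 0)) (Plus (Var x) (Const 1)))))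
     (\<lambda>k st' inp' out'. k \<le> n * ((b + 2) + 1) + 1 \<and> Inv n st' inp' out') (st(x := (st x)(0 := 0))) inp out"
  proof (rule wp_While[where Inv = ?I])
    show "?I n (st(x := (st x)(0 := 0))) inp out" using init by simp
  next
    fix k st inp out
    assume "?I k st inp out"
    then obtain i where i: "i + k = n" "st x 0 = int i" "Inv i st inp out" by blast
    show "mul_bounded A (Minus (Var y) (Var x)) (flat st)" by simp
    assume "eval (Minus (Var y) (Var x)) (flat st) > 0"
    hence "i < n" using i limit[OF i(3)] by simp
    show "wp A (Seq c (Assign (loc x (Const 0)) (Plus (Var x) (Const 1))))
      (\<lambda>k' st' inp' out'. k' \<le> b + 2 \<and> (\<exists>n'<k. ?I n' st' inp' out')) st inp out"
    proof (rule wp_Seq, rule wp_mono[OF body[OF \<open>i < n\<close> i(2,3)]], rule wp_Assign)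
      fix k' :: nat and st' :: store and inp' out'
      assume *: "k' \<le> b \<and> st' x 0 = int i \<and>
        Inv (Suc i) (st'(x := (st' x)(0 := int (Suc i)))) inp' out'"
      let ?st = "st'(x := (st' x)(eval (Const 0) (flat st') :=
        eval (Plus (Var x) (Const 1)) (flat st')))"
      have "k - 1 < k" "?I (k - 1) ?st inp' out'"
        using * i \<open>i < n\<close> by (auto intro!: exI[of _ "Suc i"] simp: add.commute)
      thus "k' + 1 + 1 \<le> b + 2 \<and> (\<exists>n'<k. ?I n' ?st inp' out')"
        using * by auto
    qed auto
  next
    fix k st inp out
    assume "?I k st inp out"
    then obtain i where i: "i + k = n" "st x 0 = int i" "Inv i st inp out" by blast
    assume "eval (Minus (Var y) (Var x)) (flat st) \<le> 0"
    hence "i = n" using i limit[OF i(3)] by simp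
    thus "Inv n st inp out" using i by simp
  qed
  thus ?thesis
    unfolding For_def by (intro wp_Seq wp_Assign) (auto elim!: wp_mono simp: algebra_simps)
qed

section \<open>Polynomial bounds\<close>

definition poly_bounded :: "(nat \<Rightarrow> nat) \<Rightarrow> bool" where
  "poly_bounded f \<longleftrightarrow> (\<exists>p. \<forall>n. f n \<le> poly p n)"

lemma poly_bounded_const: "poly_bounded (\<lambda>_. c)"
  unfolding poly_bounded_def by (rule exI[of _ "[:c:]"]) simp

lemma poly_bounded_id: "poly_bounded (\<lambda>n. n)"
  unfolding poly_bounded_def by (rule exI[of _ "[:0, 1:]"]) simp

lemma poly_bounded_add:
  assumes "poly_bounded f" "poly_bounded g"
  shows "poly_bounded (\<lambda>n. f n + g n)"
proof -
  obtain p q where "\<forall>n. f n \<le> poly p n" "\<forall>n. g n \<le> poly q n"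
    using assms by (auto simp: poly_bounded_def)
  thus ?thesis unfolding poly_bounded_def by (intro exI[of _ "p + q"]) (simp add: add_mono)
qed

lemma poly_bounded_mult:
  assumes "poly_bounded f" "poly_bounded g"
  shows "poly_bounded (\<lambda>n. f n * g n)"
proof -
  obtain p q where "\<forall>n. f n \<le> poly p n" "\<forall>n. g n \<le> poly q n"
    using assms by (auto simp: poly_bounded_def)
  thus ?thesis unfolding poly_bounded_def by (intro exI[of _ "p * q"]) (simp add: mult_mono)
qed

lemmas poly_bounded_intros =
  poly_bounded_const poly_bounded_id poly_bounded_add poly_bounded_mult

lemma abs_le_power_input_size:
  assumes "z \<in> set zs"
  shows "\<bar>z\<bar> \<le> 2 ^ input_size zs"
proof -
  have "int_bits z \<le> input_size zs"
    unfolding input_size_def using assms by (intro member_le_sum_list) auto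
  hence "(2 :: int) ^ int_bits z \<le> 2 ^ input_size zs" by (intro power_increasing) auto
  thus ?thesis using abs_le_power_int_bits[of z] by linarith
qed

lemma length_le_input_size: "length zs \<le> input_size zs"
proof -
  have "(\<Sum>z\<leftarrow>zs. 1 :: nat) \<le> input_size zs"
    unfolding input_size_def by (intro sum_list_mono) (simp add: int_bits_def)
  thus ?thesis by (simp add: sum_list_triv)
qed

text \<open>Passes from steps to bit cost. Numbers on the tape have at most
  \<open>input_size\<close> bits; the factor 2 admits products of two of them as right factors,
  which reading the history requires.\<close>

lemma polynomial_time_minimizableI:
  assumes "poly_bounded q"
    and "\<And>I. I \<in> insts \<Longrightarrow> wp (2 * input_size (enc I)) c
      (\<lambda>k st inp out. k \<le> q (input_size (enc I)) \<and>
        (\<exists>x. is_arg_min (obj I) (\<lambda>y. y \<in> feasible I) x \<and> out = enc_sol I x)) (\<lambda>_ _. 0) (enc I) []"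
  shows "polynomial_time_minimizable insts enc feasible obj enc_sol"
proof -
  define D where "D = com_size c"
  \<comment> \<open>The cost bound of \<open>exec_if_steps\<close> for \<open>L = 0\<close>, as the
    memory is initially zero, for \<open>A = 2 * n\<close>, and for \<open>X\<close> equal to the
    length that \<open>q n\<close> steps can produce.\<close>
  let ?t = "\<lambda>n. q n * ((D + 1) * (q n * (D * (2 * n + 1)) + 3))"
  have "poly_bounded ?t" by (intro poly_bounded_intros assms(1))
  then obtain p where p: "\<And>n. ?t n \<le> poly p n" by (auto simp: poly_bounded_def)
  have "\<exists>x t. is_arg_min (obj I) (\<lambda>y. y \<in> feasible I) x \<and> run c (enc I) t (enc_sol I x) \<and>
      t \<le> poly p (input_size (enc I))" if "I \<in> insts" for I
  proof -
    let ?M = "input_size (enc I)"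
    have zero: "flat (\<lambda>_ _. 0) = (\<lambda>_. 0)" by (auto simp: flat_def)
    from assms(2)[OF that] obtain k st inp x where
      k: "steps (2 * ?M) c ((\<lambda>_. 0), enc I, []) k (flat st, inp, enc_sol I x)" "k \<le> q ?M"
      and x: "is_arg_min (obj I) (\<lambda>y. y \<in> feasible I) x"
      unfolding wp_def zero by blast
    have "\<bar>v\<bar> \<le> 2 ^ (2 * ?M)" if "v \<in> set (enc I)" for v
      by (rule order.trans[OF abs_le_power_input_size[OF that]]) (rule power_increasing, auto)
    then obtain t where t: "exec c ((\<lambda>_. 0), enc I, []) t (flat st, inp, enc_sol I x)"
      "t \<le> k * ((D + 1) * (k * (D * (2 * ?M + 1)) + 3))"
      using exec_if_steps[OF k(1), of D 0 "k * (D * (2 * ?M + 1))"] by (auto simp: D_def)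
    have "k * ((D + 1) * (k * (D * (2 * ?M + 1)) + 3)) \<le> ?t ?M"
      using k(2) by (intro mult_mono add_mono) auto
    hence "t \<le> poly p ?M" using t(2) p[of ?M] by linarith
    thus ?thesis using t(1) x unfolding run_def by blast
  qed
  thus ?thesis unfolding polynomial_time_minimizable_def by blast
qed

section \<open>Reading an instance\<close>

text \<open>Adds the fraction \<open>Num / Den\<close>, multiplied by \<open>Coeff j\<close>, to
  every weight: both are brought to the denominator \<open>Scale * Den\<close>. Fractions are never
  reduced, so \<open>Scale\<close> becomes the product of all denominators used.\<close>

definition scale :: com where
  "scale = Seq
     (For Jx EdgeCount (Assign (loc Weight (Var Jx))
        (Plus (Times (Arr Weight (Var Jx)) (Var Den))
           (Times (Times (Var Scale) (Var Num)) (Arr Coeff (Var Jx))))))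
     (Assign (loc Scale (Const 0)) (Times (Var Scale) (Var Den)))"

text \<open>All vertex names go to the same cell and only the last one survives. It is the start
  vertex of Prim's algorithm; other vertices become known as ends of edges.\<close>

definition read_nodes :: com where
  "read_nodes = Seq (Read (loc NodeCount (Const 0)))
     (For Ix NodeCount (Read (loc Node (Const 0))))"

definition read_edges :: com where
  "read_edges = Seq (Read (loc EdgeCount (Const 0)))
     (For Ix EdgeCount (Seq (Read (loc Tail (Var Ix))) (Read (loc Head (Var Ix)))))"

text \<open>\<open>Coeff\<close> is temporarily the unit vector of the current edge. In this way
  \<open>scale\<close> serves for the cost of a single edge as well as for a historic weight, which
  affects many edges.\<close>

definition read_costs :: com where
  "read_costs = Seq (Assign (loc Scale (Const 0)) (Const 1))
     (For Ix EdgeCount (Seq (Read (loc Num (Const 0))) (Seq (Read (loc Den (Const 0)))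
        (Seq (Assign (loc Coeff (Var Ix)) (Const 1))
        (Seq scale (Assign (loc Coeff (Var Ix)) (Const 0)))))))"

definition read_important :: com where
  "read_important = For Ix EdgeCount (Read (loc Imp (Var Ix)))"

definition read_alpha :: com where
  "read_alpha = Seq (Read (loc AlphaNum (Const 0))) (Read (loc AlphaDen (Const 0)))"

definition read_solution :: com where
  "read_solution = For Jx EdgeCount (Seq (Read (loc Bit (Const 0)))
     (Assign (loc Coeff (Var Jx))
        (Times (Minus (Const 1) (Plus (Var Bit) (Var Bit))) (Arr Imp (Var Jx)))))"

text \<open>The objective function is scaled by \<open>1 / \<alpha>\<close>, so the costs need not be multiplied by \<open>\<alpha>\<close>.\<close>

definition read_history :: com where
  "read_history = Seq (Read (loc HistCount (Const 0)))
     (For Ix HistCount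
        (Seq read_solution
        (Seq (Read (loc Num (Const 0))) (Seq (Read (loc Den (Const 0)))
        (Seq (Assign (loc Num (Const 0)) (Times (Var Num) (Minus (Var AlphaDen) (Var AlphaNum))))
        (Seq (Assign (loc Den (Const 0)) (Times (Var Den) (Var AlphaNum))) scale))))))"

definition read_instance :: com where
  "read_instance = Seq read_nodes (Seq read_edges (Seq read_costs (Seq read_important
     (Seq read_alpha read_history))))"

definition write_solution :: com where
  "write_solution = For Ix EdgeCount (Write (Arr Chosen (Var Ix)))"

text \<open>
  The machine has no division, so the rational edge weights \<open>w\<close> are kept as integers
  relative to a common denominator.
\<close>

definition represents :: "store \<Rightarrow> nat \<Rightarrow> (nat \<Rightarrow> rat) \<Rightarrow> bool" where
  "represents st m w \<longleftrightarrow> st Scale 0 > 0 \<and>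
     (\<forall>j<m. rat_of_int (st Weight (int j)) = rat_of_int (st Scale 0) * w j)"

section \<open>Correctness of reading the input\<close>

lemma wp_scale:
  assumes m: "st EdgeCount 0 = int m"
    and bounds: "\<bar>st Den 0\<bar> \<le> 2 ^ A" "\<bar>st Num 0\<bar> \<le> 2 ^ A"
    and coeff: "\<And>j. j < m \<Longrightarrow> \<bar>st Coeff (int j)\<bar> \<le> 1"
    and den: "st Den 0 > 0"
    and w: "represents st m w"
  shows "wp A scale (\<lambda>k st' inp' out'. k \<le> m * 4 + 5 \<and> inp' = inp \<and> out' = out \<and>
      (\<forall>x. x \<notin> {Weight, Scale, Jx} \<longrightarrow> st' x = st x) \<and>
      represents st' m (\<lambda>j. w j + rat_of_int (st Coeff (int j)) * Fract (st Num 0) (st Den 0)))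
    st inp out"
proof -
  let ?new = "\<lambda>j. st Weight (int j) * st Den 0 + st Scale 0 * st Num 0 * st Coeff (int j)"
  have pow: "(1 :: int) \<le> 2 ^ A" by simp
  have "wp A (For Jx EdgeCount (Assign (loc Weight (Var Jx))
        (Plus (Times (Arr Weight (Var Jx)) (Var Den))
           (Times (Times (Var Scale) (Var Num)) (Arr Coeff (Var Jx))))))
     (\<lambda>k st' inp' out'. k \<le> m * (1 + 3) + 3 \<and> (inp' = inp \<and> out' = out \<and>
        (\<forall>x. x \<notin> {Weight, Jx} \<longrightarrow> st' x = st x) \<and>
        (\<forall>j<m. st' Weight (int j) = (if j < m then ?new j else st Weight (int j))))) st inp out"
  proof (rule wp_For[where Inv = "\<lambda>i st' inp' out'. inp' = inp \<and> out' = out \<and>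
        (\<forall>x. x \<notin> {Weight, Jx} \<longrightarrow> st' x = st x) \<and>
        (\<forall>j<m. st' Weight (int j) = (if j < i then ?new j else st Weight (int j)))"])
    fix i st' inp' out'
    assume i: "i < m" "st' Jx 0 = int i" and inv: "inp' = inp \<and> out' = out \<and>
        (\<forall>x. x \<notin> {Weight, Jx} \<longrightarrow> st' x = st x) \<and>
        (\<forall>j<m. st' Weight (int j) = (if j < i then ?new j else st Weight (int j)))"
    have "\<bar>st Coeff (int i)\<bar> \<le> 2 ^ A" using coeff[OF i(1)] pow by linarith
    thus "wp A (Assign (loc Weight (Var Jx))
        (Plus (Times (Arr Weight (Var Jx)) (Var Den))
           (Times (Times (Var Scale) (Var Num)) (Arr Coeff (Var Jx)))))
      (\<lambda>k st' inp' out'. k \<le> 1 \<and> st' Jx 0 = int i \<and> (inp' = inp \<and> out' = out \<and>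
        (\<forall>x. x \<notin> {Weight, Jx} \<longrightarrow> (st'(Jx := (st' Jx)(0 := int (Suc i)))) x = st x) \<and>
        (\<forall>j<m. (st'(Jx := (st' Jx)(0 := int (Suc i)))) Weight (int j) =
           (if j < Suc i then ?new j else st Weight (int j))))) st' inp' out'"
      using i inv bounds by (intro wp_rules) (auto simp: less_Suc_eq)
  qed (use m in auto)
  \<comment> \<open>Over the denominator \<open>Scale * Den\<close>, the old weight has the
    numerator \<open>Weight j * Den\<close>, and the added multiple of \<open>Num / Den\<close> has
    the numerator \<open>Scale * Num * Coeff j\<close>.\<close>
  moreover have "rat_of_int (?new j) = rat_of_int (st Scale 0 * st Den 0) *
      (w j + rat_of_int (st Coeff (int j)) * Fract (st Num 0) (st Den 0))" if "j < m" for j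
    using w den that by (auto simp: represents_def Fract_of_int_quotient field_simps)
  ultimately show ?thesis
    unfolding scale_def using w den bounds
    by (intro wp_Seq, elim wp_mono) (intro wp_rules; auto simp: represents_def)
qed

lemma wp_read_nodes:
  "wp A read_nodes (\<lambda>k st' inp' out'. k \<le> length ns * 4 + 5 \<and> inp' = rest \<and> out' = out \<and>
      st' NodeCount 0 = int (length ns) \<and> (ns \<noteq> [] \<longrightarrow> st' Node 0 = int (last ns)) \<and>
      (\<forall>x. x \<notin> {NodeCount, Node, Ix} \<longrightarrow> st' x = st x))
    st (int (length ns) # map int ns @ rest) out"
proof -
  let ?I = "\<lambda>i st' inp' out'. inp' = map int (drop i ns) @ rest \<and> out' = out \<and>
      st' NodeCount 0 = int (length ns) \<and> (i > 0 \<longrightarrow> st' Node 0 = int (ns ! (i - 1))) \<and>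
      (\<forall>x. x \<notin> {NodeCount, Node, Ix} \<longrightarrow> st' x = st x)"
  let ?st = "st(NodeCount := (st NodeCount)(0 := int (length ns)))"
  have loop: "wp A (For Ix NodeCount (Read (loc Node (Const 0))))
    (\<lambda>k st' inp' out'. k \<le> length ns * (1 + 3) + 3 \<and> ?I (length ns) st' inp' out')
    ?st (map int ns @ rest) out"
  proof (rule wp_For[where Inv = ?I])
    fix i st' inp' out'
    assume i: "i < length ns" "st' Ix 0 = int i" "?I i st' inp' out'"
    hence drop: "drop i ns = ns ! i # drop (Suc i) ns" by (simp add: Cons_nth_drop_Suc)
    show "wp A (Read (loc Node (Const 0))) (\<lambda>k st' inp' out'. k \<le> 1 \<and> st' Ix 0 = int i \<and>
        ?I (Suc i) (st'(Ix := (st' Ix)(0 := int (Suc i)))) inp' out') st' inp' out'"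
      using i by (intro wp_rules) (auto simp: drop)
  qed auto
  show ?thesis
    unfolding read_nodes_def by (intro wp_rules wp_step[OF loop]) (auto simp: last_conv_nth)
qed

lemma wp_read_edges:
  "wp A read_edges (\<lambda>k st' inp' out'. k \<le> length xs * 6 + 5 \<and> inp' = rest \<and> out' = out \<and>
      st' EdgeCount 0 = int (length xs) \<and>
      (\<forall>j<length xs. st' Tail (int j) = int (a (xs ! j)) \<and> st' Head (int j) = int (b (xs ! j))) \<and>
      (\<forall>x. x \<notin> {EdgeCount, Tail, Head, Ix} \<longrightarrow> st' x = st x))
    st (int (length xs) # concat (map (\<lambda>x. [int (a x), int (b x)]) xs) @ rest) out"
proof -
  let ?I = "\<lambda>i st' inp' out'. inp' = concat (map (\<lambda>x. [int (a x), int (b x)]) (drop i xs)) @ rest \<and>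
      out' = out \<and> st' EdgeCount 0 = int (length xs) \<and>
      (\<forall>j<i. st' Tail (int j) = int (a (xs ! j)) \<and> st' Head (int j) = int (b (xs ! j))) \<and>
      (\<forall>x. x \<notin> {EdgeCount, Tail, Head, Ix} \<longrightarrow> st' x = st x)"
  let ?st = "st(EdgeCount := (st EdgeCount)(0 := int (length xs)))"
  have loop: "wp A (For Ix EdgeCount (Seq (Read (loc Tail (Var Ix))) (Read (loc Head (Var Ix)))))
    (\<lambda>k st' inp' out'. k \<le> length xs * (3 + 3) + 3 \<and> ?I (length xs) st' inp' out')
    ?st (concat (map (\<lambda>x. [int (a x), int (b x)]) xs) @ rest) out"
  proof (rule wp_For[where Inv = ?I])
    fix i st' inp' out'
    assume i: "i < length xs" "st' Ix 0 = int i" "?I i st' inp' out'"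
    hence drop: "drop i xs = xs ! i # drop (Suc i) xs" by (simp add: Cons_nth_drop_Suc)
    show "wp A (Seq (Read (loc Tail (Var Ix))) (Read (loc Head (Var Ix))))
      (\<lambda>k st' inp' out'. k \<le> 3 \<and> st' Ix 0 = int i \<and>
        ?I (Suc i) (st'(Ix := (st' Ix)(0 := int (Suc i)))) inp' out') st' inp' out'"
      using i by (intro wp_rules) (auto simp: drop less_Suc_eq)
  qed auto
  show ?thesis
    unfolding read_edges_def by (intro wp_rules wp_step[OF loop]) (auto)
qed

lemma quotient_of_parts:
  assumes "x \<in> set xs" "set (concat (map (\<lambda>x. encode_rat (f x)) xs)) \<subseteq> S"
  shows "fst (quotient_of (f x)) \<in> S" "snd (quotient_of (f x)) \<in> S"
  using assms by (auto simp: encode_rat_def)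

lemma Fract_quotient_of [simp]: "Fract (fst (quotient_of q)) (snd (quotient_of q)) = q"
  by (metis Fract_of_int_quotient prod.collapse quotient_of_div)

lemma wp_read_costs:
  assumes m: "st EdgeCount 0 = int (length xs)"
    and zero: "st Weight = (\<lambda>_. 0)" "st Coeff = (\<lambda>_. 0)"
    and bound: "set (concat (map (\<lambda>x. encode_rat (c x)) xs)) \<subseteq> {v. \<bar>v\<bar> \<le> 2 ^ A}"
  shows "wp A read_costs (\<lambda>k st' inp' out'. k \<le> length xs * (length xs * 4 + 16) + 5 \<and>
      inp' = rest \<and> out' = out \<and>
      represents st' (length xs) (\<lambda>j. c (xs ! j)) \<and>
      (\<forall>x. x \<notin> {Weight, Scale, Coeff, Num, Den, Ix, Jx} \<longrightarrow> st' x = st x))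
    st (concat (map (\<lambda>x. encode_rat (c x)) xs) @ rest) out"
proof -
  let ?m = "length xs"
  let ?w = "\<lambda>i j. if j < i then c (xs ! j) else 0"
  let ?I = "\<lambda>i st' inp' out'. inp' = concat (map (\<lambda>x. encode_rat (c x)) (drop i xs)) @ rest \<and>
      out' = out \<and> represents st' ?m (?w i) \<and> st' Coeff = (\<lambda>_. 0) \<and>
      (\<forall>x. x \<notin> {Weight, Scale, Coeff, Num, Den, Ix, Jx} \<longrightarrow> st' x = st x)"
  let ?body = "Seq (Read (loc Num (Const 0))) (Seq (Read (loc Den (Const 0)))
        (Seq (Assign (loc Coeff (Var Ix)) (Const 1))
        (Seq scale (Assign (loc Coeff (Var Ix)) (Const 0)))))"
  have loop: "wp A (For Ix EdgeCount ?body)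
    (\<lambda>k st' inp' out'. k \<le> ?m * (?m * 4 + 13 + 3) + 3 \<and> ?I ?m st' inp' out')
    (st(Scale := (st Scale)(0 := 1))) (concat (map (\<lambda>x. encode_rat (c x)) xs) @ rest) out"
  proof (rule wp_For[where Inv = ?I])
    fix i st1 inp' out'
    assume i: "i < ?m" "st1 Ix 0 = int i" and I: "?I i st1 inp' out'"
    hence inv: "inp' = concat (map (\<lambda>x. encode_rat (c x)) (drop i xs)) @ rest"
      "out' = out" "represents st1 ?m (?w i)" "st1 Coeff = (\<lambda>_. 0)"
      and frame: "\<And>x. x \<notin> {Weight, Scale, Coeff, Num, Den, Ix, Jx} \<Longrightarrow> st1 x = st x" by blast+
    define p where "p = fst (quotient_of (c (xs ! i)))"
    define q where "q = snd (quotient_of (c (xs ! i)))"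
    have inp': "inp' = p # q # concat (map (\<lambda>x. encode_rat (c x)) (drop (Suc i) xs)) @ rest"
      using i inv by (simp add: p_def q_def encode_rat_def flip: Cons_nth_drop_Suc)
    have pq: "\<bar>p\<bar> \<le> 2 ^ A" "\<bar>q\<bar> \<le> 2 ^ A" "q > 0" "Fract p q = c (xs ! i)"
      using quotient_of_parts[OF nth_mem[OF i(1)] bound] quotient_of_denom_pos'
      by (auto simp: p_def q_def)
    define st2 where "st2 = st1(Num := (st1 Num)(0 := p), Den := (st1 Den)(0 := q),
      Coeff := (\<lambda>_. 0)(int i := 1))"
    \<comment> \<open>\<open>Coeff\<close> is the unit vector at \<open>i\<close>: the weight of
      edge \<open>i\<close> grows from 0 to its cost, while all other weights keep their value and
      merely change the denominator.\<close>
    have scale: "wp A scale (\<lambda>k st' inp' out'. k \<le> ?m * 4 + 5 \<and>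
        inp' = concat (map (\<lambda>x. encode_rat (c x)) (drop (Suc i) xs)) @ rest \<and> out' = out \<and>
        (\<forall>x. x \<notin> {Weight, Scale, Jx} \<longrightarrow> st' x = st2 x) \<and>
        represents st' ?m (\<lambda>j. ?w i j + rat_of_int (st2 Coeff (int j)) * Fract (st2 Num 0) (st2 Den 0)))
      st2 (concat (map (\<lambda>x. encode_rat (c x)) (drop (Suc i) xs)) @ rest) out"
      by (rule wp_scale) (use m pq(1-3) frame inv in \<open>auto simp: st2_def represents_def\<close>)
    have w: "(\<lambda>j. ?w i j + rat_of_int (st2 Coeff (int j)) * Fract (st2 Num 0) (st2 Den 0)) = ?w (Suc i)"
      using pq by (auto simp: st2_def fun_eq_iff less_Suc_eq)
    note scale = scale[unfolded w]
    show "wp A ?body (\<lambda>k st' inp' out'. k \<le> ?m * 4 + 13 \<and> st' Ix 0 = int i \<and>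
        ?I (Suc i) (st'(Ix := (st' Ix)(0 := int (Suc i)))) inp' out') st1 inp' out'"
      using i inv(2-4) frame unfolding inp'
      by (intro wp_Seq wp_Read wp_Assign wp_step[OF scale]) (auto simp: st2_def represents_def)
  qed (use m zero in \<open>auto simp: represents_def\<close>)
  show ?thesis
    unfolding read_costs_def by (intro wp_rules wp_step[OF loop]) (auto simp: represents_def algebra_simps)
qed

lemma wp_read_important:
  assumes m: "st EdgeCount 0 = int (length xs)"
  shows "wp A read_important (\<lambda>k st' inp' out'. k \<le> length xs * 4 + 3 \<and> inp' = rest \<and> out' = out \<and>
      (\<forall>j<length xs. st' Imp (int j) = f (xs ! j)) \<and> (\<forall>x. x \<notin> {Imp, Ix} \<longrightarrow> st' x = st x))
    st (map f xs @ rest) out"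
proof -
  let ?I = "\<lambda>i st' inp' out'. inp' = map f (drop i xs) @ rest \<and> out' = out \<and>
      (\<forall>j<i. st' Imp (int j) = f (xs ! j)) \<and> (\<forall>x. x \<notin> {Imp, Ix} \<longrightarrow> st' x = st x)"
  have loop: "wp A read_important
    (\<lambda>k st' inp' out'. k \<le> length xs * (1 + 3) + 3 \<and> ?I (length xs) st' inp' out')
    st (map f xs @ rest) out"
    unfolding read_important_def
  proof (rule wp_For[where Inv = ?I])
    fix i st' inp' out'
    assume i: "i < length xs" "st' Ix 0 = int i" "?I i st' inp' out'"
    hence drop: "drop i xs = xs ! i # drop (Suc i) xs" by (simp add: Cons_nth_drop_Suc)
    show "wp A (Read (loc Imp (Var Ix))) (\<lambda>k st' inp' out'. k \<le> 1 \<and> st' Ix 0 = int i \<and>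
        ?I (Suc i) (st'(Ix := (st' Ix)(0 := int (Suc i)))) inp' out') st' inp' out'"
      using i by (intro wp_rules) (auto simp: drop less_Suc_eq)
  qed (use m in auto)
  show ?thesis by (rule wp_step[OF loop]) auto
qed

lemma wp_read_solution:
  assumes m: "st EdgeCount 0 = int (length xs)"
    and imp: "\<And>j. j < length xs \<Longrightarrow> st Imp (int j) \<in> {0, 1}"
  shows "wp A read_solution (\<lambda>k st' inp' out'. k \<le> length xs * 6 + 3 \<and> inp' = rest \<and> out' = out \<and>
      (\<forall>j<length xs. st' Coeff (int j) = (1 - 2 * f (xs ! j)) * st Imp (int j)) \<and>
      (\<forall>x. x \<notin> {Bit, Coeff, Jx} \<longrightarrow> st' x = st x))
    st (map f xs @ rest) out"
proof -
  let ?I = "\<lambda>i st' inp' out'. inp' = map f (drop i xs) @ rest \<and> out' = out \<and>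
      (\<forall>j<i. st' Coeff (int j) = (1 - 2 * f (xs ! j)) * st Imp (int j)) \<and>
      (\<forall>x. x \<notin> {Bit, Coeff, Jx} \<longrightarrow> st' x = st x)"
  have loop: "wp A read_solution
    (\<lambda>k st' inp' out'. k \<le> length xs * (3 + 3) + 3 \<and> ?I (length xs) st' inp' out')
    st (map f xs @ rest) out"
    unfolding read_solution_def
  proof (rule wp_For[where Inv = ?I])
    fix i st' inp' out'
    assume i: "i < length xs" "st' Jx 0 = int i" "?I i st' inp' out'"
    hence drop: "drop i xs = xs ! i # drop (Suc i) xs" by (simp add: Cons_nth_drop_Suc)
    have "\<bar>st Imp (int i)\<bar> \<le> 2 ^ A" using imp[OF i(1)] by auto
    thus "wp A (Seq (Read (loc Bit (Const 0))) (Assign (loc Coeff (Var Jx))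
          (Times (Minus (Const 1) (Plus (Var Bit) (Var Bit))) (Arr Imp (Var Jx)))))
        (\<lambda>k st' inp' out'. k \<le> 3 \<and> st' Jx 0 = int i \<and>
        ?I (Suc i) (st'(Jx := (st' Jx)(0 := int (Suc i)))) inp' out') st' inp' out'"
      using i by (intro wp_rules) (auto simp: drop less_Suc_eq)
  qed (use m in auto)
  show ?thesis by (rule wp_step[OF loop]) auto
qed

text \<open>The factor \<open>Fract (st AlphaDen 0 - st AlphaNum 0) (st AlphaNum 0)\<close> is \<open>(1 - \<alpha>) / \<alpha>\<close>.\<close>

lemma wp_read_history:
  assumes m: "st EdgeCount 0 = int (length xs)"
    and imp: "\<And>j. j < length xs \<Longrightarrow> st Imp (int j) \<in> {0, 1}"
    and alpha: "0 < st AlphaNum 0" "st AlphaNum 0 < st AlphaDen 0" "st AlphaDen 0 \<le> 2 ^ M"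
    and w: "represents st (length xs) w"
    and f01: "\<And>x l j. (x, l) \<in> set hs \<Longrightarrow> j \<in> set xs \<Longrightarrow> x j \<in> {0, 1}"
    and bound: "set (concat (map (\<lambda>(x, l). encode_rat l) hs)) \<subseteq> {v. \<bar>v\<bar> \<le> 2 ^ M}"
  shows "wp (2 * M) read_history (\<lambda>k st' inp' out'.
      k \<le> length hs * (length xs * 10 + 21) + 5 \<and> inp' = rest \<and> out' = out \<and>
      represents st' (length xs) (\<lambda>j. w j + Fract (st AlphaDen 0 - st AlphaNum 0) (st AlphaNum 0) *
        rat_of_int (st Imp (int j)) *
        (\<Sum>i<length hs. snd (hs ! i) * (1 - 2 * of_nat (fst (hs ! i) (xs ! j))))) \<and>
      (\<forall>x. x \<notin> {HistCount, Weight, Scale, Coeff, Num, Den, Bit, Ix, Jx} \<longrightarrow> st' x = st x))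
    st (int (length hs) #
      concat (map (\<lambda>(x, l). map (\<lambda>j. int (x j)) xs @ encode_rat l) hs) @ rest) out"
proof -
  let ?m = "length xs" and ?n = "length hs"
  let ?a = "st AlphaNum 0" and ?b = "st AlphaDen 0"
  define enc where "enc = (\<lambda>(x :: 'a \<Rightarrow> nat, l). map (\<lambda>j. int (x j)) xs @ encode_rat l)"
  define W where "W = (\<lambda>i j. w j + Fract (?b - ?a) ?a * rat_of_int (st Imp (int j)) *
        (\<Sum>i<i. snd (hs ! i) * (1 - 2 * of_nat (fst (hs ! i) (xs ! j)))))"
  let ?I = "\<lambda>i st' inp' out'. inp' = concat (map enc (drop i hs)) @ rest \<and>
      out' = out \<and> st' HistCount 0 = int ?n \<and> represents st' ?m (W i) \<and>
      (\<forall>x. x \<notin> {HistCount, Weight, Scale, Coeff, Num, Den, Bit, Ix, Jx} \<longrightarrow> st' x = st x)"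
  let ?body = "Seq read_solution
        (Seq (Read (loc Num (Const 0))) (Seq (Read (loc Den (Const 0)))
        (Seq (Assign (loc Num (Const 0)) (Times (Var Num) (Minus (Var AlphaDen) (Var AlphaNum))))
        (Seq (Assign (loc Den (Const 0)) (Times (Var Den) (Var AlphaNum))) scale))))"
  have pow: "(2 :: int) ^ M \<le> 2 ^ (2 * M)" by (rule power_increasing) auto
  have ab: "\<bar>?b - ?a\<bar> \<le> 2 ^ M" "\<bar>?a\<bar> \<le> 2 ^ M" using alpha by auto
  have loop: "wp (2 * M) (For Ix HistCount ?body)
    (\<lambda>k st' inp' out'. k \<le> ?n * (?m * 10 + 18 + 3) + 3 \<and> ?I ?n st' inp' out')
    (st(HistCount := (st HistCount)(0 := int ?n))) (concat (map enc hs) @ rest) out"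
  proof (rule wp_For[where Inv = ?I])
    fix i st1 inp' out'
    assume i: "i < ?n" "st1 Ix 0 = int i" and I: "?I i st1 inp' out'"
    hence inv: "out' = out" "st1 HistCount 0 = int ?n" "represents st1 ?m (W i)"
      and frame: "\<And>x. x \<notin> {HistCount, Weight, Scale, Coeff, Num, Den, Bit, Ix, Jx} \<Longrightarrow> st1 x = st x"
      by blast+
    obtain x l where xl: "hs ! i = (x, l)" by fastforce
    hence xl_in: "(x, l) \<in> set hs" using nth_mem[OF i(1)] by simp
    define p where "p = fst (quotient_of l)"
    define q where "q = snd (quotient_of l)"
    let ?rest = "concat (map enc (drop (Suc i) hs)) @ rest"
    have drop: "drop i hs = (x, l) # drop (Suc i) hs" using i xl by (metis Cons_nth_drop_Suc)
    have inp': "inp' = map (\<lambda>j. int (x j)) xs @ p # q # ?rest"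
      using I by (simp add: drop enc_def p_def q_def encode_rat_def)
    have "{p, q} \<subseteq> {v. \<bar>v\<bar> \<le> 2 ^ M}"
      using bound xl_in by (force simp: p_def q_def encode_rat_def)
    hence pq: "\<bar>p\<bar> \<le> 2 ^ M" "\<bar>q\<bar> \<le> 2 ^ M" "q > 0" "Fract p q = l"
      using quotient_of_denom_pos' by (auto simp: p_def q_def)
    \<comment> \<open>These are the products of two input numbers that force the factor length
      \<open>2 * M\<close>.\<close>
    have prod: "\<bar>p * (?b - ?a)\<bar> \<le> 2 ^ (2 * M)" "\<bar>q * ?a\<bar> \<le> 2 ^ (2 * M)"
      unfolding abs_mult mult_2 power_add using pq ab by (auto intro!: mult_mono)
    have solution: "wp (2 * M) read_solution (\<lambda>k st' inp' out'.
        k \<le> ?m * 6 + 3 \<and> inp' = p # q # ?rest \<and> out' = out \<and>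
        (\<forall>j<?m. st' Coeff (int j) = (1 - 2 * int (x (xs ! j))) * st1 Imp (int j)) \<and>
        (\<forall>y. y \<notin> {Bit, Coeff, Jx} \<longrightarrow> st' y = st1 y))
      st1 (map (\<lambda>j. int (x j)) xs @ p # q # ?rest) out"
      by (rule wp_read_solution) (use m imp frame in auto)
    \<comment> \<open>Stated for every store with the listed properties, because the store reached
      after \<open>read_solution\<close> is known only through its postcondition.\<close>
    have scale: "wp (2 * M) scale (\<lambda>k st' inp' out'. k \<le> ?m * 4 + 5 \<and> inp' = ?rest \<and> out' = out \<and>
        (\<forall>x. x \<notin> {Weight, Scale, Jx} \<longrightarrow> st' x = st2 x) \<and> represents st' ?m (W (Suc i)))
      st2 inp2 out2"
      if st2: "\<forall>j<?m. st2 Coeff (int j) = (1 - 2 * int (x (xs ! j))) * st1 Imp (int j)"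
        "\<forall>y. y \<notin> {Bit, Coeff, Jx, Num, Den} \<longrightarrow> st2 y = st1 y"
        "st2 Num 0 = p * (?b - ?a)" "st2 Den 0 = q * ?a" "inp2 = ?rest" "out2 = out"
      for st2 inp2 out2
      unfolding st2(5,6)
    proof (rule wp_mono[OF wp_scale[where m = ?m and w = "W i"]])
      show "\<bar>st2 Coeff (int j)\<bar> \<le> 1" if "j < ?m" for j
        using st2 that f01[OF xl_in nth_mem[OF that]] imp[OF that] frame[of Imp] by auto
      fix n st' inp' out'
      assume *: "n \<le> ?m * 4 + 5 \<and> inp' = ?rest \<and> out' = out \<and>
        (\<forall>x. x \<notin> {Weight, Scale, Jx} \<longrightarrow> st' x = st2 x) \<and>
        represents st' ?m (\<lambda>j. W i j + rat_of_int (st2 Coeff (int j)) * Fract (st2 Num 0) (st2 Den 0))"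
      have frac: "Fract (p * (?b - ?a)) (q * ?a) = Fract (?b - ?a) ?a * l"
        unfolding pq(4)[symmetric] by (simp add: mult.commute)
      have "W i j + rat_of_int (st2 Coeff (int j)) * Fract (st2 Num 0) (st2 Den 0) = W (Suc i) j"
        if "j < ?m" for j
      proof -
        have coeff: "rat_of_int (st2 Coeff (int j)) =
            (1 - 2 * of_nat (x (xs ! j))) * rat_of_int (st Imp (int j))"
          using st2(1) that frame[of Imp] by simp
        show ?thesis unfolding st2(3,4) frac coeff W_def by (simp add: xl algebra_simps)
      qed
      thus "n \<le> ?m * 4 + 5 \<and> inp' = ?rest \<and> out' = out \<and>
        (\<forall>x. x \<notin> {Weight, Scale, Jx} \<longrightarrow> st' x = st2 x) \<and> represents st' ?m (W (Suc i))"
        using * by (simp add: represents_def)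
    qed (use st2 m frame inv prod pq alpha in \<open>auto simp: represents_def\<close>)
    show "wp (2 * M) ?body (\<lambda>k st' inp' out'. k \<le> ?m * 10 + 18 \<and> st' Ix 0 = int i \<and>
        ?I (Suc i) (st'(Ix := (st' Ix)(0 := int (Suc i)))) inp' out') st1 inp' out'"
      unfolding inp' inv(1)
      by (intro wp_Seq wp_Read wp_Assign wp_step[OF solution] wp_mono[OF scale])
        (use i inv(2) frame order.trans[OF ab(1) pow] order.trans[OF ab(2) pow] in \<open>auto simp: represents_def\<close>)
  qed (use w in \<open>auto simp: represents_def W_def\<close>)
  show ?thesis
    unfolding read_history_def
    by (intro wp_rules wp_step[OF loop]) (simp_all add: enc_def W_def add.assoc)
qed

lemma wp_write_solution:
  assumes m: "st EdgeCount 0 = int m"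
  shows "wp A write_solution (\<lambda>k st' inp' out'. k \<le> m * 4 + 3 \<and>
      out' = out @ map (\<lambda>j. st Chosen (int j)) [0..<m]) st inp out"
proof -
  let ?I = "\<lambda>i st' inp' out'. out' = out @ map (\<lambda>j. st Chosen (int j)) [0..<i] \<and>
    (\<forall>x. x \<noteq> Ix \<longrightarrow> st' x = st x)"
  have loop: "wp A write_solution (\<lambda>k st' inp' out'. k \<le> m * (1 + 3) + 3 \<and> ?I m st' inp' out') st inp out"
    unfolding write_solution_def
  proof (rule wp_For[where Inv = ?I])
    fix i st' inp' out'
    assume "i < m" "st' Ix 0 = int i" "?I i st' inp' out'"
    thus "wp A (Write (Arr Chosen (Var Ix))) (\<lambda>k st' inp' out'. k \<le> 1 \<and> st' Ix 0 = int i \<and>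
        ?I (Suc i) (st'(Ix := (st' Ix)(0 := int (Suc i)))) inp' out') st' inp' out'"
      by (intro wp_rules) auto
  qed (use m in auto)
  show ?thesis by (rule wp_step[OF loop]) auto
qed

text \<open>The coefficient of the variable of edge \<open>j\<close> after the Hamming distances
  have been expanded and the objective has been divided by \<open>alpha I\<close>.\<close>

definition linear_weight :: "('e, 'a) scalarized_instance_scheme \<Rightarrow> 'e \<Rightarrow> rat" where
  "linear_weight I j = cost I j + (1 - alpha I) / alpha I * (if j \<in> important I then
     \<Sum>i<length (history I). snd (history I ! i) * (1 - 2 * of_nat (fst (history I ! i) j)) else 0)"

definition loaded :: "('e, 'a) scalarized_instance_scheme \<Rightarrow> ('e \<Rightarrow> nat) \<Rightarrow> ('e \<Rightarrow> nat) \<Rightarrow>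
    store \<Rightarrow> bool" where
  "loaded I a b st \<longleftrightarrow> st NodeCount 0 = int (length (nodes I)) \<and>
     (nodes I \<noteq> [] \<longrightarrow> st Node 0 = int (last (nodes I))) \<and>
     st EdgeCount 0 = int (length (items I)) \<and>
     (\<forall>j<length (items I). st Tail (int j) = int (a (items I ! j)) \<and>
        st Head (int j) = int (b (items I ! j))) \<and>
     represents st (length (items I)) (\<lambda>j. linear_weight I (items I ! j))"

lemma wp_Seq_mono:
  assumes "wp A c P st inp out"
    and "\<And>n st' inp' out'. P n st' inp' out' \<Longrightarrow> wp A d (\<lambda>k. Q (n + k + 1)) st' inp' out'"
  shows "wp A (Seq c d) Q st inp out"
  using assms by (intro wp_Seq, elim wp_mono)

lemma wp_read_instance:
  fixes I :: "('e, 'a) scalarized_instance_scheme"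
  defines "V \<equiv> length (nodes I)" and "E \<equiv> length (items I)" and "N \<equiv> length (history I)"
  assumes alpha: "0 < alpha I" "alpha I < 1"
    and hist: "\<And>x l j. (x, l) \<in> set (history I) \<Longrightarrow> j \<in> set (items I) \<Longrightarrow> x j \<in> {0, 1}"
    and bound: "set (encode (\<lambda>j. [int (a j), int (b j)]) I) \<subseteq> {v. \<bar>v\<bar> \<le> 2 ^ M}"
    and zero: "st Weight = (\<lambda>_. 0)" "st Coeff = (\<lambda>_. 0)"
  shows "wp (2 * M) read_instance (\<lambda>k st' inp' out'.
      k \<le> V * 4 + E * (E * 4 + 26) + N * (E * 10 + 21) + 32 \<and> out' = out \<and> loaded I a b st' \<and>
      (\<forall>x\<in>{Src, Snk, Chosen, Reached, Dist, Via}. st' x = st x))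
    st (encode (\<lambda>j. [int (a j), int (b j)]) I) out"
proof -
  let ?xs = "items I"
  obtain p q where pq: "quotient_of (alpha I) = (p, q)" by fastforce
  have pow: "(2 :: int) ^ M \<le> 2 ^ (2 * M)" by (rule power_increasing) auto
  \<comment> \<open>The tape is named suffix by suffix, so that what one phase leaves unread is
    literally the input of the next. The trailing \<open>[]\<close> gives \<open>r6\<close> the
    shape \<open>... @ rest\<close> expected by \<open>wp_read_history\<close>.\<close>
  define r6 where "r6 = int N # concat (map (\<lambda>(x, l). map (\<lambda>j. int (x j)) ?xs @ encode_rat l) (history I)) @ []"
  define r5 where "r5 = p # q # r6"
  define r4 where "r4 = map (\<lambda>j. of_bool (j \<in> important I)) ?xs @ r5"
  define r3 where "r3 = concat (map (\<lambda>j. encode_rat (cost I j)) ?xs) @ r4"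
  define r2 where "r2 = int E # concat (map (\<lambda>j. [int (a j), int (b j)]) ?xs) @ r3"
  have enc: "encode (\<lambda>j. [int (a j), int (b j)]) I = int V # map int (nodes I) @ r2"
    by (simp add: encode_def r2_def r3_def r4_def r5_def r6_def encode_vec_def
        encode_rat_def[of "alpha I"] pq V_def E_def N_def)
  have r6: "set (concat (map (\<lambda>(x, l). encode_rat l) (history I))) \<subseteq> {v. \<bar>v\<bar> \<le> 2 ^ M}"
  proof -
    have "set (concat (map (\<lambda>(x, l). encode_rat l) (history I))) \<subseteq> set r6"
      by (auto simp: r6_def)
    also have "\<dots> \<subseteq> {v. \<bar>v\<bar> \<le> 2 ^ M}"
      using bound unfolding enc by (auto simp: r2_def r3_def r4_def r5_def)
    finally show ?thesis .
  qed
  have r3: "set (concat (map (\<lambda>j. encode_rat (cost I j)) ?xs)) \<subseteq> {v. \<bar>v\<bar> \<le> 2 ^ (2 * M)}"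
  proof -
    have "set (concat (map (\<lambda>j. encode_rat (cost I j)) ?xs)) \<subseteq> {v. \<bar>v\<bar> \<le> 2 ^ M}"
      using bound unfolding enc by (auto simp: r2_def r3_def)
    also have "\<dots> \<subseteq> {v. \<bar>v\<bar> \<le> 2 ^ (2 * M)}" by (auto intro: order.trans[OF _ pow])
    finally show ?thesis .
  qed

  have q: "alpha I = Fract p q" "q > 0"
    using Fract_quotient_of[of "alpha I"] quotient_of_denom_pos[OF pq] pq by simp_all
  \<comment> \<open>From 0 < \<alpha> < 1: the new denominator \<open>Den * p\<close> stays
    positive, and \<open>q - p\<close> is positive and not longer than \<open>q\<close>.\<close>
  have "0 < p" "p < q"
    using alpha q(2) unfolding q(1) by (simp_all add: zero_less_Fract_iff Fract_less_one_iff)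
  moreover have "q \<le> 2 ^ M"
    using bound unfolding enc by (auto simp: r2_def r3_def r4_def r5_def)
  ultimately have q': "0 < p" "p < q" "q \<le> 2 ^ M" by auto
  have ratio: "Fract (q - p) (p) = (1 - alpha I) / alpha I"
    using q' unfolding q(1) by (simp add: Fract_of_int_quotient divide_simps)
  show ?thesis
    unfolding read_instance_def enc V_def
  proof (rule wp_Seq_mono[OF wp_read_nodes], goal_cases)
    case (1 k1 st1 inp1 out1)
    hence eq: "inp1 = r2" "out1 = out" by simp_all
    note st1 = 1
    show ?case
      unfolding eq r2_def E_def
    proof (rule wp_Seq_mono[OF wp_read_edges], goal_cases)
      case (1 k2 st2 inp2 out2)
      hence eq: "inp2 = r3" "out2 = out" by simp_all
      note st2 = 1
      show ?case
        unfolding eq r3_def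
      proof (rule wp_Seq_mono[OF wp_read_costs[where c = "cost I"]], goal_cases)
        case (5 k3 st3 inp3 out3)
        hence eq: "inp3 = r4" "out3 = out" by simp_all
        note st3 = 5
        show ?case
          unfolding eq r4_def
        proof (rule wp_Seq_mono[OF wp_read_important], goal_cases)
          case (2 k4 st4 inp4 out4)
          hence eq: "inp4 = r5" "out4 = out" by simp_all
          note st4 = 2
          let ?st5 = "st4(AlphaNum := (st4 AlphaNum)(0 := p),
            AlphaDen := (st4 AlphaDen)(0 := q))"
          have hist: "wp (2 * M) read_history (\<lambda>k st' inp' out'.
              k \<le> N * (length ?xs * 10 + 21) + 5 \<and> inp' = [] \<and> out' = out \<and>
              represents st' (length ?xs) (\<lambda>j. cost I (?xs ! j) +
                Fract (?st5 AlphaDen 0 - ?st5 AlphaNum 0) (?st5 AlphaNum 0) *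
                rat_of_int (?st5 Imp (int j)) *
                (\<Sum>i<N. snd (history I ! i) * (1 - 2 * of_nat (fst (history I ! i) (?xs ! j))))) \<and>
              (\<forall>x. x \<notin> {HistCount, Weight, Scale, Coeff, Num, Den, Bit, Ix, Jx} \<longrightarrow> st' x = ?st5 x))
            ?st5 r6 out"
            unfolding r6_def N_def
          proof (rule wp_read_history)
            show "?st5 EdgeCount 0 = int (length ?xs)" using st2 st3 st4 by simp
            show "?st5 Imp (int j) \<in> {0, 1}" if "j < length ?xs" for j using that st4 by simp
            show "represents ?st5 (length ?xs) (\<lambda>j. cost I (?xs ! j))"
              using st3 st4 by (simp add: represents_def)
          qed (use q' hist r6 in auto)
          show ?case
            unfolding eq r5_def read_alpha_def
          proof (intro wp_Seq wp_Read wp_step[OF hist], goal_cases)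
            case (8 k6 st6 inp6 out6)
            note st6 = 8
            have weight: "cost I (?xs ! j) + Fract (?st5 AlphaDen 0 - ?st5 AlphaNum 0) (?st5 AlphaNum 0) *
                rat_of_int (?st5 Imp (int j)) *
                (\<Sum>i<N. snd (history I ! i) * (1 - 2 * of_nat (fst (history I ! i) (?xs ! j)))) =
                linear_weight I (?xs ! j)" if "j < length ?xs" for j
            proof -
              have imp: "?st5 Imp (int j) = of_bool (?xs ! j \<in> important I)" using st4 that by simp
              show ?thesis unfolding imp by (simp add: ratio linear_weight_def N_def)
            qed
            have "represents st6 (length ?xs) (\<lambda>j. linear_weight I (?xs ! j))"
              using st6 weight by (simp add: represents_def)
            moreover have "k1 + (k2 + (k3 + (k4 + (1 + (1 + k6 + 1) + 1) + 1) + 1) + 1) \<le>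
                length (nodes I) * 4 + E * (E * 4 + 26) + N * (E * 10 + 21) + 31"
            proof -
              have "k1 \<le> length (nodes I) * 4 + 5" "k2 \<le> E * 6 + 5" "k3 \<le> E * (E * 4 + 16) + 5"
                "k4 \<le> E * 4 + 3" "k6 \<le> N * (E * 10 + 21) + 5"
                using st1 st2 st3 st4 st6 by (simp_all add: E_def)
              thus ?thesis by (simp add: distrib_left)
            qed
            moreover have "st6 NodeCount = st1 NodeCount" "st6 Node = st1 Node"
              "st6 EdgeCount = st2 EdgeCount" "st6 Tail = st2 Tail" "st6 Head = st2 Head"
              using st2 st3 st4 st6 by simp_all
            moreover have "st6 x = st x" if "x \<in> {Src, Snk, Chosen, Reached, Dist, Via}" for x
              using that by (elim insertE) (use st1 st2 st3 st4 st6 in simp_all)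
            moreover have "out6 = out" using st6 by simp
            ultimately show ?case using st1 st2 by (simp only: loaded_def E_def) simp
          qed auto
        qed (use st2 st3 in auto)
      qed (use st1 st2 zero r3 in auto)
    qed
  qed
qed

section \<open>Linearity of the objective function\<close>

lemma objective_linear:
  fixes I :: "('e, 'a) scalarized_instance_scheme"
  assumes "valid_data X I" and binary: "\<forall>x\<in>X. \<forall>j\<in>set (items I). x j \<in> {0, 1}"
  shows "\<exists>d. \<forall>x\<in>X. objective I x =
    alpha I * (\<Sum>j\<in>set (items I). linear_weight I j * of_nat (x j)) + d"
proof -
  let ?S = "set (items I)" and ?H = "history I" and ?D = "important I"
  have alpha: "alpha I \<noteq> 0" and D: "?D \<subseteq> ?S" "finite ?D"
    using assms(1) by (auto simp: valid_data_def intro: finite_subset)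
  let ?d = "(1 - alpha I) * (\<Sum>i<length ?H. snd (?H ! i) * (\<Sum>j\<in>?D. of_nat (fst (?H ! i) j)))"
  let ?g = "\<lambda>j. if j \<in> ?D then
    \<Sum>i<length ?H. snd (?H ! i) * (1 - 2 * rat_of_nat (fst (?H ! i) j)) else 0"
  have "objective I x = alpha I * (\<Sum>j\<in>?S. linear_weight I j * of_nat (x j)) + ?d"
    if x: "x \<in> X" for x
  proof -
    have ham: "rat_of_nat (hamming ?D (restrict x ?D) (restrict y ?D)) =
        (\<Sum>j\<in>?D. (1 - 2 * of_nat (y j)) * of_nat (x j)) + (\<Sum>j\<in>?D. of_nat (y j))" if y: "y \<in> X" for y
    proof -
      have "{j \<in> ?D. restrict x ?D j \<noteq> restrict y ?D j} = {j \<in> ?D. x j \<noteq> y j}" by auto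
      hence "rat_of_nat (hamming ?D (restrict x ?D) (restrict y ?D)) =
          (\<Sum>j\<in>?D. if x j \<noteq> y j then 1 else 0)"
        using D by (simp add: hamming_def flip: sum.inter_filter)
      also have "\<dots> = (\<Sum>j\<in>?D. (1 - 2 * of_nat (y j)) * of_nat (x j) + of_nat (y j))"
        using bspec[OF binary x] bspec[OF binary y] D by (intro sum.cong) fastforce+
      finally show ?thesis by (simp add: sum.distrib)
    qed
    have H: "fst (?H ! i) \<in> X" if "i < length ?H" for i
      using assms(1) that by (auto simp: valid_data_def)
    have "(\<Sum>i<length ?H. snd (?H ! i) * of_nat (hamming ?D (restrict x ?D) (restrict (fst (?H ! i)) ?D))) =
        (\<Sum>i<length ?H. \<Sum>j\<in>?D. snd (?H ! i) * (1 - 2 * of_nat (fst (?H ! i) j)) * of_nat (x j)) +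
        (\<Sum>i<length ?H. snd (?H ! i) * (\<Sum>j\<in>?D. of_nat (fst (?H ! i) j)))"
      unfolding sum.distrib[symmetric]
      by (intro sum.cong refl) (simp add: ham[OF H] distrib_left sum_distrib_left mult.assoc)
    \<comment> \<open>Exchanging the sums collects the influence of all historic solutions on an
      important edge in a single coefficient.\<close>
    also have "(\<Sum>i<length ?H. \<Sum>j\<in>?D. snd (?H ! i) * (1 - 2 * of_nat (fst (?H ! i) j)) * of_nat (x j)) =
        (\<Sum>j\<in>?D. (\<Sum>i<length ?H. snd (?H ! i) * (1 - 2 * of_nat (fst (?H ! i) j))) * of_nat (x j))"
      by (subst sum.swap) (simp add: sum_distrib_right)
    also have "\<dots> = (\<Sum>j\<in>?S. ?g j * of_nat (x j))"
      using D(1) by (intro sum.mono_neutral_cong_left) auto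
    finally have hist: "(\<Sum>i<length ?H. snd (?H ! i) *
          of_nat (hamming ?D (restrict x ?D) (restrict (fst (?H ! i)) ?D))) =
        (\<Sum>j\<in>?S. ?g j * of_nat (x j)) +
        (\<Sum>i<length ?H. snd (?H ! i) * (\<Sum>j\<in>?D. of_nat (fst (?H ! i) j)))" .
    have "(\<Sum>j\<in>?S. linear_weight I j * of_nat (x j)) = (\<Sum>j\<in>?S. cost I j * of_nat (x j)) +
        (1 - alpha I) / alpha I * (\<Sum>j\<in>?S. ?g j * of_nat (x j))"
      unfolding linear_weight_def distrib_right sum.distrib sum_distrib_left by (simp only: mult.assoc)
    thus ?thesis
      using alpha unfolding objective_def hist by (simp add: distrib_left)
  qed
  thus ?thesis by blast
qed

section \<open>Shortest paths in acyclic graphs\<close>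

lemma pcas_append: "pcas u (p @ q) v \<longleftrightarrow> (\<exists>x. pcas u p x \<and> pcas x q v)"
  by (induction p arbitrary: u) auto

lemma pcas_reachable:
  assumes "pcas u p v" "set p \<subseteq> E" "x \<in> set (pawalk_verts u p)"
  shows "(u, x) \<in> E\<^sup>*"
  using assms
  by (induction p arbitrary: u) (auto intro: converse_rtrancl_into_rtrancl)

lemma fst_in_pawalk_verts: "e \<in> set p \<Longrightarrow> fst e \<in> set (pawalk_verts u p)"
  by (induction p arbitrary: u) auto

text \<open>A vertex met twice would reach itself through at least one edge. So walks and paths
  coincide in an acyclic graph.\<close>

lemma distinct_pawalk_verts:
  assumes "acyclic E" "pcas u p v" "set p \<subseteq> E"
  shows "distinct (pawalk_verts u p)"
  using assms(2,3)
proof (induction p arbitrary: u)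
  case (Cons e p)
  have "fst e \<notin> set (pawalk_verts (snd e) p)"
  proof
    assume "fst e \<in> set (pawalk_verts (snd e) p)"
    hence "(snd e, fst e) \<in> E\<^sup>*" using pcas_reachable[of "snd e" p v E] Cons.prems by auto
    hence "(fst e, fst e) \<in> E\<^sup>+" using Cons.prems(2)
      by (metis insert_subset list.simps(15) prod.collapse rtrancl_into_trancl2)
    thus False using assms(1) by (auto simp: acyclic_def)
  qed
  thus ?case using Cons by simp
qed simp

lemma distinct_walk:
  assumes "acyclic E" "pcas u p v" "set p \<subseteq> E"
  shows "distinct p"
proof -
  have "distinct (pawalk_verts u p) \<Longrightarrow> distinct p"
    by (induction p arbitrary: u) (auto dest: fst_in_pawalk_verts)
  thus ?thesis using distinct_pawalk_verts[OF assms] by blast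
qed

text \<open>This is why |E| rounds of Bellman-Ford are enough and why tracing a walk back
  terminates. Counting edges instead of vertices lets both bounds use the same number.\<close>

lemma length_walk_le:
  assumes "acyclic (set es)" "pcas u p v" "set p \<subseteq> set es"
  shows "length p \<le> length es"
proof -
  have "length p = card (set p)" using distinct_walk[OF assms] by (simp add: distinct_card)
  also have "\<dots> \<le> card (set es)" using assms(3) by (intro card_mono) auto
  also have "\<dots> \<le> length es" by (rule card_length)
  finally show ?thesis .
qed

text \<open>The distinctness required of a path comes for free, so the optimization may range over
  walks, which are easier to cut and extend.\<close>

lemma st_paths_eq:
  assumes "acyclic (set (items I))" "source I \<in> set (nodes I)"
  shows "st_paths I = {char_vec (set (items I)) (set p) |p.
    set p \<subseteq> set (items I) \<and> pcas (source I) p (sink I)}"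
proof -
  have "pre_digraph.apath (with_proj (dag_graph I)) (source I) p (sink I) \<longleftrightarrow>
      set p \<subseteq> set (items I) \<and> pcas (source I) p (sink I)" for p
    using distinct_pawalk_verts[OF assms(1)] assms(2)
    by (auto simp: pre_digraph.apath_def pre_digraph.awalk_def cas_with_proj_eq
        awalk_verts_with_proj_eq dag_graph_def)
  thus ?thesis by (simp add: st_paths_def)
qed

text \<open>
  The state of the Bellman-Ford algorithm in round \<open>k\<close> after the first \<open>i\<close> edges: \<open>R\<close> is the
  set of reached vertices, \<open>d\<close> the tentative distances and \<open>via v\<close> one plus the index of
  the last edge on the walk to \<open>v\<close>. Distances may be smaller than the weight of the walk to the
  predecessor would suggest, hence the inequality.
\<close>

definition bellman_ford ::
  "(nat \<times> nat) list \<Rightarrow> (nat \<times> nat \<Rightarrow> int) \<Rightarrow> nat \<Rightarrow> nat \<Rightarrow> nat \<Rightarrow>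
   (nat \<Rightarrow> bool) \<Rightarrow> (nat \<Rightarrow> int) \<Rightarrow> (nat \<Rightarrow> int) \<Rightarrow> bool" where
  "bellman_ford es w s k i R d via \<longleftrightarrow>
     R s \<and> d s = 0 \<and> via s = 0 \<and>
     (\<forall>v. R v \<and> v \<noteq> s \<longrightarrow> (\<exists>j<length es. via v = int j + 1 \<and> snd (es ! j) = v \<and>
        R (fst (es ! j)) \<and> d (fst (es ! j)) + w (es ! j) \<le> d v)) \<and>
     (\<forall>v. R v \<longrightarrow> (s, v) \<in> (set es)\<^sup>*) \<and>
     (\<forall>p v. set p \<subseteq> set es \<and> pcas s p v \<and> length p \<le> k \<longrightarrow> R v \<and> d v \<le> sum_list (map w p)) \<and>
     (\<forall>p e. set p \<subseteq> set es \<and> pcas s p (fst e) \<and> length p \<le> k \<and> e \<in> set (take i es) \<longrightarrow>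
        R (snd e) \<and> d (snd e) \<le> sum_list (map w p) + w e)"

section \<open>Preservation of the Bellman-Ford invariant\<close>

lemma bellman_ford_init:
  assumes "\<And>v. R v \<longleftrightarrow> v = s"
  shows "bellman_ford es w s 0 0 R (\<lambda>_. 0) (\<lambda>_. 0)"
  unfolding bellman_ford_def using assms by auto

text \<open>A nonempty walk with at most \<open>k + 1\<close> edges is a walk with at most
  \<open>k\<close> edges followed by one edge, and after a full pass the last clause of the
  invariant covers every such edge. The new pass starts with an empty prefix, for which that clause
  is vacuous.\<close>

lemma bellman_ford_round:
  assumes "bellman_ford es w s k (length es) R d via"
  shows "bellman_ford es w s (Suc k) 0 R d via"
proof -
  have "R v \<and> d v \<le> sum_list (map w p)"
    if p: "set p \<subseteq> set es" "pcas s p v" "length p \<le> Suc k" for p v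
  proof (cases p rule: rev_exhaust)
    case Nil
    thus ?thesis using assms p by (auto simp: bellman_ford_def)
  next
    case (snoc q e)
    hence "set q \<subseteq> set es" "pcas s q (fst e)" "length q \<le> k" "e \<in> set (take (length es) es)" "snd e = v"
      using p by (auto simp: pcas_append)
    hence "R (snd e) \<and> d (snd e) \<le> sum_list (map w q) + w e"
      using assms unfolding bellman_ford_def by blast
    thus ?thesis using \<open>snd e = v\<close> snoc by simp
  qed
  thus ?thesis using assms unfolding bellman_ford_def by auto
qed

text \<open>If \<open>u\<close> is not reached, then by the invariant no walk with at most
  \<open>k\<close> edges ends in \<open>u\<close>, and nothing is to be shown for the edge.\<close>

lemma bellman_ford_skip:
  assumes inv: "bellman_ford es w s k j R d via" and j: "j < length es" "es ! j = (u, v)"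
    and skip: "R u \<Longrightarrow> R v \<and> d v \<le> d u + w (u, v)"
  shows "bellman_ford es w s k (Suc j) R d via"
proof -
  have "R (snd e) \<and> d (snd e) \<le> sum_list (map w p) + w e"
    if p: "set p \<subseteq> set es" "pcas s p (fst e)" "length p \<le> k" "e \<in> set (take (Suc j) es)" for p e
  proof (cases "e = (u, v)")
    case True
    hence "R u" "d u \<le> sum_list (map w p)" using inv p unfolding bellman_ford_def by auto
    thus ?thesis using skip True by auto
  next
    case False
    hence "e \<in> set (take j es)" using p j by (auto simp: take_Suc_conv_app_nth)
    thus ?thesis using inv p(1-3) unfolding bellman_ford_def by blast
  qed
  thus ?thesis using inv unfolding bellman_ford_def by blast
qed

text \<open>Acyclicity enters twice: \<open>u \<noteq> v\<close> means that the distance of the tail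
  is not overwritten, and \<open>v \<noteq> s\<close> preserves distance 0 and label 0 of the
  source. Everything else follows because vertices stay reached and distances only decrease.\<close>

lemma bellman_ford_update:
  assumes inv: "bellman_ford es w s k j R d via" and j: "j < length es" "es ! j = (u, v)"
    and acyclic: "acyclic (set es)"
    and update: "R u" "R v \<Longrightarrow> d u + w (u, v) < d v"
  shows "bellman_ford es w s k (Suc j) (R(v := True)) (d(v := d u + w (u, v))) (via(v := int j + 1))"
proof -
  let ?R = "R(v := True)" and ?d = "d(v := d u + w (u, v))" and ?via = "via(v := int j + 1)"
  have uv: "(u, v) \<in> set es" using j by (metis nth_mem)
  have "u \<noteq> v" using uv acyclic by (auto simp: acyclic_def)
  have su: "(s, u) \<in> (set es)\<^sup>*" using inv update(1) unfolding bellman_ford_def by blast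
  have "v \<noteq> s"
    using su uv acyclic by (metis acyclic_def rtrancl_into_trancl1)
  have mono: "?R x \<and> ?d x \<le> d x" if "R x" for x
    using that update by auto
  have "?R (snd e) \<and> ?d (snd e) \<le> sum_list (map w p) + w e"
    if p: "set p \<subseteq> set es" "pcas s p (fst e)" "length p \<le> k" "e \<in> set (take (Suc j) es)" for p e
  proof (cases "e = (u, v)")
    case True
    hence "d u \<le> sum_list (map w p)" using inv p unfolding bellman_ford_def by auto
    thus ?thesis using True by auto
  next
    case False
    hence "e \<in> set (take j es)" using p j by (auto simp: take_Suc_conv_app_nth)
    hence "R (snd e)" "d (snd e) \<le> sum_list (map w p) + w e"
      using inv p(1-3) unfolding bellman_ford_def by blast+
    thus ?thesis using mono[of "snd e"] by linarith
  qed
  moreover have "?R x \<and> ?d x \<le> sum_list (map w p)"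
    if p: "set p \<subseteq> set es" "pcas s p x" "length p \<le> k" for p x
  proof -
    have "R x" "d x \<le> sum_list (map w p)" using inv p unfolding bellman_ford_def by blast+
    thus ?thesis using mono[of x] by linarith
  qed
  moreover have "(s, x) \<in> (set es)\<^sup>*" if "?R x" for x
    using that su uv inv unfolding bellman_ford_def
    by (metis fun_upd_apply rtrancl.rtrancl_into_rtrancl)
  moreover have "\<exists>i<length es. ?via x = int i + 1 \<and> snd (es ! i) = x \<and> ?R (fst (es ! i)) \<and>
      ?d (fst (es ! i)) + w (es ! i) \<le> ?d x" if x: "?R x" "x \<noteq> s" for x
  proof (cases "x = v")
    case True
    thus ?thesis using j update(1) \<open>u \<noteq> v\<close> by (intro exI[of _ j]) auto
  next
    case False
    hence "R x" using x by simp
    then obtain i where i: "i < length es" "via x = int i + 1" "snd (es ! i) = x"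
      "R (fst (es ! i))" "d (fst (es ! i)) + w (es ! i) \<le> d x"
      using inv x(2) unfolding bellman_ford_def by blast
    \<comment> \<open>The predecessor of \<open>x\<close> may be \<open>v\<close>, whose distance
      may just have dropped. The inequality survives this; an equation would not.\<close>
    thus ?thesis using mono[OF i(4)] False by (intro exI[of _ i]) auto
  qed
  moreover have "?R s \<and> ?d s = 0 \<and> ?via s = 0"
    using inv \<open>v \<noteq> s\<close> by (auto simp: bellman_ford_def)
  ultimately show ?thesis unfolding bellman_ford_def by blast
qed

section \<open>Bellman-Ford and the extraction of a shortest path on the machine\<close>

definition update_dist :: com where
  "update_dist = Seq (Assign (loc Dist (Arr Head (Var Jx))) (Plus (Arr Dist (Arr Tail (Var Jx))) (Arr Weight (Var Jx))))
     (Seq (Assign (loc Reached (Arr Head (Var Jx))) (Const 1))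
        (Assign (loc Via (Arr Head (Var Jx))) (Plus (Var Jx) (Const 1))))"

text \<open>No integer stands for an infinite distance. Reachability is stored separately, and an
  unreached head is updated without comparing distances.\<close>

definition relax :: com where
  "relax = Cond (Arr Reached (Arr Tail (Var Jx)))
     (Cond (Minus (Const 1) (Arr Reached (Arr Head (Var Jx)))) update_dist
        (Cond (Minus (Arr Dist (Arr Head (Var Jx))) (Plus (Arr Dist (Arr Tail (Var Jx))) (Arr Weight (Var Jx))))
           update_dist Skip))
     Skip"

definition compute_dists :: com where
  "compute_dists = Seq (Assign (loc Reached (Var Src)) (Const 1))
     (For Ix EdgeCount (For Jx EdgeCount relax))"

text \<open>Among the reached vertices only the source has label 0, so the test of the label detects
  the source. Storing indices increased by one keeps edge 0 apart from this mark.\<close>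

definition trace_back :: com where
  "trace_back = Seq (Assign (loc Cur (Const 0)) (Var Snk))
     (While (Arr Via (Var Cur))
        (Seq (Assign (loc Jx (Const 0)) (Minus (Arr Via (Var Cur)) (Const 1)))
        (Seq (Assign (loc Chosen (Var Jx)) (Const 1))
           (Assign (loc Cur (Const 0)) (Arr Tail (Var Jx))))))"

definition dag_program :: com where
  "dag_program = Seq (Read (loc Src (Const 0))) (Seq (Read (loc Snk (Const 0)))
     (Seq read_instance (Seq compute_dists (Seq trace_back write_solution))))"

definition graph_loaded ::
  "('e \<Rightarrow> nat) \<Rightarrow> ('e \<Rightarrow> nat) \<Rightarrow> 'e list \<Rightarrow> ('e \<Rightarrow> int) \<Rightarrow> store \<Rightarrow> bool" where
  "graph_loaded a b es w st \<longleftrightarrow> st EdgeCount 0 = int (length es) \<and>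
     (\<forall>j<length es. st Tail (int j) = int (a (es ! j)) \<and> st Head (int j) = int (b (es ! j)) \<and>
        st Weight (int j) = w (es ! j))"

abbreviation bellman_ford_store ::
  "(nat \<times> nat) list \<Rightarrow> (nat \<times> nat \<Rightarrow> int) \<Rightarrow> nat \<Rightarrow> nat \<Rightarrow> nat \<Rightarrow> store \<Rightarrow> bool" where
  "bellman_ford_store es w s k i st \<equiv> bellman_ford es w s k i
     (\<lambda>v. st Reached (int v) > 0) (\<lambda>v. st Dist (int v)) (\<lambda>v. st Via (int v))"

lemma wp_relax:
  assumes "graph_loaded fst snd es w st" "acyclic (set es)" "bellman_ford_store es w s k j st"
    "j < length es" "st Jx 0 = int j"
  shows "wp A relax (\<lambda>n st' inp' out'. n \<le> 8 \<and> inp' = inp \<and> out' = out \<and>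
      bellman_ford_store es w s k (Suc j) st' \<and>
      (\<forall>x. x \<notin> {Dist, Reached, Via} \<longrightarrow> st' x = st x)) st inp out"
proof -
  obtain u v where uv: "es ! j = (u, v)" by fastforce
  have j: "st Tail (int j) = int u" "st Head (int j) = int v" "st Weight (int j) = w (u, v)"
    using assms(1,4) uv by (auto simp: graph_loaded_def)
  let ?Q = "\<lambda>st'. bellman_ford_store es w s k (Suc j) st' \<and>
      (\<forall>x. x \<notin> {Dist, Reached, Via} \<longrightarrow> st' x = st x)"
  have update: "wp A update_dist (\<lambda>n st' inp' out'. n \<le> 5 \<and> inp' = inp \<and> out' = out \<and> ?Q st') st inp out"
    if "st Reached (int u) > 0" "st Reached (int v) > 0 \<Longrightarrow> st Dist (int u) + w (u, v) < st Dist (int v)"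
  proof -
    let ?st = "st(Dist := (st Dist)(int v := st Dist (int u) + w (u, v)),
      Reached := (st Reached)(int v := 1), Via := (st Via)(int v := int j + 1))"
    have "(\<lambda>x. ?st Reached (int x) > 0) = (\<lambda>x. st Reached (int x) > 0)(v := True)"
      "(\<lambda>x. ?st Dist (int x)) = (\<lambda>x. st Dist (int x))(v := st Dist (int u) + w (u, v))"
      "(\<lambda>x. ?st Via (int x)) = (\<lambda>x. st Via (int x))(v := int j + 1)" by auto
    hence "bellman_ford_store es w s k (Suc j) ?st"
      using bellman_ford_update[OF assms(3,4) uv assms(2)] that by simp
    thus ?thesis
      unfolding update_dist_def using j assms(5) by (intro wp_rules) auto
  qed
  have skip: "?Q st" if "st Reached (int u) > 0 \<Longrightarrow> st Reached (int v) > 0 \<and>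
      st Dist (int v) \<le> st Dist (int u) + w (u, v)"
    using bellman_ford_skip[OF assms(3,4) uv] that by simp
  show ?thesis
    unfolding relax_def
    by (intro wp_Cond wp_Skip wp_mono[OF update]) (use skip in \<open>auto simp: j assms(5)\<close>)
qed


lemma graph_loaded_frame:
  assumes "graph_loaded a b es w st" "st' EdgeCount = st EdgeCount" "st' Tail = st Tail"
    "st' Head = st Head" "st' Weight = st Weight"
  shows "graph_loaded a b es w st'"
  using assms by (simp add: graph_loaded_def)

lemma wp_compute_dists:
  assumes loaded: "graph_loaded fst snd es w st" and acyclic: "acyclic (set es)"
    and src: "st Src 0 = int s"
    and zero: "st Reached = (\<lambda>_. 0)" "st Dist = (\<lambda>_. 0)" "st Via = (\<lambda>_. 0)"
  shows "wp A compute_dists (\<lambda>n st' inp' out'. n \<le> length es * (length es * 11 + 6) + 5 \<and>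
      inp' = inp \<and> out' = out \<and> bellman_ford_store es w s (length es) 0 st' \<and>
      (\<forall>x. x \<notin> {Dist, Reached, Via, Ix, Jx} \<longrightarrow> st' x = st x)) st inp out"
proof -
  let ?m = "length es"
  let ?J = "\<lambda>k j st' inp' out'. inp' = inp \<and> out' = out \<and> bellman_ford_store es w s k j st' \<and>
      st' Ix 0 = int k \<and> (\<forall>x. x \<notin> {Dist, Reached, Via, Ix, Jx} \<longrightarrow> st' x = st x)"
  let ?I = "\<lambda>k st' inp' out'. inp' = inp \<and> out' = out \<and> bellman_ford_store es w s k 0 st' \<and>
      (\<forall>x. x \<notin> {Dist, Reached, Via, Ix, Jx} \<longrightarrow> st' x = st x)"
  let ?st = "st(Reached := (st Reached)(int s := 1))"
  have inner: "wp A (For Jx EdgeCount relax)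
      (\<lambda>n st' inp' out'. n \<le> ?m * (8 + 3) + 3 \<and> ?J k ?m st' inp' out') st1 inp1 out1"
    if "?I k st1 inp1 out1" "st1 Ix 0 = int k" for k st1 inp1 out1
  proof (rule wp_For[where Inv = "?J k"])
    show "?J k 0 (st1(Jx := (st1 Jx)(0 := 0))) inp1 out1" using that by simp
  next
    fix j st2 inp2 out2
    assume "?J k j st2 inp2 out2"
    hence "st2 EdgeCount = st EdgeCount" by simp
    thus "st2 EdgeCount 0 = int ?m" using loaded by (simp add: graph_loaded_def)
  next
    fix j st2 inp2 out2
    assume j: "j < ?m" "st2 Jx 0 = int j" and J: "?J k j st2 inp2 out2"
    have g: "graph_loaded fst snd es w st2" by (rule graph_loaded_frame[OF loaded]) (use J in simp_all)
    have bf: "bellman_ford_store es w s k j st2" using J by simp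
    note relax = wp_relax[OF g acyclic bf j]
    show "wp A relax (\<lambda>n st' inp' out'. n \<le> 8 \<and> st' Jx 0 = int j \<and>
        ?J k (Suc j) (st'(Jx := (st' Jx)(0 := int (Suc j)))) inp' out') st2 inp2 out2"
      by (rule wp_mono[OF relax]) (use j J in simp_all)
  qed
  have loop: "wp A (For Ix EdgeCount (For Jx EdgeCount relax))
      (\<lambda>n st' inp' out'. n \<le> ?m * (?m * 11 + 3 + 3) + 3 \<and> ?I ?m st' inp' out') ?st inp out"
  proof (rule wp_For[where Inv = ?I])
    have "bellman_ford es w s 0 0 (\<lambda>v. ?st Reached (int v) > 0) (\<lambda>_. 0) (\<lambda>_. 0)"
      by (rule bellman_ford_init) (simp add: zero)
    thus "?I 0 (?st(Ix := (?st Ix)(0 := 0))) inp out" by (simp add: zero)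
  next
    fix k st1 inp1 out1
    assume "?I k st1 inp1 out1"
    hence "st1 EdgeCount = st EdgeCount" by simp
    thus "st1 EdgeCount 0 = int ?m" using loaded by (simp add: graph_loaded_def)
  next
    fix k st1 inp1 out1
    assume k: "k < ?m" "st1 Ix 0 = int k" "?I k st1 inp1 out1"
    show "wp A (For Jx EdgeCount relax) (\<lambda>n st' inp' out'. n \<le> ?m * 11 + 3 \<and> st' Ix 0 = int k \<and>
        ?I (Suc k) (st'(Ix := (st' Ix)(0 := int (Suc k)))) inp' out') st1 inp1 out1"
      by (rule wp_mono[OF inner[OF k(3,2)]]) (simp add: bellman_ford_round)
  qed
  show ?thesis
    unfolding compute_dists_def
    by (intro wp_rules wp_step[OF loop]) (use src in \<open>auto simp: algebra_simps\<close>)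
qed

text \<open>The predecessor inequalities telescope: the part of the walk collected from
  \<open>u\<close> to \<open>t\<close> weighs at most the distance of \<open>t\<close> minus that of
  \<open>u\<close>. At the source the latter is 0.\<close>

lemma wp_trace_back:
  assumes loaded: "graph_loaded fst snd es w st" and acyclic: "acyclic (set es)" and dist: "distinct es"
    and bf: "bellman_ford_store es w s (length es) 0 st"
    and snk: "st Snk 0 = int t" "st Reached (int t) > 0"
    and zero: "st Chosen = (\<lambda>_. 0)"
  shows "wp A trace_back (\<lambda>n st' inp' out'. n \<le> length es * 6 + 3 \<and> inp' = inp \<and> out' = out \<and>
      st' EdgeCount = st EdgeCount \<and>
      (\<exists>p. set p \<subseteq> set es \<and> pcas s p t \<and> sum_list (map w p) \<le> st Dist (int t) \<and>
         (\<forall>j<length es. st' Chosen (int j) = of_bool (es ! j \<in> set p)))) st inp out"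
proof -
  let ?m = "length es"
  let ?frame = "\<lambda>st'. \<forall>x. x \<notin> {Cur, Jx, Chosen} \<longrightarrow> st' x = st x"
  let ?walk = "\<lambda>u p st'. set p \<subseteq> set es \<and> pcas u p t \<and>
      sum_list (map w p) \<le> st Dist (int t) - st Dist (int u) \<and>
      (\<forall>j<?m. st' Chosen (int j) = of_bool (es ! j \<in> set p))"
  \<comment> \<open>The variant is the number of edges still available: the collected walk cannot
    have more than \<open>?m\<close> edges, as the graph is acyclic.\<close>
  let ?I = "\<lambda>n st' inp' out'. inp' = inp \<and> out' = out \<and> ?frame st' \<and> (\<exists>u p. length p + n = ?m \<and>
      st' Cur 0 = int u \<and> st Reached (int u) > 0 \<and> ?walk u p st')"
  let ?R = "\<lambda>st' inp' out'. inp' = inp \<and> out' = out \<and> st' EdgeCount = st EdgeCount \<and>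
      (\<exists>p. ?walk s p st')"
  have s: "st Dist (int s) = 0" "st Via (int s) = 0" using bf by (auto simp: bellman_ford_def)
  have step: "\<exists>j<?m. st Via (int u) = int j + 1 \<and> snd (es ! j) = u \<and>
        st Reached (int (fst (es ! j))) > 0 \<and>
        st Dist (int (fst (es ! j))) + w (es ! j) \<le> st Dist (int u)"
    if "st Reached (int u) > 0" "u \<noteq> s" for u
    using bf that unfolding bellman_ford_def by blast
  let ?body = "Seq (Assign (loc Jx (Const 0)) (Minus (Arr Via (Var Cur)) (Const 1)))
        (Seq (Assign (loc Chosen (Var Jx)) (Const 1))
           (Assign (loc Cur (Const 0)) (Arr Tail (Var Jx))))"
  have loop: "wp A (While (Arr Via (Var Cur)) ?body)
      (\<lambda>n st' inp' out'. n \<le> ?m * (5 + 1) + 1 \<and> ?R st' inp' out') (st(Cur := (st Cur)(0 := int t))) inp out"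
  proof (rule wp_While[where Inv = ?I])
    show "?I ?m (st(Cur := (st Cur)(0 := int t))) inp out"
      using snk zero by (auto intro!: exI[of _ t] exI[of _ "[]"])
  next
    fix n st1 inp1 out1
    assume I: "?I n st1 inp1 out1" and via: "eval (Arr Via (Var Cur)) (flat st1) > 0"
    then obtain u p where p: "length p + n = ?m" "st1 Cur 0 = int u" "st Reached (int u) > 0"
      "?walk u p st1" by blast
    have "st Via (int u) > 0" using via I p(2) by simp
    hence "u \<noteq> s" using s by auto
    then obtain j where j: "j < ?m" "st Via (int u) = int j + 1" "snd (es ! j) = u"
        "st Reached (int (fst (es ! j))) > 0"
        "st Dist (int (fst (es ! j))) + w (es ! j) \<le> st Dist (int u)"
      using step[OF p(3)] by blast
    let ?v = "fst (es ! j)"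
    let ?st = "st1(Jx := (st1 Jx)(0 := int j), Chosen := (st1 Chosen)(int j := 1),
      Cur := (st1 Cur)(0 := int ?v))"
    \<comment> \<open>As \<open>es\<close> has no repetitions, setting position \<open>j\<close>
      marks the edge \<open>es ! j\<close> and no other.\<close>
    have "?walk ?v (es ! j # p) ?st"
      using p(4) j dist by (auto simp: nth_eq_iff_index_eq)
    moreover from this have len: "length (es ! j # p) \<le> ?m"
      using length_walk_le[OF acyclic] by blast
    moreover have frame: "?frame ?st" using I by simp
    ultimately have "length (es ! j # p) + (n - 1) = ?m \<and> ?st Cur 0 = int ?v \<and>
        st Reached (int ?v) > 0 \<and> ?walk ?v (es ! j # p) ?st"
      using p(1) j(4) by simp
    hence "?I (n - 1) ?st inp1 out1" using I frame by blast
    moreover have "n - 1 < n" using p(1) len by simp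
    ultimately have "\<exists>n'<n. ?I n' ?st inp1 out1" by blast
    moreover have "st1 Via (int u) = int j + 1" using I j(2) by simp
    moreover have "st1 Tail (int j) = int ?v" using I loaded j(1) by (simp add: graph_loaded_def)
    ultimately show "wp A ?body (\<lambda>k st' inp' out'. k \<le> 5 \<and> (\<exists>n'<n. ?I n' st' inp' out')) st1 inp1 out1"
      using p(2) by (intro wp_rules) simp_all
  next
    fix n st1 inp1 out1
    assume I: "?I n st1 inp1 out1" and via: "eval (Arr Via (Var Cur)) (flat st1) \<le> 0"
    then obtain u p where p: "st Reached (int u) > 0" "?walk u p st1" "st1 Cur 0 = int u" by blast
    have "st Via (int u) \<le> 0" using via I p(3) by simp
    hence "u = s" using step[OF p(1)] by force
    thus "?R st1 inp1 out1" using p(2) I by auto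
  next
    fix st1
    show "mul_bounded A (Arr Via (Var Cur)) (flat st1)" by simp
  qed
  show ?thesis
    unfolding trace_back_def
    by (intro wp_rules wp_step[OF loop]) (use snk s in auto)
qed

text \<open>Comparing integer weights suffices: the common denominator and \<alpha> are positive, so
  both preserve the order, and the additive constant is the same for all solutions.\<close>

lemma represents_objective:
  fixes I :: "('e, 'a) scalarized_instance_scheme"
  assumes valid: "valid_data X I" and binary: "\<forall>x\<in>X. \<forall>j\<in>set (items I). x j \<in> {0, 1}"
    and st: "represents st (length (items I)) (\<lambda>j. linear_weight I (items I ! j))"
  obtains w where "\<And>j. j < length (items I) \<Longrightarrow> st Weight (int j) = w (items I ! j)"
    and "\<And>x y. x \<in> X \<Longrightarrow> y \<in> X \<Longrightarrow> (\<Sum>j\<in>set (items I). w j * int (x j)) \<le> (\<Sum>j\<in>set (items I). w j * int (y j)) \<Longrightarrow>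
      objective I x \<le> objective I y"
proof -
  let ?S = "set (items I)" and ?q = "rat_of_int (st Scale 0)"
  \<comment> \<open>The floor only changes the type from rational to integer and makes
    \<open>w\<close> total: on the edges of the instance its argument is already an integer.\<close>
  define w where "w e = \<lfloor>?q * linear_weight I e\<rfloor>" for e
  have q: "?q > 0" using st by (simp add: represents_def)
  have weight: "st Weight (int j) = w (items I ! j)" if "j < length (items I)" for j
    using st that by (metis floor_of_int represents_def w_def)
  have w: "rat_of_int (w e) = ?q * linear_weight I e" if e: "e \<in> ?S" for e
  proof -
    obtain j where "j < length (items I)" "e = items I ! j" using e by (metis in_set_conv_nth)
    thus ?thesis using weight st by (metis represents_def)
  qed
  obtain d where d: "\<And>x. x \<in> X \<Longrightarrow> objective I x =
      alpha I * (\<Sum>j\<in>?S. linear_weight I j * of_nat (x j)) + d"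
    using objective_linear[OF valid binary] by blast
  have scaled: "rat_of_int (\<Sum>j\<in>?S. w j * int (x j)) = ?q * (\<Sum>j\<in>?S. linear_weight I j * of_nat (x j))" for x
    by (simp add: w sum_distrib_left mult.assoc)
  have "objective I x \<le> objective I y" if "x \<in> X" "y \<in> X"
    "(\<Sum>j\<in>?S. w j * int (x j)) \<le> (\<Sum>j\<in>?S. w j * int (y j))" for x y
  proof -
    have "?q * (\<Sum>j\<in>?S. linear_weight I j * of_nat (x j)) \<le> ?q * (\<Sum>j\<in>?S. linear_weight I j * of_nat (y j))"
      using that(3) unfolding scaled[symmetric] of_int_le_iff .
    hence "(\<Sum>j\<in>?S. linear_weight I j * of_nat (x j)) \<le> (\<Sum>j\<in>?S. linear_weight I j * of_nat (y j))"
      using q by simp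
    moreover have "0 \<le> alpha I" using valid by (simp add: valid_data_def)
    ultimately show ?thesis using d that by (simp add: mult_left_mono)
  qed
  with weight show thesis using that by blast
qed

lemma sum_char_vec:
  assumes "finite S" "F \<subseteq> S"
  shows "(\<Sum>j\<in>S. w j * int (char_vec S F j)) = (\<Sum>j\<in>F. w j)"
proof -
  have "(\<Sum>j\<in>S. w j * int (char_vec S F j)) = (\<Sum>j\<in>F. w j * int (char_vec S F j))"
    using assms by (intro sum.mono_neutral_right) (auto simp: char_vec_def)
  also have "\<dots> = (\<Sum>j\<in>F. w j)"
    using assms by (intro sum.cong) (auto simp: char_vec_def)
  finally show ?thesis .
qed

lemma encode_vec_char_vec:
  assumes "\<And>j. j < length (items I) \<Longrightarrow> v j = of_bool (items I ! j \<in> F)"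
  shows "map v [0..<length (items I)] = encode_vec I (char_vec (set (items I)) F)"
  by (rule nth_equalityI) (auto simp: encode_vec_def char_vec_def assms)

lemma length_le_length_concat:
  assumes "\<And>x. x \<in> set xs \<Longrightarrow> f x \<noteq> []"
  shows "length xs \<le> length (concat (map f xs))"
  using assms
proof (induction xs)
  case (Cons x xs)
  hence "length (f x) > 0" "length xs \<le> length (concat (map f xs))" by auto
  thus ?case unfolding list.map concat.simps length_append list.size by linarith
qed simp

text \<open>The counts on the tape are binary and give no such bound; what counts is that each
  vertex, edge and historic solution occupies an entry of its own. A historic solution does so even
  without any edges, because of its weight.\<close>

lemma lengths_le_input_size:
  fixes I :: "('e, 'a) scalarized_instance_scheme"
  shows "length (nodes I) \<le> input_size (xs @ encode enc I)"
    "length (items I) \<le> input_size (xs @ encode enc I)"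
    "length (history I) \<le> input_size (xs @ encode enc I)"
proof -
  have "length (history I) \<le> length (concat (map (\<lambda>(x, w). encode_vec I x @ encode_rat w) (history I)))"
    by (rule length_le_length_concat) (auto simp: encode_rat_def)
  hence "length (nodes I) + length (items I) + length (history I) \<le> length (xs @ encode enc I)"
    unfolding encode_def by simp
  also have "\<dots> \<le> input_size (xs @ encode enc I)" by (rule length_le_input_size)
  finally show "length (nodes I) \<le> input_size (xs @ encode enc I)"
    "length (items I) \<le> input_size (xs @ encode enc I)"
    "length (history I) \<le> input_size (xs @ encode enc I)" by simp_all
qed

lemma wp_dag_program:
  assumes I: "I \<in> dag_instances"
  defines "n \<equiv> input_size (encode_dag_instance I)"
  shows "wp (2 * n) dag_program
    (\<lambda>k st inp out. k \<le> n * 4 + n * (n * 4 + 26) + n * (n * 10 + 21) + n * (n * 11 + 6) + n * 10 + 50 \<and>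
      (\<exists>x. is_arg_min (objective I) (\<lambda>y. y \<in> st_paths I) x \<and> out = encode_vec I x))
    (\<lambda>_ _. 0) (encode_dag_instance I) []"
proof -
  let ?es = "items I" and ?X = "st_paths I" and ?s = "source I" and ?t = "sink I"
  let ?bound = "n * 4 + n * (n * 4 + 26) + n * (n * 10 + 21) + n * (n * 11 + 6) + n * 10 + 50"
  let ?V = "length (nodes I)" and ?E = "length (items I)" and ?N = "length (history I)"
  have valid: "valid_data ?X I" and acyclic: "acyclic (set ?es)" and dist: "distinct ?es"
    and alpha: "0 < alpha I" "alpha I < 1" and hist: "history I \<noteq> []" "fst ` set (history I) \<subseteq> ?X"
    and s: "?s \<in> set (nodes I)"
    using I by (auto simp: dag_instances_def valid_data_def)
  note paths = st_paths_eq[OF acyclic s]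
  have binary: "\<forall>x\<in>?X. \<forall>j\<in>set ?es. x j \<in> {0, 1}"
    by (auto simp: st_paths_def char_vec_def)
  have path_weight: "(\<Sum>j\<in>set ?es. w j * int (char_vec (set ?es) (set p) j)) = sum_list (map w p)"
    if "set p \<subseteq> set ?es" "pcas ?s p ?t" for p w
    using that distinct_walk[OF acyclic that(2,1)]
    by (subst sum_char_vec) (auto simp: sum_list_distinct_conv_sum_set)
  define enc where "enc = encode (\<lambda>j. [int (fst j), int (snd j)]) I"
  have pair: "(\<lambda>(u, v). [int u, int v]) = (\<lambda>j. [int (fst j), int (snd j)])" by auto
  have enc: "encode_dag_instance I = int ?s # int ?t # enc"
    by (simp add: encode_dag_instance_def pair enc_def)
  have lens: "?V \<le> n" "?E \<le> n" "?N \<le> n"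
    using lengths_le_input_size[of I "[int ?s, int ?t]" "\<lambda>j. [int (fst j), int (snd j)]"]
    by (simp_all add: n_def enc enc_def)
  let ?st = "(\<lambda>_ _. 0)(Src := (\<lambda>_. 0)(0 := int ?s), Snk := (\<lambda>_. 0)(0 := int ?t))"
  have read: "wp (2 * n) read_instance (\<lambda>k st' inp' out'.
      k \<le> ?V * 4 + ?E * (?E * 4 + 26) + ?N * (?E * 10 + 21) + 32 \<and> out' = [] \<and> loaded I fst snd st' \<and>
      (\<forall>x\<in>{Src, Snk, Chosen, Reached, Dist, Via}. st' x = ?st x)) ?st enc []"
    unfolding enc_def
  proof (rule wp_read_instance)
    show "set (encode (\<lambda>j. [int (fst j), int (snd j)]) I) \<subseteq> {v. \<bar>v\<bar> \<le> 2 ^ n}"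
      using abs_le_power_input_size[of _ "encode_dag_instance I"] unfolding n_def enc enc_def by auto
    show "x j \<in> {0, 1}" if "(x, l) \<in> set (history I)" "j \<in> set ?es" for x l j
    proof -
      have "x \<in> ?X" using hist(2) imageI[OF that(1), of fst] by auto
      thus ?thesis using binary that(2) by blast
    qed
  qed (use alpha in auto)
  \<comment> \<open>Four steps are set aside for reading source and sink: two reads and two
    sequential compositions.\<close>
  have main: "wp (2 * n) (Seq read_instance (Seq compute_dists (Seq trace_back write_solution)))
    (\<lambda>k st inp out. k + 4 \<le> ?bound \<and>
      (\<exists>x. is_arg_min (objective I) (\<lambda>y. y \<in> ?X) x \<and> out = encode_vec I x)) ?st enc []"
  proof (rule wp_Seq_mono[OF read], goal_cases)
    case (1 k1 st1 inp1 out1)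
    note st1 = 1
    hence out1: "out1 = []" and frame: "\<And>x. x \<in> {Src, Snk, Chosen, Reached, Dist, Via} \<Longrightarrow> st1 x = ?st x"
      by blast+
    have "represents st1 ?E (\<lambda>j. linear_weight I (?es ! j))" using st1 by (simp add: loaded_def)
    from represents_objective[OF valid binary this] obtain w where
      weight: "\<And>j. j < ?E \<Longrightarrow> st1 Weight (int j) = w (?es ! j)"
      and obj: "\<And>x y. x \<in> ?X \<Longrightarrow> y \<in> ?X \<Longrightarrow> (\<Sum>j\<in>set ?es. w j * int (x j)) \<le> (\<Sum>j\<in>set ?es. w j * int (y j)) \<Longrightarrow>
        objective I x \<le> objective I y" by blast
    have graph: "graph_loaded fst snd ?es w st1"
      using st1 weight by (simp add: graph_loaded_def loaded_def)
    show ?case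
      unfolding out1
    proof (rule wp_Seq_mono[OF wp_compute_dists[OF graph acyclic, where s = ?s]], goal_cases)
      case (5 k2 st2 inp2 out2)
      note st2 = 5
      hence out2: "out2 = []" by blast
      have graph2: "graph_loaded fst snd ?es w st2" by (rule graph_loaded_frame[OF graph]) (use st2 in simp_all)
      have bf: "bellman_ford_store ?es w ?s ?E 0 st2" using st2 by blast
      have best: "st2 Reached (int ?t) > 0 \<and> st2 Dist (int ?t) \<le> sum_list (map w p)"
        if "set p \<subseteq> set ?es" "pcas ?s p ?t" for p
        using bf that length_walk_le[OF acyclic that(2,1)] unfolding bellman_ford_def by blast
      \<comment> \<open>A historic solution is a walk from source to sink. Being no longer than |E|,
        it forces the sink to be reached.\<close>
      obtain x where "x \<in> ?X" using hist by (cases "history I") auto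
      hence reached: "st2 Reached (int ?t) > 0" using best unfolding paths by blast
      have "st2 Snk 0 = int ?t" "st2 Chosen = (\<lambda>_. 0)" using st2 by (simp_all add: frame)
      note trace = wp_trace_back[OF graph2 acyclic dist bf this(1) reached this(2)]
      show ?case
        unfolding out2
      proof (rule wp_Seq_mono[OF trace], goal_cases)
        case (1 k3 st3 inp3 out3)
        note st3 = 1
        hence out3: "out3 = []" by blast
        from st3 obtain p where p: "set p \<subseteq> set ?es" "pcas ?s p ?t"
          "sum_list (map w p) \<le> st2 Dist (int ?t)"
          "\<And>j. j < ?E \<Longrightarrow> st3 Chosen (int j) = of_bool (?es ! j \<in> set p)" by blast
        let ?x = "char_vec (set ?es) (set p)"
        have x: "?x \<in> ?X" using p unfolding paths by blast
        have "objective I ?x \<le> objective I y" if y: "y \<in> ?X" for y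
        proof -
          obtain q where q: "y = char_vec (set ?es) (set q)" "set q \<subseteq> set ?es" "pcas ?s q ?t"
            using y unfolding paths by blast
          have "sum_list (map w p) \<le> sum_list (map w q)" using p(3) best[OF q(2,3)] by linarith
          thus ?thesis using obj[OF x y] q p by (simp add: path_weight)
        qed
        hence opt: "is_arg_min (objective I) (\<lambda>y. y \<in> ?X) ?x"
          using x by (auto simp: is_arg_min_linorder)
        have "st3 EdgeCount 0 = int ?E" using st3 graph2 by (simp add: graph_loaded_def)
        note writing = wp_write_solution[where st = st3 and m = ?E, OF this]
        show ?case
          unfolding out3
        proof (rule wp_mono[OF writing], goal_cases)
          case (1 k4 st4 inp4 out4)
          have out4: "out4 = encode_vec I ?x"
            using 1 encode_vec_char_vec[of I "\<lambda>j. st3 Chosen (int j)" "set p"] p(4) by simp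
          have "k1 \<le> ?V * 4 + ?E * (?E * 4 + 26) + ?N * (?E * 10 + 21) + 32"
            "k2 \<le> ?E * (?E * 11 + 6) + 5" "k3 \<le> ?E * 6 + 3" "k4 \<le> ?E * 4 + 3"
            using st1 st2 st3 1 by blast+
          moreover have "?E * (?E * 4 + 26) \<le> n * (n * 4 + 26)" "?N * (?E * 10 + 21) \<le> n * (n * 10 + 21)"
            "?E * (?E * 11 + 6) \<le> n * (n * 11 + 6)" using lens by (auto intro!: mult_mono)
          ultimately have "k1 + (k2 + (k3 + k4 + 1) + 1) + 1 + 4 \<le> ?bound"
            using lens by linarith
          thus ?case using opt out4 by blast
        qed
      qed
    qed (simp_all add: frame)
  qed
  show ?thesis
    unfolding dag_program_def enc
    by (rule wp_Seq, rule wp_Read, simp, simp, rule wp_Seq, rule wp_Read, simp, simp,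
        rule wp_step[OF main]) auto
qed

lemma dag_polynomial_time:
  "polynomial_time_minimizable dag_instances encode_dag_instance st_paths objective encode_vec"
proof (rule polynomial_time_minimizableI[where c = dag_program])
  show "poly_bounded (\<lambda>n. n * 4 + n * (n * 4 + 26) + n * (n * 10 + 21) + n * (n * 11 + 6) + n * 10 + 50)"
    by (intro poly_bounded_intros)
qed (rule wp_dag_program)

section \<open>Spanning trees\<close>

definition links :: "nat set set \<Rightarrow> (nat \<times> nat) set" where
  "links T = {(a, b). {a, b} \<in> T}"

text \<open>For sets of two-element edges, acyclicity means that every edge is a bridge.\<close>

definition forest :: "nat set set \<Rightarrow> bool" where
  "forest T \<longleftrightarrow> (\<forall>a b. {a, b} \<in> T \<and> a \<noteq> b \<longrightarrow> (a, b) \<notin> (links (T - {{a, b}}))\<^sup>*)"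

lemma links_mono: "T \<subseteq> T' \<Longrightarrow> (links T)\<^sup>* \<subseteq> (links T')\<^sup>*"
  by (intro rtrancl_mono) (auto simp: links_def)

lemma links_sym: "(a, b) \<in> (links T)\<^sup>* \<Longrightarrow> (b, a) \<in> (links T)\<^sup>*"
proof -
  have "sym (links T)" by (auto simp: links_def sym_def insert_commute)
  thus "(a, b) \<in> (links T)\<^sup>* \<Longrightarrow> (b, a) \<in> (links T)\<^sup>*" by (metis sym_rtrancl symD)
qed

lemma links_edge: "{a, b} \<in> T \<Longrightarrow> (a, b) \<in> (links T)\<^sup>*"
  by (auto simp: links_def)

text \<open>A path is extended vertex by vertex; if the new vertex already occurs, the path is cut
  off at that occurrence. Distinctness is what makes a closed path a cycle and lets a path use each
  edge at most once.\<close>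

lemma rtrancl_distinct_path:
  assumes "(a, b) \<in> r\<^sup>*"
  obtains vs where "vs \<noteq> []" "distinct vs" "hd vs = a" "last vs = b"
    "\<And>i. Suc i < length vs \<Longrightarrow> (vs ! i, vs ! Suc i) \<in> r"
proof -
  from assms have "\<exists>vs. vs \<noteq> [] \<and> distinct vs \<and> hd vs = a \<and> last vs = b \<and>
      (\<forall>i. Suc i < length vs \<longrightarrow> (vs ! i, vs ! Suc i) \<in> r)"
  proof (induction rule: rtrancl_induct)
    case base
    show ?case by (intro exI[of _ "[a]"]) simp
  next
    case (step b c)
    then obtain vs where vs: "vs \<noteq> []" "distinct vs" "hd vs = a" "last vs = b"
      "\<And>i. Suc i < length vs \<Longrightarrow> (vs ! i, vs ! Suc i) \<in> r" by blast
    show ?case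
    proof (cases "c \<in> set vs")
      case True
      then obtain k where k: "k < length vs" "vs ! k = c" by (metis in_set_conv_nth)
      hence "last (take (Suc k) vs) = c" "hd (take (Suc k) vs) = a"
        using vs by (auto simp: take_Suc_conv_app_nth hd_append hd_conv_nth)
      thus ?thesis using vs k by (intro exI[of _ "take (Suc k) vs"]) auto
    next
      case False
      have "((vs @ [c]) ! i, (vs @ [c]) ! Suc i) \<in> r" if i: "Suc i < length (vs @ [c])" for i
      proof (cases "Suc i < length vs")
        case True
        thus ?thesis using vs(5)[OF True] by (simp add: nth_append)
      next
        case False
        hence "i = length vs - 1" "Suc i = length vs" using i by auto
        thus ?thesis using vs(1,4) step(2) by (simp add: nth_append last_conv_nth)
      qed
      thus ?thesis using vs False by (intro exI[of _ "vs @ [c]"]) auto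
    qed
  qed
  thus thesis using that by blast
qed

text \<open>A cycle without one of its edges still joins the ends of that edge. Conversely, a simple
  path joining the ends of a removed edge closes up to a cycle when the edge is put back.\<close>

lemma forest_iff:
  assumes "\<And>e. e \<in> T \<Longrightarrow> card e = 2"
  shows "forest T \<longleftrightarrow> (\<nexists>vs. undirected_cycle T vs)"
proof
  assume forest: "forest T"
  show "\<nexists>vs. undirected_cycle T vs"
  proof
    assume "\<exists>vs. undirected_cycle T vs"
    then obtain vs where len: "3 \<le> length vs" and dist: "distinct vs"
      and edge: "\<And>i. i < length vs \<Longrightarrow> {vs ! i, vs ! (Suc i mod length vs)} \<in> T"
      unfolding undirected_cycle_def by blast
    have ne: "vs \<noteq> []" using len by auto
    have inj: "vs ! i \<noteq> vs ! j" if "i < length vs" "j < length vs" "i \<noteq> j" for i j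
      using that dist by (simp add: nth_eq_iff_index_eq)
    let ?a = "vs ! 0" and ?b = "vs ! 1" and ?T = "T - {{vs ! 0, vs ! 1}}"
    \<comment> \<open>Going around the cycle from its second vertex, no edge used contains both
      \<open>?a\<close> and \<open>?b\<close>, so the removed edge is avoided.\<close>
    have path: "(?b, vs ! Suc i) \<in> (links ?T)\<^sup>*" if "Suc i < length vs" for i
      using that
    proof (induction i)
      case (Suc i)
      have "{vs ! Suc i, vs ! Suc (Suc i)} \<in> T" using edge[of "Suc i"] Suc.prems by simp
      moreover have "vs ! Suc (Suc i) \<noteq> ?a" "vs ! Suc (Suc i) \<noteq> ?b"
        using inj[of "Suc (Suc i)" 0] inj[of "Suc (Suc i)" 1] Suc.prems ne by auto
      ultimately have "(vs ! Suc i, vs ! Suc (Suc i)) \<in> links ?T" by (auto simp: links_def doubleton_eq_iff)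
      thus ?case using Suc by (auto intro: rtrancl_into_rtrancl)
    qed simp
    let ?l = "vs ! (length vs - 1)"
    have "Suc (length vs - 1) = length vs" using len by simp
    hence "{?l, ?a} \<in> T" using edge[of "length vs - 1"] len by simp
    moreover have "?l \<noteq> ?a" "?l \<noteq> ?b"
      using inj[of "length vs - 1" 0] inj[of "length vs - 1" 1] len ne by auto
    ultimately have "(?l, ?a) \<in> links ?T" by (auto simp: links_def doubleton_eq_iff)
    moreover have "(?b, ?l) \<in> (links ?T)\<^sup>*" using path[of "length vs - 2"] len
      by (simp add: Suc_diff_Suc numeral_2_eq_2)
    ultimately have "(?a, ?b) \<in> (links ?T)\<^sup>*" by (meson links_sym rtrancl_into_rtrancl)
    moreover have "0 < length vs" "Suc 0 mod length vs = 1" using len by auto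
    hence "{?a, ?b} \<in> T" using edge[of 0] by simp
    moreover have "?a \<noteq> ?b" using inj[of 0 1] len ne by auto
    ultimately show False using forest by (simp add: forest_def)
  qed
next
  assume acyclic: "\<nexists>vs. undirected_cycle T vs"
  show "forest T"
    unfolding forest_def
  proof (intro allI impI notI)
    fix a b
    assume ab: "{a, b} \<in> T \<and> a \<noteq> b" "(a, b) \<in> (links (T - {{a, b}}))\<^sup>*"
    from ab(2) obtain vs where vs: "vs \<noteq> []" "distinct vs" "hd vs = a" "last vs = b"
      "\<And>i. Suc i < length vs \<Longrightarrow> (vs ! i, vs ! Suc i) \<in> links (T - {{a, b}})"
      by (rule rtrancl_distinct_path) blast
    have ends: "vs ! 0 = a" "vs ! (length vs - 1) = b"
      using vs by (simp_all add: hd_conv_nth last_conv_nth)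
    have "length vs \<noteq> 1" using ends ab(1) by auto
    \<comment> \<open>A path with just two vertices would consist of the removed edge
      itself.\<close>
    moreover have "length vs \<noteq> 2" using vs(5)[of 0] ends by (auto simp: links_def)
    moreover have "length vs \<noteq> 0" using vs(1) by simp
    ultimately have len: "3 \<le> length vs" by linarith
    have "{vs ! i, vs ! (Suc i mod length vs)} \<in> T" if "i < length vs" for i
    proof (cases "Suc i < length vs")
      case True
      thus ?thesis using vs(5)[OF True] by (auto simp: links_def)
    next
      case False
      hence "i = length vs - 1" "Suc i = length vs" using that by auto
      thus ?thesis using ends ab(1) by (simp add: insert_commute)
    qed
    hence "undirected_cycle T vs" using len vs(2) by (simp add: undirected_cycle_def)
    thus False using acyclic by blast
  qed
qed

text \<open>A connection never needs the new edge more than once; the last two cases are the two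
  directions of its use.\<close>

lemma links_insert:
  assumes "(a, b) \<in> (links (insert {x, y} G))\<^sup>*"
  shows "(a, b) \<in> (links G)\<^sup>* \<or> (a, x) \<in> (links G)\<^sup>* \<and> (y, b) \<in> (links G)\<^sup>* \<or>
    (a, y) \<in> (links G)\<^sup>* \<and> (x, b) \<in> (links G)\<^sup>*"
  using assms
proof (induction rule: rtrancl_induct)
  case (step b c)
  from step(2) consider "(b, c) \<in> links G" | "b = x" "c = y" | "b = y" "c = x"
    by (auto simp: links_def doubleton_eq_iff)
  thus ?case
  proof cases
    case 1
    thus ?thesis using step(3) by (meson rtrancl_into_rtrancl)
  qed (use step(3) in auto)
qed simp

lemma forest_subset: "forest T \<Longrightarrow> F \<subseteq> T \<Longrightarrow> forest F"
  unfolding forest_def by (meson Diff_mono links_mono subset_iff subset_refl)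

text \<open>If an old edge \<open>{a, b}\<close> were no longer a bridge, then the detour around it
  would pass through \<open>{x, y}\<close>. The two remaining pieces of the detour together with
  \<open>{a, b}\<close> would join \<open>x\<close> and \<open>y\<close> inside
  \<open>F\<close>.\<close>

lemma forest_insert:
  assumes forest: "forest F" and xy: "(x, y) \<notin> (links F)\<^sup>*"
  shows "forest (insert {x, y} F)"
  unfolding forest_def
proof (intro allI impI notI)
  fix a b
  assume ab: "{a, b} \<in> insert {x, y} F \<and> a \<noteq> b" "(a, b) \<in> (links (insert {x, y} F - {{a, b}}))\<^sup>*"
  show False
  proof (cases "{a, b} = {x, y}")
    case True
    hence "(a, b) \<in> (links F)\<^sup>*" using ab(2) links_mono[of "insert {x, y} F - {{a, b}}" F] by auto
    thus False using True xy links_sym by (auto simp: doubleton_eq_iff)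
  next
    case False
    let ?G = "F - {{a, b}}"
    have F: "{a, b} \<in> F" using ab False by auto
    have "insert {x, y} F - {{a, b}} = insert {x, y} ?G" using False by auto
    with ab(2) have "(a, b) \<in> (links (insert {x, y} ?G))\<^sup>*" by simp
    from links_insert[OF this] show False
    proof (elim disjE)
      assume "(a, b) \<in> (links ?G)\<^sup>*"
      thus False using forest F ab(1) by (simp add: forest_def)
    next
      assume "(a, x) \<in> (links ?G)\<^sup>* \<and> (y, b) \<in> (links ?G)\<^sup>*"
      hence "(a, x) \<in> (links F)\<^sup>*" "(y, b) \<in> (links F)\<^sup>*" using links_mono[of ?G F] by auto
      thus False using links_edge[OF F] xy by (meson links_sym rtrancl_trans)
    next
      assume "(a, y) \<in> (links ?G)\<^sup>* \<and> (x, b) \<in> (links ?G)\<^sup>*"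
      hence "(a, y) \<in> (links F)\<^sup>*" "(x, b) \<in> (links F)\<^sup>*" using links_mono[of ?G F] by auto
      thus False using links_edge[OF F] xy by (meson links_sym rtrancl_trans)
    qed
  qed
qed

text \<open>On a simple path take the edge that enters the first vertex outside \<open>S\<close>.
  Since no vertex repeats, the pieces before and after it do not use this edge, which is what the
  exchange argument needs.\<close>

lemma crossing_edge:
  assumes "(x, y) \<in> (links T)\<^sup>*" "x \<in> S" "y \<notin> S"
  obtains u v where "{u, v} \<in> T" "u \<in> S" "v \<notin> S"
    "(x, u) \<in> (links (T - {{u, v}}))\<^sup>*" "(v, y) \<in> (links (T - {{u, v}}))\<^sup>*"
proof -
  from assms(1) obtain vs where vs: "vs \<noteq> []" "distinct vs" "hd vs = x" "last vs = y"
    "\<And>i. Suc i < length vs \<Longrightarrow> (vs ! i, vs ! Suc i) \<in> links T"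
    by (rule rtrancl_distinct_path) blast
  have ends: "vs ! 0 = x" "vs ! (length vs - 1) = y"
    using vs by (simp_all add: hd_conv_nth last_conv_nth)
  define k where "k = (LEAST k. vs ! k \<notin> S)"
  have "vs ! (length vs - 1) \<notin> S" using assms(3) ends by simp
  hence k: "vs ! k \<notin> S" "k \<le> length vs - 1"
    unfolding k_def by (rule LeastI, rule Least_le)
  have "k \<noteq> 0" using k(1) ends(1) assms(2) by metis
  then obtain i where i: "k = Suc i" by (cases k) auto
  have "vs ! i \<in> S" using not_less_Least[of i "\<lambda>k. vs ! k \<notin> S"] i k_def by auto
  have len: "Suc i < length vs" using k(2) vs(1) i by (cases vs) auto
  let ?T = "T - {{vs ! i, vs ! Suc i}}"
  have step: "(vs ! j, vs ! Suc j) \<in> links ?T" if "Suc j < length vs" "j \<noteq> i" for j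
  proof -
    have "{vs ! j, vs ! Suc j} \<noteq> {vs ! i, vs ! Suc i}"
      using that len vs(2) by (auto simp: doubleton_eq_iff nth_eq_iff_index_eq)
    thus ?thesis using vs(5)[OF that(1)] by (simp add: links_def)
  qed
  have "(x, vs ! j) \<in> (links ?T)\<^sup>*" if "j \<le> i" for j
    using that
  proof (induction j)
    case (Suc j)
    thus ?case using step[of j] len by (auto intro: rtrancl_into_rtrancl)
  qed (simp add: ends)
  moreover have "(vs ! Suc i, vs ! j) \<in> (links ?T)\<^sup>*" if "Suc i \<le> j" "j < length vs" for j
    using that
  proof (induction j rule: dec_induct)
    case (step j)
    thus ?case using \<open>\<And>j. Suc j < length vs \<Longrightarrow> j \<noteq> i \<Longrightarrow> (vs ! j, vs ! Suc j) \<in> links ?T\<close>[of j]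
      by (auto intro: rtrancl_into_rtrancl)
  qed simp
  ultimately show thesis
    using that[of "vs ! i" "vs ! Suc i"] vs(5)[OF len] \<open>vs ! i \<in> S\<close> k(1) i len ends
    by (auto simp: links_def)
qed

section \<open>Exchanging edges of spanning trees\<close>

definition tree_on :: "nat set \<Rightarrow> nat set set \<Rightarrow> nat set set \<Rightarrow> bool" where
  "tree_on V E T \<longleftrightarrow> T \<subseteq> E \<and> V \<times> V \<subseteq> (links T)\<^sup>* \<and> forest T"

lemma undirected_spanning_tree_iff:
  assumes "\<And>e. e \<in> E \<Longrightarrow> card e = 2"
  shows "undirected_spanning_tree V E T \<longleftrightarrow> tree_on V E T"
proof -
  have "forest T \<longleftrightarrow> (\<nexists>vs. undirected_cycle T vs)" if "T \<subseteq> E"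
    using that assms by (intro forest_iff) auto
  thus ?thesis
    by (auto simp: undirected_spanning_tree_def tree_on_def undirected_connected_def links_def)
qed

text \<open>The removed edge lies on the path of \<open>T\<close> from \<open>x\<close> to
  \<open>y\<close> and crosses the same cut as \<open>{x, y}\<close>. If \<open>{x, y}\<close>
  already belongs to \<open>T\<close>, it is itself the removed edge; so the inserted edge is always
  new, and weights can be summed without distinguishing cases.\<close>

lemma tree_exchange:
  assumes T: "tree_on V E T" and xy: "{x, y} \<in> E" "x \<in> V" "y \<in> V" "x \<in> S" "y \<notin> S"
  obtains u v where "{u, v} \<in> T" "u \<in> S" "v \<notin> S" "{x, y} \<notin> T - {{u, v}}"
    "tree_on V E (insert {x, y} (T - {{u, v}}))"
proof -
  have "(x, y) \<in> (links T)\<^sup>*" using T xy by (auto simp: tree_on_def)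
  then obtain u v where uv: "{u, v} \<in> T" "u \<in> S" "v \<notin> S"
    "(x, u) \<in> (links (T - {{u, v}}))\<^sup>*" "(v, y) \<in> (links (T - {{u, v}}))\<^sup>*"
    using crossing_edge xy by metis
  let ?F = "T - {{u, v}}"
  let ?T = "insert {x, y} ?F"
  \<comment> \<open>Otherwise the two pieces of the path together with this connection would join
    \<open>u\<close> and \<open>v\<close> without their edge, although it is a bridge of
    \<open>T\<close>.\<close>
  have bridge: "(x, y) \<notin> (links ?F)\<^sup>*"
  proof
    assume "(x, y) \<in> (links ?F)\<^sup>*"
    hence "(u, v) \<in> (links ?F)\<^sup>*" using uv by (meson links_sym rtrancl_trans)
    moreover have "u \<noteq> v" using uv by auto
    ultimately show False using T uv(1) by (auto simp: tree_on_def forest_def)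
  qed
  have "forest ?T" using T by (intro forest_insert bridge) (auto simp: tree_on_def intro: forest_subset)
  moreover have "links T \<subseteq> (links ?T)\<^sup>*"
  proof
    fix p
    assume "p \<in> links T"
    then obtain a b where p: "p = (a, b)" "{a, b} \<in> T" by (auto simp: links_def)
    show "p \<in> (links ?T)\<^sup>*"
    proof (cases "{a, b} = {u, v}")
      case True
      have "(x, u) \<in> (links ?T)\<^sup>*" "(v, y) \<in> (links ?T)\<^sup>*"
        using uv links_mono[of ?F ?T] by auto
      moreover have "(x, y) \<in> (links ?T)\<^sup>*" by (intro links_edge) simp
      ultimately have "(u, v) \<in> (links ?T)\<^sup>*" by (meson links_sym rtrancl_trans)
      thus ?thesis using True p links_sym by (auto simp: doubleton_eq_iff)
    next
      case False
      thus ?thesis using p by (auto intro!: links_edge)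
    qed
  qed
  hence "(links T)\<^sup>* \<subseteq> (links ?T)\<^sup>*" by (metis rtrancl_idemp rtrancl_mono)
  moreover have "{x, y} \<notin> ?F" using bridge links_edge[of x y ?F] by auto
  ultimately show thesis
    using that[OF uv(1-3)] T xy(1) unfolding tree_on_def by blast
qed

section \<open>Minimum trees and the invariant of Prim's algorithm\<close>

definition minimum_tree :: "nat set \<Rightarrow> nat set set \<Rightarrow> (nat set \<Rightarrow> int) \<Rightarrow> nat set set \<Rightarrow> bool" where
  "minimum_tree V E w T \<longleftrightarrow> tree_on V E T \<and> (\<forall>T'. tree_on V E T' \<longrightarrow> sum w T \<le> sum w T')"

lemma minimum_tree_exists:
  assumes "finite E" "tree_on V E T"
  shows "\<exists>T. minimum_tree V E w T"
proof -
  have "finite {T. tree_on V E T}"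
    by (rule finite_subset[of _ "Pow E"]) (use assms(1) in \<open>auto simp: tree_on_def\<close>)
  thus ?thesis
    using ex_is_arg_min_if_finite[of "{T. tree_on V E T}" "sum w"] assms(2)
    unfolding minimum_tree_def is_arg_min_linorder by auto
qed

text \<open>The state of Prim's algorithm: the reached vertices \<open>S\<close> and the chosen edges \<open>F\<close>.\<close>

definition prim :: "nat set \<Rightarrow> nat set set \<Rightarrow> (nat set \<Rightarrow> int) \<Rightarrow> nat set \<Rightarrow> nat set set \<Rightarrow> bool" where
  "prim V E w S F \<longleftrightarrow> S \<subseteq> V \<and> (\<forall>e\<in>F. e \<subseteq> S) \<and> S \<times> S \<subseteq> (links F)\<^sup>* \<and>
     (\<exists>T. minimum_tree V E w T \<and> F \<subseteq> T)"

text \<open>The cut property: in a minimum tree containing \<open>F\<close>, the new edge replaces a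
  tree edge that also leaves \<open>S\<close> and is therefore at least as heavy.\<close>

lemma prim_step:
  assumes prim: "prim V E w S F" and fin: "finite E"
    and xy: "{x, y} \<in> E" "x \<in> S" "y \<in> V" "y \<notin> S"
    and min: "\<And>u v. {u, v} \<in> E \<Longrightarrow> u \<in> S \<Longrightarrow> v \<notin> S \<Longrightarrow> w {x, y} \<le> w {u, v}"
  shows "prim V E w (insert y S) (insert {x, y} F)"
proof -
  obtain T where T: "minimum_tree V E w T" "F \<subseteq> T" using prim by (auto simp: prim_def)
  have tree: "tree_on V E T" using T by (simp add: minimum_tree_def)
  have "x \<in> V" using prim xy by (auto simp: prim_def)
  from tree_exchange[OF tree xy(1) this xy(3,2,4)] obtain u v where
    uv: "{u, v} \<in> T" "u \<in> S" "v \<notin> S" "{x, y} \<notin> T - {{u, v}}"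
      "tree_on V E (insert {x, y} (T - {{u, v}}))" by blast
  let ?T = "insert {x, y} (T - {{u, v}})"
  have "T \<subseteq> E" using tree by (simp add: tree_on_def)
  hence "finite T" using fin by (rule finite_subset)
  hence "sum w ?T = w {x, y} + (sum w T - w {u, v})"
    using uv(1,4) by (subst sum.insert) (auto simp: sum_diff1)
  moreover have "w {x, y} \<le> w {u, v}" using min[of u v] uv \<open>T \<subseteq> E\<close> by auto
  ultimately have "sum w ?T \<le> sum w T" by linarith
  hence "minimum_tree V E w ?T"
    using T(1) uv(5) order.trans unfolding minimum_tree_def by blast
  \<comment> \<open>Edges of \<open>F\<close> have both ends in \<open>S\<close>, so the exchange
    never removes an edge that was chosen earlier.\<close>
  moreover have "{u, v} \<notin> F" using prim uv(3) by (auto simp: prim_def)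
  hence "insert {x, y} F \<subseteq> ?T" using T(2) by auto
  moreover have "insert y S \<times> insert y S \<subseteq> (links (insert {x, y} F))\<^sup>*"
  proof -
    let ?L = "(links (insert {x, y} F))\<^sup>*"
    have "S \<times> S \<subseteq> (links F)\<^sup>*" using prim by (simp add: prim_def)
    also have "\<dots> \<subseteq> ?L" by (rule links_mono) auto
    finally have S: "S \<times> S \<subseteq> ?L" .
    have "(x, y) \<in> ?L" by (intro links_edge) simp
    hence y: "(a, y) \<in> ?L" if "a \<in> insert y S" for a
    proof (cases "a = y")
      case False
      hence "(a, x) \<in> ?L" using S that xy(2) by auto
      thus ?thesis using \<open>(x, y) \<in> ?L\<close> by (rule rtrancl_trans)
    qed simp
    show ?thesis
    proof clarify
      fix a b
      assume "a \<in> insert y S" "b \<in> insert y S"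
      thus "(a, b) \<in> ?L" using y[of a] links_sym[OF y[of b]] by (blast intro: rtrancl_trans)
    qed
  qed
  moreover have "insert y S \<subseteq> V" "\<forall>e\<in>insert {x, y} F. e \<subseteq> insert y S"
    using prim xy(2,3) by (auto simp: prim_def)
  ultimately show ?thesis unfolding prim_def by blast
qed

lemma prim_crossing_edge:
  assumes "prim V E w S F" "s \<in> S" "S \<noteq> V"
  shows "\<exists>u v. {u, v} \<in> E \<and> u \<in> S \<and> v \<notin> S"
proof -
  obtain T where T: "T \<subseteq> E" "V \<times> V \<subseteq> (links T)\<^sup>*"
    using assms(1) by (auto simp: prim_def minimum_tree_def tree_on_def)
  have "S \<subseteq> V" using assms(1) by (simp add: prim_def)
  then obtain t where t: "t \<in> V" "t \<notin> S" using assms(3) by blast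
  hence "(s, t) \<in> (links T)\<^sup>*" using T(2) \<open>S \<subseteq> V\<close> assms(2) by blast
  then obtain u v where "{u, v} \<in> T" "u \<in> S" "v \<notin> S"
    using crossing_edge assms(2) t(2) by metis
  thus ?thesis using T(1) by blast
qed

text \<open>\<open>F\<close> already connects all vertices, so a further edge of the minimum tree
  around it would not be a bridge. Hence \<open>F\<close> is that tree.\<close>

lemma prim_complete:
  assumes "prim V E w V F" and E: "\<And>e. e \<in> E \<Longrightarrow> e \<subseteq> V \<and> card e = 2"
  shows "minimum_tree V E w F"
proof -
  obtain T where T: "minimum_tree V E w T" "F \<subseteq> T" using assms(1) by (auto simp: prim_def)
  have "e \<in> F" if e: "e \<in> T" for e
  proof (rule ccontr)
    assume "e \<notin> F"
    have "e \<in> E" using e T by (auto simp: minimum_tree_def tree_on_def)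
    then obtain a b where ab: "e = {a, b}" "a \<noteq> b" "a \<in> V" "b \<in> V"
      using E[of e] by (auto simp: card_2_iff)
    have "(a, b) \<in> (links F)\<^sup>*" using assms(1) ab by (auto simp: prim_def)
    moreover have "F \<subseteq> T - {e}" using T(2) \<open>e \<notin> F\<close> by auto
    ultimately have "(a, b) \<in> (links (T - {e}))\<^sup>*" using links_mono by blast
    thus False using T(1) e ab by (auto simp: minimum_tree_def tree_on_def forest_def)
  qed
  thus ?thesis using T by (metis subsetI subset_antisym)
qed

section \<open>Prim's algorithm on the machine\<close>

definition select_edge :: com where
  "select_edge = Cond (Times (Minus (Arr Reached (Arr Tail (Var Jx))) (Arr Reached (Arr Head (Var Jx))))
       (Minus (Arr Reached (Arr Tail (Var Jx))) (Arr Reached (Arr Head (Var Jx)))))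
     (Cond (Var Best)
        (Cond (Minus (Arr Weight (Minus (Var Best) (Const 1))) (Arr Weight (Var Jx)))
           (Assign (loc Best (Const 0)) (Plus (Var Jx) (Const 1))) Skip)
        (Assign (loc Best (Const 0)) (Plus (Var Jx) (Const 1))))
     Skip"

text \<open>Marking both ends avoids finding out which of them is new.\<close>

definition grow :: com where
  "grow = Cond (Var Best)
     (Seq (Assign (loc Reached (Arr Tail (Minus (Var Best) (Const 1)))) (Const 1))
        (Seq (Assign (loc Reached (Arr Head (Minus (Var Best) (Const 1)))) (Const 1))
           (Assign (loc Chosen (Minus (Var Best) (Const 1))) (Const 1))))
     Skip"

text \<open>The guard is for the empty graph, which has no start vertex. One round more than there
  are vertices to add is executed; as soon as all are reached, no edge crosses and
  \<open>grow\<close> does nothing.\<close>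

definition grow_tree :: com where
  "grow_tree = Seq (Cond (Var NodeCount) (Assign (loc Reached (Var Node)) (Const 1)) Skip)
     (For Ix NodeCount
        (Seq (Assign (loc Best (Const 0)) (Const 0)) (Seq (For Jx EdgeCount select_edge) grow)))"

definition tree_program :: com where
  "tree_program = Seq read_instance (Seq grow_tree write_solution)"

text \<open>
  The argument \<open>b\<close> is one plus the index of a lightest edge leaving \<open>S\<close>, or 0 if no edge
  leaves \<open>S\<close>.
\<close>

definition lightest :: "nat set list \<Rightarrow> (nat set \<Rightarrow> int) \<Rightarrow> nat set \<Rightarrow> nat \<Rightarrow> int \<Rightarrow> bool" where
  "lightest es w S j b \<longleftrightarrow> b = 0 \<and> (\<forall>i<j. (Min (es ! i) \<in> S) = (Max (es ! i) \<in> S)) \<or>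
     (\<exists>k<j. b = int k + 1 \<and> (Min (es ! k) \<in> S) \<noteq> (Max (es ! k) \<in> S) \<and>
        (\<forall>i<j. (Min (es ! i) \<in> S) \<noteq> (Max (es ! i) \<in> S) \<longrightarrow> w (es ! k) \<le> w (es ! i)))"

lemma lightest_same:
  "lightest es w S j b \<Longrightarrow> (Min (es ! j) \<in> S) = (Max (es ! j) \<in> S) \<Longrightarrow> lightest es w S (Suc j) b"
  unfolding lightest_def by (auto simp: less_Suc_eq)

lemma lightest_first:
  "lightest es w S j 0 \<Longrightarrow> (Min (es ! j) \<in> S) \<noteq> (Max (es ! j) \<in> S) \<Longrightarrow>
   lightest es w S (Suc j) (int j + 1)"
  unfolding lightest_def by (intro disjI2 exI[of _ j]) (auto simp: less_Suc_eq)

lemma lightest_replace: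
  "lightest es w S j (int k + 1) \<Longrightarrow> (Min (es ! j) \<in> S) \<noteq> (Max (es ! j) \<in> S) \<Longrightarrow>
   w (es ! j) < w (es ! k) \<Longrightarrow> lightest es w S (Suc j) (int j + 1)"
  unfolding lightest_def by (intro disjI2 exI[of _ j]) (fastforce simp: less_Suc_eq)

lemma lightest_keep:
  "lightest es w S j (int k + 1) \<Longrightarrow> w (es ! k) \<le> w (es ! j) \<Longrightarrow>
   lightest es w S (Suc j) (int k + 1)"
  unfolding lightest_def by (intro disjI2 exI[of _ k]) (auto simp: less_Suc_eq)

lemma wp_select_edge:
  assumes loaded: "graph_loaded Min Max es w st" and j: "j < length es" "st Jx 0 = int j"
    and reached: "\<And>v. st Reached (int v) = of_bool (v \<in> S)"
    and best: "lightest es w S j (st Best 0)"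
  shows "wp A select_edge (\<lambda>k st' inp' out'. k \<le> 4 \<and> inp' = inp \<and> out' = out \<and>
      lightest es w S (Suc j) (st' Best 0) \<and> (\<forall>x. x \<noteq> Best \<longrightarrow> st' x = st x)) st inp out"
proof -
  let ?a = "Min (es ! j)" and ?b = "Max (es ! j)"
  have e: "st Tail (int j) = int ?a" "st Head (int j) = int ?b" "st Weight (int j) = w (es ! j)"
    using loaded j(1) by (auto simp: graph_loaded_def)
  let ?c = "Times (Minus (Arr Reached (Arr Tail (Var Jx))) (Arr Reached (Arr Head (Var Jx))))
       (Minus (Arr Reached (Arr Tail (Var Jx))) (Arr Reached (Arr Head (Var Jx))))"
  \<comment> \<open>The squared difference of the two marks is positive exactly for a crossing edge
    in either orientation. Its right factor is -1, 0 or 1 and thus within the bound on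
    factors.\<close>
  have cond: "eval ?c (flat st) > 0 \<longleftrightarrow> (?a \<in> S) \<noteq> (?b \<in> S)" "mul_bounded A ?c (flat st)"
    by (auto simp: e j(2) reached)
  show ?thesis
  proof (cases "(?a \<in> S) = (?b \<in> S)")
    case True
    thus ?thesis
      unfolding select_edge_def using lightest_same[OF best] cond by (intro wp_Cond wp_Skip) auto
  next
    case cross: False
    show ?thesis
    proof (cases "st Best 0 > 0")
      case True
      then obtain k where k: "k < j" "st Best 0 = int k + 1"
        using best by (auto simp: lightest_def)
      have "st Weight (int k) = w (es ! k)" using loaded j(1) k(1) by (simp add: graph_loaded_def)
      moreover have best': "lightest es w S j (int k + 1)" using best k(2) by simp
      ultimately show ?thesis
        unfolding select_edge_def using cond cross k(2) e(3) j(2)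
          lightest_replace[OF best'] lightest_keep[OF best']
        by (intro wp_Cond wp_Skip wp_Assign) simp_all
    next
      case False
      hence "st Best 0 = 0" using best by (auto simp: lightest_def)
      thus ?thesis
        unfolding select_edge_def using cond cross best j(2) lightest_first[of es w S j]
        by (intro wp_Cond wp_Skip wp_Assign) simp_all
    qed
  qed
qed

abbreviation prim_store ::
  "nat set \<Rightarrow> nat set list \<Rightarrow> (nat set \<Rightarrow> int) \<Rightarrow> nat set \<Rightarrow> nat set set \<Rightarrow> store \<Rightarrow> bool" where
  "prim_store V es w S F st \<equiv> prim V (set es) w S F \<and>
     (\<forall>v. st Reached (int v) = of_bool (v \<in> S)) \<and>
     (\<forall>j<length es. st Chosen (int j) = of_bool (es ! j \<in> F))"

text \<open>The program knows an edge by its smaller and larger end, whereas the invariant needs it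
  directed out of \<open>S\<close>. This lemma supplies the orientation.\<close>

lemma prim_select:
  assumes prim: "prim V (set es) w S F" and es: "\<And>e. e \<in> set es \<Longrightarrow> e \<subseteq> V \<and> card e = 2"
    and best: "lightest es w S (length es) (int k + 1)"
  obtains x y where "k < length es" "es ! k = {x, y}" "x \<in> S" "y \<in> V" "y \<notin> S"
    "{Min (es ! k), Max (es ! k)} = {x, y}"
    "prim V (set es) w (insert y S) (insert (es ! k) F)"
proof -
  from best have k: "k < length es" "(Min (es ! k) \<in> S) \<noteq> (Max (es ! k) \<in> S)"
    and min: "\<And>i. i < length es \<Longrightarrow> (Min (es ! i) \<in> S) \<noteq> (Max (es ! i) \<in> S) \<Longrightarrow> w (es ! k) \<le> w (es ! i)"
    by (auto simp: lightest_def)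
  have pair: "e = {Min e, Max e}" if e: "e \<in> set es" for e
  proof -
    obtain a b where "e = {a, b}" using es[OF e] by (auto simp: card_2_iff)
    thus ?thesis by (cases "a \<le> b") (auto simp: max_def min_def)
  qed
  have ek: "es ! k \<in> set es" using k(1) by simp
  obtain x y where xy: "{Min (es ! k), Max (es ! k)} = {x, y}" "x \<in> S" "y \<notin> S"
    using k(2) by (cases "Min (es ! k) \<in> S") (blast, metis insert_commute)
  hence eq: "es ! k = {x, y}" using pair[OF ek] by simp
  have "y \<in> V" using es[OF ek] eq by auto
  moreover have "w {x, y} \<le> w {u, v}" if uv: "{u, v} \<in> set es" "u \<in> S" "v \<notin> S" for u v
  proof -
    obtain i where i: "i < length es" "es ! i = {u, v}" using uv(1) by (auto simp: in_set_conv_nth)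
    have "(Min (es ! i) \<in> S) \<noteq> (Max (es ! i) \<in> S)"
      unfolding i(2) using uv by (cases "u \<le> v") (auto simp: max_def min_def)
    thus ?thesis using min[OF i(1)] eq i(2) by simp
  qed
  ultimately have "prim V (set es) w (insert y S) (insert {x, y} F)"
    using prim_step[OF prim _ _ xy(2) _ xy(3)] ek eq by simp
  thus thesis using that[OF k(1) eq xy(2) \<open>y \<in> V\<close> xy(3,1)] eq by simp
qed

text \<open>\<open>i\<close> is the number of finished rounds, and the start vertex accounts for the
  additional element. The alternative \<open>S = V\<close> lets the number of rounds be fixed
  beforehand.\<close>

lemma wp_grow:
  assumes loaded: "graph_loaded Min Max es w st" and dist: "distinct es"
    and es: "\<And>e. e \<in> set es \<Longrightarrow> e \<subseteq> V \<and> card e = 2"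
    and prim: "prim_store V es w S F st" and S: "finite S" "S = V \<or> card S = Suc i"
    and best: "lightest es w S (length es) (st Best 0)"
  shows "wp A grow (\<lambda>k st' inp' out'. k \<le> 6 \<and> inp' = inp \<and> out' = out \<and>
      (\<exists>S F. prim_store V es w S F st' \<and> finite S \<and> (S = V \<or> card S = Suc (Suc i))) \<and>
      (\<forall>x. x \<notin> {Reached, Chosen} \<longrightarrow> st' x = st x)) st inp out"
proof (cases "st Best 0 > 0")
  case True
  then obtain k where k: "st Best 0 = int k + 1" using best by (auto simp: lightest_def)
  have prim': "prim V (set es) w S F" using prim by blast
  obtain x y where xy: "k < length es" "es ! k = {x, y}" "x \<in> S" "y \<in> V" "y \<notin> S"
    "{Min (es ! k), Max (es ! k)} = {x, y}" "prim V (set es) w (insert y S) (insert (es ! k) F)"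
    by (rule prim_select[OF prim' es best[unfolded k]]) blast+
  let ?a = "Min (es ! k)" and ?b = "Max (es ! k)"
  let ?st = "st(Reached := (st Reached)(int ?a := 1, int ?b := 1), Chosen := (st Chosen)(int k := 1))"
  have ab: "st Tail (int k) = int ?a" "st Head (int k) = int ?b"
    using loaded xy(1) by (auto simp: graph_loaded_def)
  have "?st Reached (int v) = of_bool (v \<in> insert y S)" for v
  proof -
    have "v = ?a \<or> v = ?b \<longleftrightarrow> v = x \<or> v = y" using xy(6) by blast
    thus ?thesis using prim xy(3) by auto
  qed
  moreover have "?st Chosen (int j) = of_bool (es ! j \<in> insert (es ! k) F)" if "j < length es" for j
    using prim dist xy(1) that by (simp add: nth_eq_iff_index_eq)
  ultimately have "prim_store V es w (insert y S) (insert (es ! k) F) ?st" using xy(7) by blast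
  moreover have "S \<noteq> V" using xy(4,5) by blast
  hence "card (insert y S) = Suc (Suc i)" using S xy(5) by simp
  ultimately have "\<exists>S F. prim_store V es w S F ?st \<and> finite S \<and> (S = V \<or> card S = Suc (Suc i))"
    using S(1) by blast
  moreover have "\<forall>x. x \<notin> {Reached, Chosen} \<longrightarrow> ?st x = st x" by simp
  ultimately show ?thesis
    unfolding grow_def using k ab by (intro wp_rules) simp_all
next
  case False
  hence zero: "st Best 0 = 0" and same: "\<And>i. i < length es \<Longrightarrow> (Min (es ! i) \<in> S) = (Max (es ! i) \<in> S)"
    using best by (auto simp: lightest_def)
  \<comment> \<open>Otherwise connectivity would provide an edge leaving the nonempty set
    \<open>S\<close>, but the search has found none.\<close>
  have "S = V"
  proof (rule ccontr)
    assume "S \<noteq> V"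
    hence "card S = Suc i" using S by blast
    then obtain s where "s \<in> S" by fastforce
    have "prim V (set es) w S F" using prim by blast
    from prim_crossing_edge[OF this \<open>s \<in> S\<close> \<open>S \<noteq> V\<close>] obtain u v where
      uv: "{u, v} \<in> set es" "u \<in> S" "v \<notin> S" by blast
    then obtain i where i: "i < length es" "es ! i = {u, v}" by (auto simp: in_set_conv_nth)
    have "(Min (es ! i) \<in> S) \<noteq> (Max (es ! i) \<in> S)"
      unfolding i(2) using uv by (cases "u \<le> v") (auto simp: max_def min_def)
    thus False using same[OF i(1)] by blast
  qed
  hence "\<exists>S F. prim_store V es w S F st \<and> finite S \<and> (S = V \<or> card S = Suc (Suc i))"
    using prim S(1) by blast
  thus ?thesis unfolding grow_def using zero by (intro wp_Cond wp_Skip) simp_all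
qed

lemma wp_grow_tree:
  assumes loaded: "graph_loaded Min Max es w st" and dist: "distinct es"
    and es: "\<And>e. e \<in> set es \<Longrightarrow> e \<subseteq> V \<and> card e = 2"
    and V: "finite V" "st NodeCount 0 = int (card V)" "V \<noteq> {} \<Longrightarrow> st Node 0 = int s \<and> s \<in> V"
    and zero: "st Reached = (\<lambda>_. 0)" "st Chosen = (\<lambda>_. 0)"
    and tree: "tree_on V (set es) T"
  shows "wp A grow_tree (\<lambda>k st' inp' out'. k \<le> card V * (length es * 7 + 15) + 6 \<and> inp' = inp \<and> out' = out \<and>
      st' EdgeCount = st EdgeCount \<and>
      (\<exists>F. minimum_tree V (set es) w F \<and> (\<forall>j<length es. st' Chosen (int j) = of_bool (es ! j \<in> F)))) st inp out"
proof -
  let ?m = "length es" and ?n = "card V"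
  let ?S0 = "if V = {} then {} else {s}"
  let ?st = "if V = {} then st else st(Reached := (st Reached)(int s := 1))"
  let ?frame = "\<lambda>st'. \<forall>x. x \<notin> {Reached, Chosen, Best, Ix, Jx} \<longrightarrow> st' x = st x"
  let ?P = "\<lambda>i S F st'. prim_store V es w S F st' \<and> finite S \<and> (S = V \<or> card S = Suc i)"
  let ?I = "\<lambda>i st' inp' out'. inp' = inp \<and> out' = out \<and> ?frame st' \<and> (\<exists>S F. ?P i S F st')"
  \<comment> \<open>The given tree \<open>T\<close> guarantees that a minimum tree exists; nothing
    has been chosen yet, so any one of them contains the empty edge set.\<close>
  have prim0: "prim V (set es) w ?S0 {}"
    using V(3) minimum_tree_exists[OF _ tree, of w] by (auto simp: prim_def)
  have loop: "wp A (For Ix NodeCount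
        (Seq (Assign (loc Best (Const 0)) (Const 0)) (Seq (For Jx EdgeCount select_edge) grow)))
      (\<lambda>k st' inp' out'. k \<le> ?n * (?m * 7 + 12 + 3) + 3 \<and> ?I ?n st' inp' out') ?st inp out"
  proof (rule wp_For[where Inv = ?I])
    have "?P 0 ?S0 {} (?st(Ix := (?st Ix)(0 := 0)))"
      using prim0 zero by (simp add: of_bool_def)
    moreover have "?frame (?st(Ix := (?st Ix)(0 := 0)))" by simp
    ultimately show "?I 0 (?st(Ix := (?st Ix)(0 := 0))) inp out" by blast
  next
    fix i st1 inp1 out1
    assume "?I i st1 inp1 out1"
    hence "st1 NodeCount = st NodeCount" by simp
    thus "st1 NodeCount 0 = int ?n" using V(2) by simp
  next
    fix i st1 inp1 out1
    assume i: "i < ?n" "st1 Ix 0 = int i" and I: "?I i st1 inp1 out1"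
    then obtain S F where P: "prim_store V es w S F st1" "finite S" "S = V \<or> card S = Suc i" by blast
    let ?st1 = "st1(Best := (st1 Best)(0 := 0))"
    let ?J = "\<lambda>j st' inp' out'. inp' = inp1 \<and> out' = out1 \<and> lightest es w S j (st' Best 0) \<and>
      (\<forall>x. x \<notin> {Best, Jx} \<longrightarrow> st' x = st1 x)"
    have loaded': "graph_loaded Min Max es w st'" if "\<forall>x. x \<notin> {Best, Jx} \<longrightarrow> st' x = st1 x" for st'
      by (rule graph_loaded_frame[OF loaded]) (use that I in simp_all)
    have select: "wp A (For Jx EdgeCount select_edge)
        (\<lambda>k st' inp' out'. k \<le> ?m * (4 + 3) + 3 \<and> ?J ?m st' inp' out') ?st1 inp1 out1"
    proof (rule wp_For[where Inv = ?J])
      show "?J 0 (?st1(Jx := (?st1 Jx)(0 := 0))) inp1 out1" by (simp add: lightest_def)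
    next
      fix j st2 inp2 out2
      assume "?J j st2 inp2 out2"
      thus "st2 EdgeCount 0 = int ?m" using loaded'[of st2] by (simp add: graph_loaded_def)
    next
      fix j st2 inp2 out2
      assume j: "j < ?m" "st2 Jx 0 = int j" and J: "?J j st2 inp2 out2"
      have "st2 Reached (int v) = of_bool (v \<in> S)" for v using J P(1) by simp
      from wp_select_edge[where st = st2, OF _ j this, of w] J loaded'[of st2]
      have "wp A select_edge (\<lambda>k st' inp' out'. k \<le> 4 \<and> inp' = inp2 \<and> out' = out2 \<and>
        lightest es w S (Suc j) (st' Best 0) \<and> (\<forall>x. x \<noteq> Best \<longrightarrow> st' x = st2 x)) st2 inp2 out2" by blast
      thus "wp A select_edge (\<lambda>k st' inp' out'. k \<le> 4 \<and> st' Jx 0 = int j \<and>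
          ?J (Suc j) (st'(Jx := (st' Jx)(0 := int (Suc j)))) inp' out') st2 inp2 out2"
        by (rule wp_mono) (use j J in simp)
    qed
    show "wp A (Seq (Assign (loc Best (Const 0)) (Const 0)) (Seq (For Jx EdgeCount select_edge) grow))
        (\<lambda>k st' inp' out'. k \<le> ?m * 7 + 12 \<and> st' Ix 0 = int i \<and>
          ?I (Suc i) (st'(Ix := (st' Ix)(0 := int (Suc i)))) inp' out') st1 inp1 out1"
    proof (rule wp_Seq, rule wp_Assign, simp, simp, rule wp_Seq, rule wp_step[OF select], goal_cases)
      case (4 k2 st2 inp2 out2)
      hence eq: "inp2 = inp1" "out2 = out1" and J: "?J ?m st2 inp2 out2" by blast+
      have "prim_store V es w S F st2" using P(1) J by simp
      from wp_grow[OF loaded' dist es this P(2,3)] J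
      have "wp A grow (\<lambda>k st' inp' out'. k \<le> 6 \<and> inp' = inp1 \<and> out' = out1 \<and>
          (\<exists>S F. ?P (Suc i) S F st') \<and> (\<forall>x. x \<notin> {Reached, Chosen} \<longrightarrow> st' x = st2 x)) st2 inp1 out1" by blast
      thus ?case
        unfolding eq
      proof (rule wp_mono, goal_cases)
        case (1 k3 st3 inp3 out3)
        then obtain S' F' where "?P (Suc i) S' F' st3" by blast
        hence "?P (Suc i) S' F' (st3(Ix := (st3 Ix)(0 := int (Suc i))))" by simp
        moreover have "?frame (st3(Ix := (st3 Ix)(0 := int (Suc i))))" using 1 J I by simp
        moreover have "st3 Ix 0 = int i" using 1 J i(2) by simp
        moreover have "inp3 = inp" "out3 = out" using 1 I by simp_all
        moreover have "k2 \<le> ?m * (4 + 3) + 3" "k3 \<le> 6" using 1 4 by blast+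
        hence "1 + (k2 + k3 + 1) + 1 \<le> ?m * 7 + 12" by simp
        ultimately show ?case by blast
      qed
    qed simp_all
  qed
  let ?Q = "\<lambda>k st' inp' out'. k \<le> ?n * (?m * 7 + 15) + 3 \<and> inp' = inp \<and> out' = out \<and>
      st' EdgeCount = st EdgeCount \<and>
      (\<exists>F. minimum_tree V (set es) w F \<and> (\<forall>j<?m. st' Chosen (int j) = of_bool (es ! j \<in> F)))"
  have final: "?Q k st' inp' out'"
    if I: "k \<le> ?n * (?m * 7 + 12 + 3) + 3 \<and> ?I ?n st' inp' out'" for k st' inp' out'
  proof -
    from I obtain S F where P: "?P ?n S F st'" by blast
    hence prim: "prim V (set es) w S F" by blast
    \<comment> \<open>After \<open>?n\<close> rounds the invariant leaves only \<open>S = V\<close>,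
      because \<open>Suc ?n\<close> elements do not fit into \<open>V\<close>.\<close>
    hence "card S \<le> ?n" using V(1) by (intro card_mono) (auto simp: prim_def)
    hence "S = V" using P by auto
    hence "minimum_tree V (set es) w F" using prim_complete[of V "set es" w F] prim es by blast
    moreover have "\<forall>j<?m. st' Chosen (int j) = of_bool (es ! j \<in> F)" using P by blast
    moreover have "k \<le> ?n * (?m * 7 + 15) + 3" "st' EdgeCount = st EdgeCount"
      using I by (simp_all add: add.commute)
    ultimately show ?thesis using I by blast
  qed
  have completed: "wp A (For Ix NodeCount
      (Seq (Assign (loc Best (Const 0)) (Const 0)) (Seq (For Jx EdgeCount select_edge) grow))) ?Q ?st inp out"
    by (rule wp_mono[OF loop final])
  show ?thesis
    unfolding grow_tree_def
  proof (rule wp_Seq, rule wp_Cond, goal_cases)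
    case 2
    hence "V \<noteq> {}" using V by auto
    thus ?case
      using V(3) by (intro wp_Assign wp_step[OF completed]) simp_all
  next
    case 3
    hence "V = {}" using V by auto
    thus ?case by (intro wp_Skip wp_step[OF completed]) simp_all
  qed simp
qed

lemma wp_tree_program:
  assumes I: "I \<in> graph_instances"
  defines "n \<equiv> input_size (encode_graph_instance I)"
  shows "wp (2 * n) tree_program
    (\<lambda>k st inp out. k \<le> n * 4 + n * (n * 4 + 26) + n * (n * 10 + 21) + n * (n * 7 + 15) + n * 4 + 50 \<and>
      (\<exists>x. is_arg_min (objective I) (\<lambda>y. y \<in> spanning_trees I) x \<and> out = encode_vec I x))
    (\<lambda>_ _. 0) (encode_graph_instance I) []"
proof -
  let ?es = "items I" and ?X = "spanning_trees I"
  let ?bound = "n * 4 + n * (n * 4 + 26) + n * (n * 10 + 21) + n * (n * 7 + 15) + n * 4 + 50"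
  let ?V = "length (nodes I)" and ?E = "length (items I)" and ?N = "length (history I)"
  have valid: "valid_data ?X I" and es: "\<And>e. e \<in> set ?es \<Longrightarrow> e \<subseteq> set (nodes I) \<and> card e = 2"
    and dist: "distinct ?es" "distinct (nodes I)"
    and alpha: "0 < alpha I" "alpha I < 1" and hist: "history I \<noteq> []" "fst ` set (history I) \<subseteq> ?X"
    using I by (auto simp: graph_instances_def valid_data_def)
  have trees: "?X = {char_vec (set ?es) T |T. tree_on (set (nodes I)) (set ?es) T}"
    using undirected_spanning_tree_iff[of "set ?es"] es by (simp add: spanning_trees_def)
  have binary: "\<forall>x\<in>?X. \<forall>j\<in>set ?es. x j \<in> {0, 1}"
    by (auto simp: spanning_trees_def char_vec_def)
  have weight_sum: "(\<Sum>j\<in>set ?es. w j * int (char_vec (set ?es) T j)) = sum w T"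
    if "tree_on (set (nodes I)) (set ?es) T" for T and w :: "nat set \<Rightarrow> int"
    using that by (intro sum_char_vec) (auto simp: tree_on_def)
  have lens: "?V \<le> n" "?E \<le> n" "?N \<le> n"
    using lengths_le_input_size[of I "[]" "\<lambda>e. [int (Min e), int (Max e)]"]
    by (simp_all add: n_def encode_graph_instance_def)
  have read: "wp (2 * n) read_instance (\<lambda>k st' inp' out'.
      k \<le> ?V * 4 + ?E * (?E * 4 + 26) + ?N * (?E * 10 + 21) + 32 \<and> out' = [] \<and> loaded I Min Max st' \<and>
      (\<forall>x\<in>{Src, Snk, Chosen, Reached, Dist, Via}. st' x = (\<lambda>_. 0))) (\<lambda>_ _. 0) (encode_graph_instance I) []"
    unfolding encode_graph_instance_def
  proof (rule wp_read_instance)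
    show "set (encode (\<lambda>e. [int (Min e), int (Max e)]) I) \<subseteq> {v. \<bar>v\<bar> \<le> 2 ^ n}"
      using abs_le_power_input_size[of _ "encode_graph_instance I"]
      unfolding n_def encode_graph_instance_def by auto
    show "x j \<in> {0, 1}" if "(x, l) \<in> set (history I)" "j \<in> set ?es" for x l j
    proof -
      have "x \<in> ?X" using hist(2) imageI[OF that(1), of fst] by auto
      thus ?thesis using binary that(2) by blast
    qed
  qed (use alpha in auto)
  show ?thesis
    unfolding tree_program_def
  proof (rule wp_Seq_mono[OF read], goal_cases)
    case (1 k1 st1 inp1 out1)
    note st1 = 1
    hence out1: "out1 = []" and zero: "\<And>x. x \<in> {Src, Snk, Chosen, Reached, Dist, Via} \<Longrightarrow> st1 x = (\<lambda>_. 0)"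
      by blast+
    have "represents st1 ?E (\<lambda>j. linear_weight I (?es ! j))" using st1 by (simp add: loaded_def)
    from represents_objective[OF valid binary this] obtain w where
      weight: "\<And>j. j < ?E \<Longrightarrow> st1 Weight (int j) = w (?es ! j)"
      and obj: "\<And>x y. x \<in> ?X \<Longrightarrow> y \<in> ?X \<Longrightarrow> (\<Sum>j\<in>set ?es. w j * int (x j)) \<le> (\<Sum>j\<in>set ?es. w j * int (y j)) \<Longrightarrow>
        objective I x \<le> objective I y" by blast
    have graph: "graph_loaded Min Max ?es w st1"
      using st1 weight by (simp add: graph_loaded_def loaded_def)
    \<comment> \<open>A historic solution is a spanning tree, which shows that the graph is
      connected.\<close>
    obtain x where "x \<in> ?X" using hist by (cases "history I") auto
    then obtain T where T: "tree_on (set (nodes I)) (set ?es) T" unfolding trees by blast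
    have nodes: "st1 NodeCount 0 = int (card (set (nodes I)))"
      "set (nodes I) \<noteq> {} \<Longrightarrow> st1 Node 0 = int (last (nodes I)) \<and> last (nodes I) \<in> set (nodes I)"
      using st1 dist(2) by (simp_all add: loaded_def distinct_card)
    have "st1 Reached = (\<lambda>_. 0)" "st1 Chosen = (\<lambda>_. 0)" by (simp_all add: zero)
    note grow = wp_grow_tree[OF graph dist(1) es finite_set nodes this T]
    show ?case
      unfolding out1
    proof (rule wp_Seq_mono[OF grow], goal_cases)
      case (3 k2 st2 inp2 out2)
      note st2 = 3
      hence out2: "out2 = []" by blast
      from st2 obtain F where F: "minimum_tree (set (nodes I)) (set ?es) w F"
        "\<And>j. j < ?E \<Longrightarrow> st2 Chosen (int j) = of_bool (?es ! j \<in> F)" by blast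
      let ?x = "char_vec (set ?es) F"
      have tree: "tree_on (set (nodes I)) (set ?es) F" using F(1) by (simp add: minimum_tree_def)
      hence x: "?x \<in> ?X" unfolding trees by blast
      have "objective I ?x \<le> objective I y" if y: "y \<in> ?X" for y
      proof -
        obtain T where T: "y = char_vec (set ?es) T" "tree_on (set (nodes I)) (set ?es) T"
          using y unfolding trees by blast
        have "sum w F \<le> sum w T" using F(1) T(2) by (simp add: minimum_tree_def)
        thus ?thesis using obj[OF x y] T tree by (simp add: weight_sum)
      qed
      hence opt: "is_arg_min (objective I) (\<lambda>y. y \<in> ?X) ?x"
        using x by (auto simp: is_arg_min_linorder)
      have "st2 EdgeCount 0 = int ?E" using st2 graph by (simp add: graph_loaded_def)
      note writing = wp_write_solution[where st = st2 and m = ?E, OF this]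
      show ?case
        unfolding out2
      proof (rule wp_mono[OF writing], goal_cases)
        case (1 k3 st3 inp3 out3)
        have out3: "out3 = encode_vec I ?x"
          using 1 encode_vec_char_vec[of I "\<lambda>j. st2 Chosen (int j)" F] F(2) by simp
        have "k1 \<le> ?V * 4 + ?E * (?E * 4 + 26) + ?N * (?E * 10 + 21) + 32"
          "k2 \<le> card (set (nodes I)) * (?E * 7 + 15) + 6" "k3 \<le> ?E * 4 + 3"
          using st1 st2 1 by blast+
        moreover have "?E * (?E * 4 + 26) \<le> n * (n * 4 + 26)" "?N * (?E * 10 + 21) \<le> n * (n * 10 + 21)"
          using lens by (auto intro!: mult_mono)
        moreover have "card (set (nodes I)) * (?E * 7 + 15) \<le> n * (n * 7 + 15)"
          using lens dist(2) by (intro mult_mono) (auto simp: distinct_card)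
        ultimately have "k1 + (k2 + k3 + 1) + 1 \<le> ?bound"
          using lens by linarith
        thus ?case using opt out3 by blast
      qed
    qed
  qed
qed

lemma tree_polynomial_time:
  "polynomial_time_minimizable graph_instances encode_graph_instance spanning_trees objective encode_vec"
proof (rule polynomial_time_minimizableI[where c = tree_program])
  show "poly_bounded (\<lambda>n. n * 4 + n * (n * 4 + 26) + n * (n * 10 + 21) + n * (n * 7 + 15) + n * 4 + 50)"
    by (intro poly_bounded_intros)
qed (rule wp_tree_program)

theorem corollary4:
  shows "polynomial_time_minimizable dag_instances encode_dag_instance st_paths objective encode_vec
    \<and> polynomial_time_minimizable graph_instances encode_graph_instance spanning_trees objective encode_vec"
  using dag_polynomial_time tree_polynomial_time by blast

end
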